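(* Let $\mathsf{C}$ be an operator space coalgebra, $\mathsf{k}$ a complex Hilbert space, $\widehat{\mathsf{k}}=\mathbb{C}\oplus\mathsf{k}$, and let $\varphi\in CB(\mathsf{C};B(\widehat{\mathsf{k}}))$. Then $l^\varphi$, the unique weak solution of the operator space coalgebraic quantum stochastic differential equation $dk_t=k_t\star d\Lambda_\varphi(t)$, $k_0=\iota_{\mathcal{F}}\circ\epsilon$, is a Markov-regular weak quantum stochastic convolution cocycle, each of whose associated convolution semigroups of functionals is norm continuous.
   Context: Operator space coalgebra: an operator space $\mathsf{C}$ with complete contractions $\epsilon:\mathsf{C}\to\mathbb{C}$ (counit) and $\Delta:\mathsf{C}\to\mathsf{C}\otimes\mathsf{C}$ (coproduct; $\otimes$ = spatial tensor product) with $(\Delta\otimes\mathrm{id})\circ\Delta=(\mathrm{id}\otimes\Delta)\circ\Delta$ and $(\epsilon\otimes\mathrm{id})\circ\Delta=\mathrm{id}_{\mathsf{C}}=(\mathrm{id}\otimes\epsilon)\circ\Delta$. Convolution: $\varphi_1\star\varphi_2:=(\varphi_1\otimes\varphi_2)\circ\Delta$ for completely bounded maps (in particular bounded functionals) on $\mathsf{C}$. A convolution semigroup of functionals is a family $(\lambda_t)_{t\ge0}$ in $\mathsf{C}^*$ with $\lambda_0=\epsilon$, $\lambda_{s+t}=\lambda_s\star\lambda_t$. Fock space notation (inner products linear in the second argument): $\widehat{c}:=(1,c)\in\widehat{\mathsf{k}}$ for $c\in\mathsf{k}$; $\widehat{f}(s):=\widehat{f(s)}$. $f_I$ equals $f$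 on $I$ and zero elsewhere; $c_I$ is the function equal to $c$ on $I$, zero elsewhere. $\mathbb{S}$ is the linear span of $\{c_{[0,t[}:c\in\mathsf{k},t\ge0\}$ in $L^2(\mathbb{R}_+;\mathsf{k})$ (right-continuous versions). $\mathcal{F}$ is the symmetric Fock space over $L^2(\mathbb{R}_+;\mathsf{k})$, $\varepsilon(f)=((n!)^{-1/2}f^{\otimes n})_{n\ge0}$, $\mathcal{E}=\mathrm{Lin}\{\varepsilon(f):f\in\mathbb{S}\}$. $(S_t)_{t\ge0}$ are the right shifts on $L^2(\mathbb{R}_+;\mathsf{k})$. $\iota_{\mathcal{F}}\circ\epsilon$ is $x\mapsto\epsilon(x)I_{\mathcal{F}}$. Process on $\mathsf{C}$ (element of $\mathbb{P}_\star(\mathsf{C})$): a family $k=(k_t)_{t\ge0}$ of linear maps from $\mathsf{C}$ to the linear operators on $\mathcal{F}$ with domain $\mathcal{E}$ such that, with $k_t^{\varepsilon',\varepsilon}(x):=\langle\varepsilon',k_t(x)\varepsilon\rangle$, $s\mapsto k_s^{\varepsilon',\varepsilon}(x)$ is measurable and $k_t^{\varepsilon',\varepsilon}=\langle\varepsilon(f'_{[t,\infty[}),\varepsilon(f_{[t,\infty[})\rangle\,k_t^{\varepsilon(f'_{[0,t[}),\varepsilon(f_{[0,t[})}$ for $\varepsilon=\varepsilon(f),\varepsilon'=\varepsilon(f')\in\mathcal{E}$. Processes are identified if all their matrix elements $t\mapsto k_t^{\varepsilon',\varepsilon}(x)$ agree for a.e. $t$. $k$ is weakly initial space bounded if each $k_t^{\varepsilon',\varepsilon}:\mathsf{C}\to\mathbb{C}$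 is bounded. Weak solution of the displayed equation: a weakly initial space bounded process $k$ such that, with $\varphi^{\zeta',\zeta}(x):=\langle\zeta',\varphi(x)\zeta\rangle$, $s\mapsto(k_s^{\varepsilon',\varepsilon}\star\varphi^{\zeta',\zeta})(x)$ is continuous and $k_t^{\varepsilon',\varepsilon}(x)=\langle\varepsilon',\varepsilon\rangle\epsilon(x)+\int_0^t(k_s^{\varepsilon',\varepsilon}\star\varphi^{\widehat{f'}(s),\widehat{f}(s)})(x)\,ds$ for all $\zeta,\zeta'\in\widehat{\mathsf{k}}$, $\varepsilon=\varepsilon(f),\varepsilon'=\varepsilon(f')\in\mathcal{E}$, $x\in\mathsf{C}$, $t\ge0$. It exists and is unique; it is denoted $l^\varphi$. Weak quantum stochastic convolution cocycle: a weakly initial space bounded process $l$ with \[ l_{s+t}^{\varepsilon',\varepsilon}=\langle\varepsilon'_3,\varepsilon_3\rangle\,l_s^{\varepsilon'_1,\varepsilon_1}\star l_t^{\varepsilon'_2,\varepsilon_2} \] for $\varepsilon=\varepsilon(f),\varepsilon'=\varepsilon(f')\in\mathcal{E}$, $s,t\ge0$, where $\varepsilon_1=\varepsilon(f_{[0,s[})$, $\varepsilon_2=\varepsilon(S_s^*f_{[s,s+t[})$, $\varepsilon_3=\varepsilon(f_{[s+t,\infty[})$ and $\varepsilon'_i$ are defined likewise from $f'$. Its associated convolution semigroups of functionals are $\lambda^{c',c}=(\lambda^{c',c}_t)_{t\ge0}$, $c,c'\in\mathsf{k}$, where $\lambda_t^{c',c}:=e^{-t\langle c',c\rangle}\,l_t^{\varepsilon(c'_{[0,t[}),\varepsilon(c_{[0,t[})}$.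 It is Markov-regular if $\lambda^{0,0}$ is norm continuous in $t$. *)

theory Defs
  imports "HOL-Analysis.Analysis"
begin

section \<open>Complex normed spaces and Hilbert spaces\<close>

class complex_normed_vector = real_normed_vector +
  fixes scaleC :: "complex \<Rightarrow> 'a \<Rightarrow> 'a" (infixr "*\<^sub>C" 75)
  assumes scaleC_add_right: "c *\<^sub>C (x + y) = c *\<^sub>C x + c *\<^sub>C y"
    and scaleC_add_left: "(c + d) *\<^sub>C x = c *\<^sub>C x + d *\<^sub>C x"
    and scaleC_scaleC: "c *\<^sub>C (d *\<^sub>C x) = (c * d) *\<^sub>C x"
    and scaleC_of_real: "complex_of_real r *\<^sub>C x = r *\<^sub>R x"
    and norm_scaleC: "norm (c *\<^sub>C x) = cmod c * norm x"

text \<open>Inner products are linear in the second argument.\<close>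

class complex_hilbert = complex_normed_vector + real_inner + complete_space +
  fixes cinner :: "'a \<Rightarrow> 'a \<Rightarrow> complex"
  assumes cinner_commute: "cinner x y = cnj (cinner y x)"
    and cinner_add_right: "cinner x (y + z) = cinner x y + cinner x z"
    and cinner_scaleC_right: "cinner x (c *\<^sub>C y) = c * cinner x y"
    and Re_cinner: "Re (cinner x y) = inner x y"

lemma scaleC_one [simp]: "1 *\<^sub>C (x::'a::complex_normed_vector) = x"
  using scaleC_of_real[of 1 x] by simp

lemma bounded_linear_scaleC_right: "bounded_linear ((*\<^sub>C) c :: 'a::complex_normed_vector \<Rightarrow> 'a)"
proof (rule bounded_linear_intro[of _ "cmod c"])
  fix r and x :: 'a
  show "c *\<^sub>C (r *\<^sub>R x) = r *\<^sub>R (c *\<^sub>C x)"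
    by (metis mult.commute scaleC_of_real scaleC_scaleC)
qed (auto simp: scaleC_add_right norm_scaleC)

lemma scaleC_zero_right [simp]: "c *\<^sub>C (0::'a::complex_normed_vector) = 0"
  using bounded_linear_scaleC_right linear_0 bounded_linear.linear by blast

lemma cinner_add_left: "cinner (x + y) (z::'a::complex_hilbert) = cinner x z + cinner y z"
  by (metis cinner_add_right cinner_commute complex_cnj_add)

lemma cinner_scaleC_left: "cinner (c *\<^sub>C x) (y::'a::complex_hilbert) = cnj c * cinner x y"
  by (metis cinner_commute cinner_scaleC_right complex_cnj_mult)

lemma cinner_self: "cinner x (x::'a::complex_hilbert) = complex_of_real ((norm x)\<^sup>2)"
proof (rule complex_eqI)
  show "Re (cinner x x) = Re (complex_of_real ((norm x)\<^sup>2))"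
    by (simp add: Re_cinner power2_norm_eq_inner)
  have "Im (cinner x x) = - Im (cinner x x)"
    using arg_cong[OF cinner_commute[of x x], of Im] by simp
  then show "Im (cinner x x) = Im (complex_of_real ((norm x)\<^sup>2))" by simp
qed

lemma norm_cinner_le: "cmod (cinner x y) \<le> norm x * norm (y::'a::complex_hilbert)"
proof (cases "cinner x y = 0")
  case False
  let ?c = "cnj (cinner x y) / cmod (cinner x y)"
  have "cnj (cinner x y) * cinner x y = (complex_of_real (cmod (cinner x y)))\<^sup>2"
    by (metis complex_norm_square mult.commute of_real_power)
  then have "?c * cinner x y = complex_of_real (cmod (cinner x y))"
    using False by (simp add: power2_eq_square)
  then have "cmod (cinner x y) = Re (?c * cinner x y)" by simp
  also have "\<dots> = inner x (?c *\<^sub>C y)"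
    by (simp add: cinner_scaleC_right flip: Re_cinner)
  also have "\<dots> \<le> norm x * norm (?c *\<^sub>C y)" by (rule norm_cauchy_schwarz)
  also have "\<dots> = norm x * norm y" using False by (simp add: norm_scaleC norm_divide)
  finally show ?thesis .
qed simp

lemma bounded_linear_cinner_right: "bounded_linear (cinner (x::'a::complex_hilbert))"
proof (rule bounded_linear_intro[of _ "norm x"])
  fix r y show "cinner x (r *\<^sub>R y) = r *\<^sub>R cinner x y"
    by (metis cinner_scaleC_right scaleC_of_real scaleR_conv_of_real)
  show "norm (cinner x y) \<le> norm y * norm x"
    using norm_cinner_le[of x y] by (simp add: mult.commute)
qed (auto simp: cinner_add_right)

instantiation complex :: complex_hilbert
begin
definition scaleC_complex :: "complex \<Rightarrow> complex \<Rightarrow> complex" where "scaleC_complex c x = c * x"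
definition cinner_complex :: "complex \<Rightarrow> complex \<Rightarrow> complex" where "cinner_complex x y = cnj x * y"
instance
  by standard (auto simp: scaleC_complex_def cinner_complex_def algebra_simps norm_mult
      scaleR_conv_of_real inner_complex_def)
end

instantiation prod :: (complex_normed_vector, complex_normed_vector) complex_normed_vector
begin
definition scaleC_prod :: "complex \<Rightarrow> 'a \<times> 'b \<Rightarrow> 'a \<times> 'b" where
  "scaleC_prod c x = (c *\<^sub>C fst x, c *\<^sub>C snd x)"
instance
  by standard (auto simp: scaleC_prod_def scaleC_add_right scaleC_add_left scaleC_scaleC
      scaleC_of_real norm_scaleC norm_prod_def power_mult_distrib scaleR_prod_def
      real_sqrt_mult simp flip: distrib_left)
end

instantiation prod :: (complex_hilbert, complex_hilbert) complex_hilbert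
begin
definition cinner_prod :: "'a \<times> 'b \<Rightarrow> 'a \<times> 'b \<Rightarrow> complex" where
  "cinner_prod x y = cinner (fst x) (fst y) + cinner (snd x) (snd y)"
instance
proof
  fix x y z :: "'a \<times> 'b" and c
  show "cinner x y = cnj (cinner y x)"
    using cinner_commute[of "fst x"] cinner_commute[of "snd x"] by (simp add: cinner_prod_def)
qed (auto simp: cinner_prod_def cinner_add_right cinner_scaleC_right scaleC_prod_def
      Re_cinner inner_prod_def algebra_simps)
end

instantiation blinfun :: (real_normed_vector, complex_normed_vector) complex_normed_vector
begin
lift_definition scaleC_blinfun :: "complex \<Rightarrow> 'a \<Rightarrow>\<^sub>L 'b \<Rightarrow> 'a \<Rightarrow>\<^sub>L 'b" is "\<lambda>c T x. c *\<^sub>C T x"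
  using bounded_linear_compose bounded_linear_scaleC_right by blast
instance
proof
  fix c d :: complex and r :: real and S T :: "'a \<Rightarrow>\<^sub>L 'b"
  show "c *\<^sub>C (S + T) = c *\<^sub>C S + c *\<^sub>C T" by transfer (simp add: scaleC_add_right)
  show "(c + d) *\<^sub>C T = c *\<^sub>C T + d *\<^sub>C T" by transfer (simp add: scaleC_add_left)
  show "c *\<^sub>C d *\<^sub>C T = (c * d) *\<^sub>C T" by transfer (simp add: scaleC_scaleC)
  show "complex_of_real r *\<^sub>C T = r *\<^sub>R T" by transfer (simp add: scaleC_of_real)
  have le: "norm (c *\<^sub>C T) \<le> cmod c * norm T" for c and T :: "'a \<Rightarrow>\<^sub>L 'b"
    by (rule norm_blinfun_bound)
      (auto simp: scaleC_blinfun.rep_eq norm_scaleC mult.assoc intro!: mult_left_mono norm_blinfun)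
  show "norm (c *\<^sub>C T) = cmod c * norm T"
  proof (cases "c = 0")
    case True
    then show ?thesis using le[of 0 T] by simp
  next
    case False
    have "T = inverse c *\<^sub>C (c *\<^sub>C T)"
      using False by transfer (simp add: scaleC_scaleC)
    then have "norm T \<le> inverse (cmod c) * norm (c *\<^sub>C T)"
      using le[of "inverse c" "c *\<^sub>C T"] by (simp add: norm_inverse)
    then show ?thesis using False le[of c T] by (simp add: field_simps)
  qed
qed
end

section \<open>Square-summable families\<close>

typedef 'i ell2 = "{x :: 'i \<Rightarrow> complex. (\<lambda>i. (cmod (x i))\<^sup>2) summable_on UNIV}"
  by (rule exI[of _ "\<lambda>_. 0"]) simp

setup_lifting type_definition_ell2

lemma ell2_add:
  fixes x y :: "'i \<Rightarrow> complex"
  assumes "(\<lambda>i. (cmod (x i))\<^sup>2) summable_on UNIV" "(\<lambda>i. (cmod (y i))\<^sup>2) summable_on UNIV"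
  shows "(\<lambda>i. (cmod (x i + y i))\<^sup>2) summable_on UNIV"
proof (rule summable_on_comparison_test)
  show "(\<lambda>i. 2 * (cmod (x i))\<^sup>2 + 2 * (cmod (y i))\<^sup>2) summable_on UNIV"
    by (intro summable_on_add summable_on_cmult_right assms)
  fix i
  have "(cmod (x i + y i))\<^sup>2 \<le> (cmod (x i) + cmod (y i))\<^sup>2"
    by (intro power_mono norm_triangle_ineq) auto
  also have "\<dots> \<le> 2 * (cmod (x i))\<^sup>2 + 2 * (cmod (y i))\<^sup>2"
    using sum_squares_bound[of "cmod (x i)" "cmod (y i)"] by (simp add: power2_sum)
  finally show "(cmod (x i + y i))\<^sup>2 \<le> 2 * (cmod (x i))\<^sup>2 + 2 * (cmod (y i))\<^sup>2" .
qed simp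

lemma ell2_scale:
  fixes x :: "'i \<Rightarrow> complex"
  assumes "(\<lambda>i. (cmod (x i))\<^sup>2) summable_on UNIV"
  shows "(\<lambda>i. (cmod (c * x i))\<^sup>2) summable_on UNIV"
  by (simp add: norm_mult power_mult_distrib summable_on_cmult_right assms)

lemma ell2_inner:
  fixes x y :: "'i \<Rightarrow> complex"
  assumes "(\<lambda>i. (cmod (x i))\<^sup>2) summable_on UNIV" "(\<lambda>i. (cmod (y i))\<^sup>2) summable_on UNIV"
  shows "(\<lambda>i. cnj (x i) * y i) summable_on UNIV"
proof (rule abs_summable_summable, rule summable_on_comparison_test)
  show "(\<lambda>i. (cmod (x i))\<^sup>2 + (cmod (y i))\<^sup>2) summable_on UNIV"
    by (intro summable_on_add assms)
  fix i
  show "norm (cnj (x i) * y i) \<le> (cmod (x i))\<^sup>2 + (cmod (y i))\<^sup>2"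
    using sum_squares_bound[of "cmod (x i)" "cmod (y i)"]
      mult_nonneg_nonneg[OF norm_ge_zero[of "x i"] norm_ge_zero[of "y i"]]
    unfolding norm_mult complex_mod_cnj by linarith
qed simp

lift_definition ell2_scale_op :: "complex \<Rightarrow> 'a ell2 \<Rightarrow> 'a ell2" is "\<lambda>c x i. c * x i"
  by (rule ell2_scale)
lift_definition ell2_ip :: "'a ell2 \<Rightarrow> 'a ell2 \<Rightarrow> complex" is
  "\<lambda>x y. \<Sum>\<^sub>\<infinity>i. cnj (x i) * y i" .

instantiation ell2 :: (type) real_inner
begin

lift_definition zero_ell2 :: "'a ell2" is "\<lambda>_. 0" by simp
lift_definition plus_ell2 :: "'a ell2 \<Rightarrow> 'a ell2 \<Rightarrow> 'a ell2" is "\<lambda>x y i. x i + y i"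
  by (rule ell2_add)
lift_definition uminus_ell2 :: "'a ell2 \<Rightarrow> 'a ell2" is "\<lambda>x i. - x i" by simp
definition minus_ell2 :: "'a ell2 \<Rightarrow> 'a ell2 \<Rightarrow> 'a ell2" where "minus_ell2 x y = x + - y"
definition scaleR_ell2 :: "real \<Rightarrow> 'a ell2 \<Rightarrow> 'a ell2" where "scaleR_ell2 r x = ell2_scale_op (complex_of_real r) x"
definition inner_ell2 :: "'a ell2 \<Rightarrow> 'a ell2 \<Rightarrow> real" where "inner_ell2 x y = Re (ell2_ip x y)"
definition norm_ell2 :: "'a ell2 \<Rightarrow> real" where "norm_ell2 x = sqrt (inner x x)"
definition dist_ell2 :: "'a ell2 \<Rightarrow> 'a ell2 \<Rightarrow> real" where "dist_ell2 x y = norm (x - y)"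
definition sgn_ell2 :: "'a ell2 \<Rightarrow> 'a ell2" where "sgn_ell2 x = inverse (norm x) *\<^sub>R x"
definition uniformity_ell2 :: "('a ell2 \<times> 'a ell2) filter" where
  "uniformity_ell2 = (INF e\<in>{0<..}. principal {(x::'a ell2, y). dist x y < e})"
definition open_ell2 :: "'a ell2 set \<Rightarrow> bool" where
  "open_ell2 U = (\<forall>x\<in>U. eventually (\<lambda>(x', y). x' = x \<longrightarrow> y \<in> U) uniformity)"

lemma ell2_ip_facts:
  fixes x y z :: "'a ell2"
  shows "ell2_ip x y = cnj (ell2_ip y x)"
    and "ell2_ip x (y + z) = ell2_ip x y + ell2_ip x z"
    and "ell2_ip x (ell2_scale_op c y) = c * ell2_ip x y"
    and "ell2_ip x x = 0 \<longleftrightarrow> x = 0"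
    and "0 \<le> Re (ell2_ip x x)"
    and "ell2_ip x x = complex_of_real (\<Sum>\<^sub>\<infinity>i. (cmod (Rep_ell2 x i))\<^sup>2)"
proof -
  show "ell2_ip x y = cnj (ell2_ip y x)"
    by transfer (simp add: mult.commute flip: infsum_cnj)
  show "ell2_ip x (y + z) = ell2_ip x y + ell2_ip x z"
    by transfer (simp add: distrib_left infsum_add ell2_inner)
  show "ell2_ip x (ell2_scale_op c y) = c * ell2_ip x y"
    by transfer (simp add: mult.left_commute infsum_cmult_right ell2_inner)
  show eq: "ell2_ip x x = complex_of_real (\<Sum>\<^sub>\<infinity>i. (cmod (Rep_ell2 x i))\<^sup>2)"
  proof transfer
    fix x :: "'a \<Rightarrow> complex" assume "(\<lambda>i. (cmod (x i))\<^sup>2) summable_on UNIV"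
    then have "((\<lambda>i. complex_of_real ((cmod (x i))\<^sup>2)) has_sum
        complex_of_real (\<Sum>\<^sub>\<infinity>i. (cmod (x i))\<^sup>2)) UNIV"
      by (intro has_sum_of_real has_sum_infsum)
    then show "(\<Sum>\<^sub>\<infinity>i. cnj (x i) * x i) = complex_of_real (\<Sum>\<^sub>\<infinity>i. (cmod (x i))\<^sup>2)"
      by (intro infsumI) (simp only: complex_norm_square mult.commute[of "cnj _"])
  qed
  show "0 \<le> Re (ell2_ip x x)" unfolding eq by (simp add: infsum_nonneg)
  show "ell2_ip x x = 0 \<longleftrightarrow> x = 0"
  proof
    assume "ell2_ip x x = 0"
    then have *: "(\<Sum>\<^sub>\<infinity>i. (cmod (Rep_ell2 x i))\<^sup>2) = 0" unfolding eq by simp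
    have "(cmod (Rep_ell2 x i))\<^sup>2 = 0" for i
      using nonneg_infsum_le_0D[of "\<lambda>i. (cmod (Rep_ell2 x i))\<^sup>2" UNIV i] * Rep_ell2[of x] by simp
    then show "x = 0" by transfer (auto simp: fun_eq_iff)
  next
    assume "x = 0" then show "ell2_ip x x = 0" by transfer simp
  qed
qed

lemma ell2_vector_facts:
  fixes x y z :: "'a ell2"
  shows "x + y + z = x + (y + z)" "x + y = y + x" "0 + x = x" "- x + x = 0"
    "ell2_scale_op c (x + y) = ell2_scale_op c x + ell2_scale_op c y"
    "ell2_scale_op (c + d) x = ell2_scale_op c x + ell2_scale_op d x"
    "ell2_scale_op c (ell2_scale_op d x) = ell2_scale_op (c * d) x" "ell2_scale_op 1 x = x"
  by (transfer; simp add: algebra_simps fun_eq_iff)+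

instance
proof
  fix x y z :: "'a ell2" and a b :: real
  show "x + y + z = x + (y + z)" "x + y = y + x" "0 + x = x" "- x + x = 0"
    by (rule ell2_vector_facts)+
  show "x - y = x + - y" by (rule minus_ell2_def)
  show "a *\<^sub>R (x + y) = a *\<^sub>R x + a *\<^sub>R y" "(a + b) *\<^sub>R x = a *\<^sub>R x + b *\<^sub>R x"
    "a *\<^sub>R b *\<^sub>R x = (a * b) *\<^sub>R x" "1 *\<^sub>R x = x"
    by (simp_all add: scaleR_ell2_def ell2_vector_facts)
  show "dist x y = norm (x - y)" by (rule dist_ell2_def)
  show "sgn x = inverse (norm x) *\<^sub>R x" by (rule sgn_ell2_def)
  show "(uniformity :: ('a ell2 \<times> 'a ell2) filter) = (INF e\<in>{0<..}. principal {(x, y). dist x y < e})"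
    by (rule uniformity_ell2_def)
  show "open U = (\<forall>x\<in>U. \<forall>\<^sub>F (x', y) in uniformity. x' = x \<longrightarrow> y \<in> U)" for U :: "'a ell2 set"
    by (rule open_ell2_def)
  show "inner x y = inner y x"
    using ell2_ip_facts(1)[of x y] by (simp add: inner_ell2_def)
  show "inner (x + y) z = inner x z + inner y z"
    unfolding inner_ell2_def
    by (metis ell2_ip_facts(1,2) complex_cnj_add plus_complex.simps(1))
  show "inner (a *\<^sub>R x) y = a * inner x y"
    unfolding inner_ell2_def scaleR_ell2_def
    by (metis ell2_ip_facts(1,3) Re_complex_of_real cnj.simps(1) scaleR_complex.simps(1)
        scaleR_conv_of_real)
  show "0 \<le> inner x x" by (simp add: inner_ell2_def ell2_ip_facts(5))
  show "inner x x = 0 \<longleftrightarrow> x = 0"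
    unfolding inner_ell2_def ell2_ip_facts(4)[symmetric] by (simp add: ell2_ip_facts(6))
  show "norm x = sqrt (inner x x)" by (rule norm_ell2_def)
qed

end

instantiation ell2 :: (type) complex_normed_vector
begin
definition scaleC_ell2 :: "complex \<Rightarrow> 'a ell2 \<Rightarrow> 'a ell2" where "scaleC_ell2 = ell2_scale_op"
instance
proof
  fix x y :: "'a ell2" and c d :: complex and a :: real
  show "c *\<^sub>C (x + y) = c *\<^sub>C x + c *\<^sub>C y" "(c + d) *\<^sub>C x = c *\<^sub>C x + d *\<^sub>C x"
    "c *\<^sub>C d *\<^sub>C x = (c * d) *\<^sub>C x"
    by (simp_all add: scaleC_ell2_def ell2_vector_facts)
  show "complex_of_real a *\<^sub>C x = a *\<^sub>R x" by (simp add: scaleC_ell2_def scaleR_ell2_def)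
  have "ell2_ip (c *\<^sub>C x) (c *\<^sub>C x) = complex_of_real ((cmod c)\<^sup>2) * ell2_ip x x"
    unfolding scaleC_ell2_def complex_norm_square
    by (metis (no_types, lifting) ell2_ip_facts(1,3) complex_cnj_mult mult.assoc mult.commute)
  then have "inner (c *\<^sub>C x) (c *\<^sub>C x) = (cmod c)\<^sup>2 * inner x x"
    by (simp add: inner_ell2_def del: of_real_power)
  then show "norm (c *\<^sub>C x) = cmod c * norm x"
    by (simp add: norm_eq_sqrt_inner real_sqrt_mult)
qed
end

instantiation ell2 :: (type) complex_hilbert
begin
definition cinner_ell2 :: "'a ell2 \<Rightarrow> 'a ell2 \<Rightarrow> complex" where "cinner_ell2 = ell2_ip"
instance
proof
  fix x y z :: "'a ell2" and c :: complex
  show "cinner x y = cnj (cinner y x)" "cinner x (y + z) = cinner x y + cinner x z"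
    "cinner x (c *\<^sub>C y) = c * cinner x y"
    unfolding cinner_ell2_def scaleC_ell2_def by (rule ell2_ip_facts)+
  show "Re (cinner x y) = inner x y" by (simp add: inner_ell2_def cinner_ell2_def)
next
  fix X :: "nat \<Rightarrow> 'a ell2"
  assume X: "Cauchy X"
  have n2: "(norm x)\<^sup>2 = (\<Sum>\<^sub>\<infinity>i. (cmod (Rep_ell2 x i))\<^sup>2)" for x :: "'a ell2"
    using ell2_ip_facts(5)[of x]
    by (simp add: norm_ell2_def inner_ell2_def ell2_ip_facts(6))
  have fin: "(\<Sum>i\<in>F. (cmod (Rep_ell2 x i))\<^sup>2) \<le> (norm x)\<^sup>2" if "finite F" for x :: "'a ell2" and F
    unfolding n2
  proof (rule finite_sum_le_infsum)
    show "(\<lambda>i. (cmod (Rep_ell2 x i))\<^sup>2) summable_on UNIV" using Rep_ell2[of x] by simp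
  qed (use that in auto)
  have diff: "Rep_ell2 (x - y) i = Rep_ell2 x i - Rep_ell2 y i" for x y :: "'a ell2" and i
    unfolding minus_ell2_def plus_ell2.rep_eq uminus_ell2.rep_eq by simp
  have coord: "cmod (Rep_ell2 x i) \<le> norm x" for x :: "'a ell2" and i
    using fin[of "{i}" x] power2_le_imp_le[of "cmod (Rep_ell2 x i)" "norm x"] by simp
  have "Cauchy (\<lambda>n. Rep_ell2 (X n) i)" for i
  proof (rule metric_CauchyI)
    fix e :: real assume "0 < e"
    then obtain N where N: "\<forall>m\<ge>N. \<forall>n\<ge>N. dist (X m) (X n) < e"
      using metric_CauchyD[OF X] by blast
    show "\<exists>M. \<forall>m\<ge>M. \<forall>n\<ge>M. dist (Rep_ell2 (X m) i) (Rep_ell2 (X n) i) < e"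
      using N coord[of "X _ - X _" i] unfolding dist_ell2_def dist_norm diff[symmetric]
      by (meson le_less_trans)
  qed
  then have "\<exists>l. (\<lambda>n. Rep_ell2 (X n) i) \<longlonglongrightarrow> l" for i
    using Cauchy_convergent convergent_def by blast
  then obtain y where y: "\<And>i. (\<lambda>n. Rep_ell2 (X n) i) \<longlonglongrightarrow> y i" by metis
  have bound: "(\<Sum>i\<in>F. (cmod (Rep_ell2 (X m) i - y i))\<^sup>2) \<le> e\<^sup>2"
    if "finite F" and N: "\<forall>m\<ge>N. \<forall>n\<ge>N. dist (X m) (X n) < e" and "m \<ge> N" for F m e N
  proof (rule tendsto_upperbound)
    show "(\<lambda>n. \<Sum>i\<in>F. (cmod (Rep_ell2 (X m) i - Rep_ell2 (X n) i))\<^sup>2)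
        \<longlonglongrightarrow> (\<Sum>i\<in>F. (cmod (Rep_ell2 (X m) i - y i))\<^sup>2)"
      by (intro tendsto_intros y)
    show "\<forall>\<^sub>F n in sequentially. (\<Sum>i\<in>F. (cmod (Rep_ell2 (X m) i - Rep_ell2 (X n) i))\<^sup>2) \<le> e\<^sup>2"
      unfolding eventually_sequentially
    proof (intro exI allI impI)
      fix n assume "n \<ge> N"
      then have "norm (X m - X n) < e" using N \<open>m \<ge> N\<close> by (simp add: dist_ell2_def)
      then have "(norm (X m - X n))\<^sup>2 \<le> e\<^sup>2" by (intro power_mono) auto
      then show "(\<Sum>i\<in>F. (cmod (Rep_ell2 (X m) i - Rep_ell2 (X n) i))\<^sup>2) \<le> e\<^sup>2"
        using fin[OF \<open>finite F\<close>, of "X m - X n"] by (simp add: diff)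
    qed
  qed simp
  have summ: "(\<lambda>i. (cmod (Rep_ell2 (X m) i - y i))\<^sup>2) summable_on UNIV"
    if N: "\<forall>m\<ge>N. \<forall>n\<ge>N. dist (X m) (X n) < e" and "m \<ge> N" for m e N
  proof (rule nonneg_bdd_above_summable_on)
    show "bdd_above (sum (\<lambda>i. (cmod (Rep_ell2 (X m) i - y i))\<^sup>2) ` {F. F \<subseteq> UNIV \<and> finite F})"
      by (rule bdd_aboveI[of _ "e\<^sup>2"]) (use bound[OF _ that] in blast)
  qed simp
  obtain N1 where N1: "\<forall>m\<ge>N1. \<forall>n\<ge>N1. dist (X m) (X n) < 1"
    using metric_CauchyD[OF X, of 1] by auto
  have "(\<lambda>i. (cmod (Rep_ell2 (X N1) i + - 1 * (Rep_ell2 (X N1) i - y i)))\<^sup>2) summable_on UNIV"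
    using Rep_ell2[of "X N1"] by (intro ell2_add ell2_scale summ[OF N1]) auto
  then have yl: "y \<in> {x. (\<lambda>i. (cmod (x i))\<^sup>2) summable_on UNIV}" by simp
  have "X \<longlonglongrightarrow> Abs_ell2 y"
  proof (rule metric_LIMSEQ_I)
    fix e :: real assume "0 < e"
    then obtain N where N: "\<forall>m\<ge>N. \<forall>n\<ge>N. dist (X m) (X n) < e / 2"
      using metric_CauchyD[OF X, of "e / 2"] by auto
    have "dist (X m) (Abs_ell2 y) < e" if "m \<ge> N" for m
    proof -
      have "(norm (X m - Abs_ell2 y))\<^sup>2 = (\<Sum>\<^sub>\<infinity>i. (cmod (Rep_ell2 (X m) i - y i))\<^sup>2)"
        by (simp add: n2 diff Abs_ell2_inverse[OF yl])
      also have "\<dots> \<le> (e / 2)\<^sup>2"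
        by (intro infsum_le_finite_sums summ[OF N that] bound[OF _ N that]) auto
      finally have "norm (X m - Abs_ell2 y) \<le> e / 2"
        by (rule power2_le_imp_le) (use \<open>0 < e\<close> in simp)
      then show ?thesis using \<open>0 < e\<close> by (simp add: dist_ell2_def)
    qed
    then show "\<exists>N. \<forall>n\<ge>N. dist (X n) (Abs_ell2 y) < e" by blast
  qed
  then show "convergent X" by (auto simp: convergent_def)
qed

end


lemma Rep_ell2_simps:
  "Rep_ell2 0 i = 0" "Rep_ell2 (x + y) i = Rep_ell2 x i + Rep_ell2 y i"
  "Rep_ell2 (- x) i = - Rep_ell2 x i" "Rep_ell2 (x - y) i = Rep_ell2 x i - Rep_ell2 y i"
  "Rep_ell2 (c *\<^sub>C x) i = c * Rep_ell2 x i" "Rep_ell2 (r *\<^sub>R x) i = r *\<^sub>R Rep_ell2 x i"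
proof -
  show "Rep_ell2 (x - y) i = Rep_ell2 x i - Rep_ell2 y i"
    unfolding minus_ell2_def plus_ell2.rep_eq uminus_ell2.rep_eq by simp
qed (simp_all add: zero_ell2.rep_eq plus_ell2.rep_eq uminus_ell2.rep_eq scaleC_ell2_def
    ell2_scale_op.rep_eq scaleR_ell2_def scaleR_conv_of_real)

lemma norm_ell2_squared: "(norm x)\<^sup>2 = (\<Sum>\<^sub>\<infinity>i. (cmod (Rep_ell2 x i))\<^sup>2)"
  using ell2_ip_facts(5)[of x]
  by (simp add: norm_ell2_def inner_ell2_def ell2_ip_facts(6))

lemma norm_Rep_ell2_le: "cmod (Rep_ell2 x i) \<le> norm x"
proof -
  have "(\<Sum>i\<in>{i}. (cmod (Rep_ell2 x i))\<^sup>2) \<le> (norm x)\<^sup>2"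
    unfolding norm_ell2_squared
    by (rule finite_sum_le_infsum) (use Rep_ell2[of x] in simp_all)
  then show ?thesis using power2_le_imp_le[of "cmod (Rep_ell2 x i)" "norm x"] by simp
qed

lemma tendsto_Rep_ell2:
  assumes "X \<longlonglongrightarrow> x" shows "(\<lambda>n. Rep_ell2 (X n) i) \<longlonglongrightarrow> Rep_ell2 x i"
proof (rule LIM_zero_cancel, rule Lim_null_comparison)
  show "\<forall>\<^sub>F n in sequentially. norm (Rep_ell2 (X n) i - Rep_ell2 x i) \<le> norm (X n - x)"
    by (simp add: norm_Rep_ell2_le flip: Rep_ell2_simps)
  show "(\<lambda>n. norm (X n - x)) \<longlonglongrightarrow> 0"
    using assms by (simp add: tendsto_norm_zero LIM_zero)
qed

section \<open>Orthonormal bases\<close>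

definition orthonormal :: "'a::complex_hilbert set \<Rightarrow> bool" where
  "orthonormal B \<longleftrightarrow> (\<forall>x\<in>B. \<forall>y\<in>B. cinner x y = (if x = y then 1 else 0))"

definition orthonormal_basis :: "'a::complex_hilbert set \<Rightarrow> bool" where
  "orthonormal_basis B \<longleftrightarrow> orthonormal B \<and> (\<forall>B'. orthonormal B' \<and> B \<subseteq> B' \<longrightarrow> B' = B)"

text \<open>Tensor products of Hilbert spaces are realised below by coordinates in this basis.\<close>

definition onb :: "'a::complex_hilbert set" where
  "onb = (SOME B. orthonormal_basis B)"

lemma orthonormal_basis_onb: "orthonormal_basis (onb :: 'a::complex_hilbert set)"
proof -
  have "\<exists>M\<in>{B :: 'a set. orthonormal B}. \<forall>X\<in>{B. orthonormal B}. M \<subseteq> X \<longrightarrow> X = M"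
  proof (rule subset_Zorn')
    fix \<C> :: "'a set set" assume ch: "subset.chain {B. orthonormal B} \<C>"
    show "\<Union>\<C> \<in> {B. orthonormal B}"
      unfolding mem_Collect_eq orthonormal_def
    proof (intro ballI)
      fix x y assume "x \<in> \<Union>\<C>" "y \<in> \<Union>\<C>"
      then obtain A B where AB: "A \<in> \<C>" "x \<in> A" "B \<in> \<C>" "y \<in> B" by blast
      then have "A \<subseteq> B \<or> B \<subseteq> A" "orthonormal A" "orthonormal B"
        using ch by (auto simp: subset.chain_def subset_chain_def)
      then show "cinner x y = (if x = y then 1 else 0)"
        using AB unfolding orthonormal_def by blast
    qed
  qed
  then have "\<exists>B :: 'a set. orthonormal_basis B"
    unfolding orthonormal_basis_def by blast
  then show ?thesis unfolding onb_def by (rule someI_ex)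
qed

lemma cinner_sum_right: "cinner x (\<Sum>i\<in>F. f i) = (\<Sum>i\<in>F. cinner x (f i :: 'a::complex_hilbert))"
  by (rule linear_sum[OF bounded_linear.linear[OF bounded_linear_cinner_right]])

lemma bessel:
  assumes "finite F" "F \<subseteq> (onb :: 'a::complex_hilbert set)"
  shows "(\<Sum>b\<in>F. (cmod (cinner b x))\<^sup>2) \<le> (norm x)\<^sup>2"
proof -
  define S where "S = (\<Sum>b\<in>F. cinner b x *\<^sub>C b)"
  have on: "cinner b b' = (if b = b' then 1 else 0)" if "b \<in> F" "b' \<in> F" for b b'
    using that assms(2) orthonormal_basis_onb unfolding orthonormal_basis_def orthonormal_def by blast
  have bS: "cinner b S = cinner b x" if "b \<in> F" for b
  proof -
    have "cinner b S = (\<Sum>b'\<in>F. if b = b' then cinner b' x else 0)"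
      unfolding S_def cinner_sum_right
      by (intro sum.cong) (auto simp: cinner_scaleC_right on that)
    then show ?thesis using that assms(1) by simp
  qed
  have eq: "cinner z S = (\<Sum>b\<in>F. cinner b x * cnj (cinner b z))" for z
    unfolding S_def cinner_sum_right by (simp add: cinner_scaleC_right cinner_commute[of z])
  have "cinner S S = (\<Sum>b\<in>F. complex_of_real ((cmod (cinner b x))\<^sup>2))"
    unfolding eq[of S] complex_norm_square by (rule sum.cong) (simp_all add: bS)
  moreover have "cinner x S = (\<Sum>b\<in>F. complex_of_real ((cmod (cinner b x))\<^sup>2))"
    unfolding eq[of x] complex_norm_square ..
  ultimately have "inner S S = (\<Sum>b\<in>F. (cmod (cinner b x))\<^sup>2)" "inner x S = (\<Sum>b\<in>F. (cmod (cinner b x))\<^sup>2)"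
    by (simp_all flip: Re_cinner)
  moreover have "0 \<le> inner (x - S) (x - S)" by simp
  ultimately show ?thesis
    by (simp add: inner_diff_left inner_diff_right inner_commute power2_norm_eq_inner)
qed

section \<open>Tensor products of Hilbert spaces\<close>

text \<open>The Hilbert space tensor product: a vector is given by its coefficients with respect to
  the orthonormal basis of the product vectors of the two fixed bases.\<close>

typedef (overloaded) ('a::complex_hilbert, 'b::complex_hilbert) htens =
  "{u :: ('a \<times> 'b) ell2. \<forall>p. p \<notin> onb \<times> onb \<longrightarrow> Rep_ell2 u p = 0}"
  by (rule exI[of _ 0]) (simp add: Rep_ell2_simps)

setup_lifting type_definition_htens

instantiation htens :: (complex_hilbert, complex_hilbert) real_inner
begin
lift_definition zero_htens :: "('a, 'b) htens" is 0 by (simp add: Rep_ell2_simps)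
lift_definition plus_htens :: "('a, 'b) htens \<Rightarrow> ('a, 'b) htens \<Rightarrow> ('a, 'b) htens" is "(+)"
  by (simp add: Rep_ell2_simps)
lift_definition minus_htens :: "('a, 'b) htens \<Rightarrow> ('a, 'b) htens \<Rightarrow> ('a, 'b) htens" is "(-)"
  by (simp add: Rep_ell2_simps)
lift_definition uminus_htens :: "('a, 'b) htens \<Rightarrow> ('a, 'b) htens" is uminus
  by (simp add: Rep_ell2_simps)
lift_definition scaleR_htens :: "real \<Rightarrow> ('a, 'b) htens \<Rightarrow> ('a, 'b) htens" is "(*\<^sub>R)"
  by (simp add: Rep_ell2_simps)
lift_definition inner_htens :: "('a, 'b) htens \<Rightarrow> ('a, 'b) htens \<Rightarrow> real" is inner .
lift_definition norm_htens :: "('a, 'b) htens \<Rightarrow> real" is norm .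
definition dist_htens :: "('a, 'b) htens \<Rightarrow> ('a, 'b) htens \<Rightarrow> real" where
  "dist_htens x y = norm (x - y)"
definition sgn_htens :: "('a, 'b) htens \<Rightarrow> ('a, 'b) htens" where
  "sgn_htens x = inverse (norm x) *\<^sub>R x"
definition uniformity_htens :: "(('a, 'b) htens \<times> ('a, 'b) htens) filter" where
  "uniformity_htens = (INF e\<in>{0<..}. principal {(x::('a, 'b) htens, y). dist x y < e})"
definition open_htens :: "('a, 'b) htens set \<Rightarrow> bool" where
  "open_htens U = (\<forall>x\<in>U. eventually (\<lambda>(x', y). x' = x \<longrightarrow> y \<in> U) uniformity)"
instance
proof
  fix x y z :: "('a, 'b) htens" and a b :: real
  show "x + y + z = x + (y + z)" "x + y = y + x" "0 + x = x" "- x + x = 0" "x - y = x + - y"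
    by (transfer; simp)+
  show "a *\<^sub>R (x + y) = a *\<^sub>R x + a *\<^sub>R y" "(a + b) *\<^sub>R x = a *\<^sub>R x + b *\<^sub>R x"
    "a *\<^sub>R b *\<^sub>R x = (a * b) *\<^sub>R x" "1 *\<^sub>R x = x"
    by (transfer; simp add: scaleR_add_right scaleR_add_left)+
  show "inner x y = inner y x" by transfer (rule inner_commute)
  show "inner (x + y) z = inner x z + inner y z" by transfer (rule inner_add_left)
  show "inner (a *\<^sub>R x) y = a * inner x y" by transfer simp
  show "0 \<le> inner x x" "inner x x = 0 \<longleftrightarrow> x = 0" by (transfer; simp)+
  show "norm x = sqrt (inner x x)" by transfer (rule norm_eq_sqrt_inner)
qed (rule dist_htens_def sgn_htens_def uniformity_htens_def open_htens_def)+
end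

instantiation htens :: (complex_hilbert, complex_hilbert) complex_normed_vector
begin
lift_definition scaleC_htens :: "complex \<Rightarrow> ('a, 'b) htens \<Rightarrow> ('a, 'b) htens" is "(*\<^sub>C)"
  by (simp add: Rep_ell2_simps)
instance
proof
  fix x y :: "('a, 'b) htens" and c d :: complex and a :: real
  show "c *\<^sub>C (x + y) = c *\<^sub>C x + c *\<^sub>C y" by transfer (rule scaleC_add_right)
  show "(c + d) *\<^sub>C x = c *\<^sub>C x + d *\<^sub>C x" by transfer (rule scaleC_add_left)
  show "c *\<^sub>C d *\<^sub>C x = (c * d) *\<^sub>C x" by transfer (rule scaleC_scaleC)
  show "complex_of_real a *\<^sub>C x = a *\<^sub>R x" by transfer (rule scaleC_of_real)
  show "norm (c *\<^sub>C x) = cmod c * norm x" by transfer (rule norm_scaleC)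
qed
end

instantiation htens :: (complex_hilbert, complex_hilbert) complex_hilbert
begin
lift_definition cinner_htens :: "('a, 'b) htens \<Rightarrow> ('a, 'b) htens \<Rightarrow> complex" is cinner .
instance
proof
  fix x y z :: "('a, 'b) htens" and c :: complex
  show "cinner x y = cnj (cinner y x)" by transfer (rule cinner_commute)
  show "cinner x (y + z) = cinner x y + cinner x z" by transfer (rule cinner_add_right)
  show "cinner x (c *\<^sub>C y) = c * cinner x y" by transfer (rule cinner_scaleC_right)
  show "Re (cinner x y) = inner x y" by transfer (rule Re_cinner)
next
  fix X :: "nat \<Rightarrow> ('a, 'b) htens"
  assume "Cauchy X"
  then have "Cauchy (\<lambda>n. Rep_htens (X n))"
    unfolding Cauchy_def dist_norm by (simp add: norm_htens.rep_eq minus_htens.rep_eq)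
  then obtain u where u: "(\<lambda>n. Rep_htens (X n)) \<longlonglongrightarrow> u"
    using Cauchy_convergent convergent_def by blast
  have "Rep_ell2 u p = 0" if "p \<notin> onb \<times> onb" for p
  proof (rule LIMSEQ_unique[OF tendsto_Rep_ell2[OF u]])
    have "Rep_ell2 (Rep_htens (X n)) p = 0" for n using Rep_htens[of "X n"] that by blast
    then show "(\<lambda>n. Rep_ell2 (Rep_htens (X n)) p) \<longlonglongrightarrow> 0" by simp
  qed
  then have "Rep_htens (Abs_htens u) = u" by (intro Abs_htens_inverse) blast
  then have "X \<longlonglongrightarrow> Abs_htens u"
    using u unfolding LIMSEQ_def dist_norm by (simp add: norm_htens.rep_eq minus_htens.rep_eq)
  then show "convergent X" by (auto simp: convergent_def)
qed
end

lift_definition htensor_coeffs :: "'a::complex_hilbert \<Rightarrow> 'b::complex_hilbert \<Rightarrow> ('a \<times> 'b) ell2" is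
  "\<lambda>x y p. if p \<in> onb \<times> onb then cinner (fst p) x * cinner (snd p) y else 0"
proof (rule nonneg_bdd_above_summable_on)
  fix x :: 'a and y :: 'b
  let ?f = "\<lambda>p. (cmod (if p \<in> onb \<times> onb then cinner (fst p) x * cinner (snd p) y else 0))\<^sup>2"
  show "bdd_above (sum ?f ` {F. F \<subseteq> UNIV \<and> finite F})"
  proof (rule bdd_aboveI2)
    fix F :: "('a \<times> 'b) set" assume "F \<in> {F. F \<subseteq> UNIV \<and> finite F}"
    then have F: "finite F" by simp
    let ?A = "fst ` F \<inter> onb" and ?B = "snd ` F \<inter> onb"
    have "sum ?f F = sum ?f (F \<inter> onb \<times> onb)"
      using F by (intro sum.mono_neutral_right) auto
    also have "\<dots> \<le> sum ?f (?A \<times> ?B)"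
      using F by (intro sum_mono2) (auto simp: image_iff, force+)
    also have "\<dots> = (\<Sum>p\<in>?A \<times> ?B. (cmod (cinner (fst p) x))\<^sup>2 * (cmod (cinner (snd p) y))\<^sup>2)"
      by (intro sum.cong) (auto simp: norm_mult power_mult_distrib)
    also have "\<dots> = (\<Sum>b\<in>?A. (cmod (cinner b x))\<^sup>2) * (\<Sum>b\<in>?B. (cmod (cinner b y))\<^sup>2)"
      unfolding sum_product sum.cartesian_product by (simp add: case_prod_beta)
    also have "\<dots> \<le> (norm x)\<^sup>2 * (norm y)\<^sup>2"
      using F by (intro mult_mono bessel sum_nonneg) auto
    finally show "sum ?f F \<le> (norm x)\<^sup>2 * (norm y)\<^sup>2" .
  qed
qed simp

lift_definition htensor ::
  "'a::complex_hilbert \<Rightarrow> 'b::complex_hilbert \<Rightarrow> ('a, 'b) htens" (infixr "\<otimes>\<^sub>h" 70)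
  is htensor_coeffs
  by (simp add: htensor_coeffs.rep_eq)

section \<open>Symmetric Fock space\<close>

text \<open>The full Fock space over \<open>'a\<close> is realised on the finite lists of vectors of the fixed
  basis: the entry at \<open>[b\<^sub>1, \<dots>, b\<^sub>n]\<close> of a vector is the coefficient of
  its component in the \<open>n\<close>-fold tensor power with respect to the product of
  \<open>b\<^sub>1, \<dots>, b\<^sub>n\<close>.  The symmetric Fock space is the subspace of symmetric coefficients.\<close>

definition sym_fock :: "'a::complex_hilbert list ell2 set" where
  "sym_fock = {u. (\<forall>bs. \<not> set bs \<subseteq> onb \<longrightarrow> Rep_ell2 u bs = 0) \<and>
    (\<forall>bs bs'. mset bs = mset bs' \<longrightarrow> Rep_ell2 u bs = Rep_ell2 u bs')}"

lemma sum_lists_length: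
  fixes g :: "'a \<Rightarrow> real"
  assumes "finite B"
  shows "(\<Sum>bs\<in>{bs. set bs \<subseteq> B \<and> length bs = n}. (\<Prod>b\<leftarrow>bs. g b)) = (\<Sum>b\<in>B. g b) ^ n"
proof (induction n)
  case 0
  have "{bs. set bs \<subseteq> B \<and> length bs = 0} = {[]}" by auto
  then show ?case by simp
next
  case (Suc n)
  let ?L = "\<lambda>n. {bs. set bs \<subseteq> B \<and> length bs = n}"
  have eq: "?L (Suc n) = (\<lambda>(b, bs). b # bs) ` (B \<times> ?L n)"
    by (auto simp: length_Suc_conv image_iff)
  have "(\<Sum>bs\<in>?L (Suc n). (\<Prod>b\<leftarrow>bs. g b)) = (\<Sum>p\<in>B \<times> ?L n. g (fst p) * (\<Prod>b\<leftarrow>snd p. g b))"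
    unfolding eq by (subst sum.reindex) (auto simp: inj_on_def case_prod_beta)
  also have "\<dots> = (\<Sum>b\<in>B. g b) * (\<Sum>bs\<in>?L n. (\<Prod>b\<leftarrow>bs. g b))"
    unfolding sum_product sum.cartesian_product by (simp add: case_prod_beta)
  finally show ?case using Suc.IH by simp
qed

text \<open>The exponential vector of \<open>f\<close>, with \<open>n\<close>-particle component
  \<open>(n!)\<^sup>-\<^sup>1\<^sup>/\<^sup>2 f \<otimes> \<cdots> \<otimes> f\<close>.\<close>

lift_definition exp_vec :: "'a::complex_hilbert \<Rightarrow> 'a list ell2" is
  "\<lambda>f bs. if set bs \<subseteq> onb
     then complex_of_real (1 / sqrt (fact (length bs))) * (\<Prod>b\<leftarrow>bs. cinner b f) else 0"
proof (rule nonneg_bdd_above_summable_on)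
  fix f :: 'a
  let ?e = "\<lambda>bs. if set bs \<subseteq> onb
     then complex_of_real (1 / sqrt (fact (length bs))) * (\<Prod>b\<leftarrow>bs. cinner b f) else 0"
  let ?f = "\<lambda>bs. (cmod (?e bs))\<^sup>2"
  show "bdd_above (sum ?f ` {F. F \<subseteq> UNIV \<and> finite F})"
  proof (rule bdd_aboveI2)
    fix F :: "'a list set" assume "F \<in> {F. F \<subseteq> UNIV \<and> finite F}"
    then have F: "finite F" by simp
    define B where "B = \<Union>(set ` F) \<inter> onb"
    define N where "N = Suc (Max (insert 0 (length ` F)))"
    have B: "finite B" "B \<subseteq> onb" using F by (auto simp: B_def)
    let ?L = "\<lambda>n. {bs. set bs \<subseteq> B \<and> length bs = n}"
    have fin: "finite (?L n)" for n using B(1) by (rule finite_lists_length_eq)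
    have len: "length bs < N" if "bs \<in> F" for bs
      using F that by (auto simp: N_def less_Suc_eq_le intro!: Max_ge)
    have prod: "(cmod (\<Prod>b\<leftarrow>bs. cinner b f))\<^sup>2 = (\<Prod>b\<leftarrow>bs. (cmod (cinner b f))\<^sup>2)" for bs
      by (induction bs) (auto simp: norm_mult power_mult_distrib)
    have "sum ?f F = sum ?f (F \<inter> {bs. set bs \<subseteq> onb})"
      using F by (intro sum.mono_neutral_right) auto
    also have "\<dots> \<le> sum ?f (\<Union>n<N. ?L n)"
      using F fin len by (intro sum_mono2) (auto simp: B_def)
    also have "\<dots> = (\<Sum>n<N. sum ?f (?L n))"
      using fin by (intro sum.UNION_disjoint) auto
    also have "\<dots> = (\<Sum>n<N. (\<Sum>b\<in>B. (cmod (cinner b f))\<^sup>2) ^ n / fact n)"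
    proof (rule sum.cong)
      fix n
      have "sum ?f (?L n) = (\<Sum>bs\<in>?L n. (\<Prod>b\<leftarrow>bs. (cmod (cinner b f))\<^sup>2) / fact n)"
      proof (rule sum.cong)
        fix bs assume "bs \<in> ?L n"
        then have "set bs \<subseteq> onb" "length bs = n" using B(2) by auto
        then show "?f bs = (\<Prod>b\<leftarrow>bs. (cmod (cinner b f))\<^sup>2) / fact n"
          by (simp add: norm_mult norm_divide power_mult_distrib power_divide flip: prod)
      qed simp
      then show "sum ?f (?L n) = (\<Sum>b\<in>B. (cmod (cinner b f))\<^sup>2) ^ n / fact n"
        by (simp add: sum_lists_length[OF B(1)] flip: sum_divide_distrib)
    qed simp
    also have "\<dots> \<le> (\<Sum>n<N. ((norm f)\<^sup>2) ^ n / fact n)"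
      using B by (intro sum_mono divide_right_mono power_mono bessel sum_nonneg) auto
    also have "\<dots> \<le> exp ((norm f)\<^sup>2)"
      unfolding exp_def using summable_exp_generic[of "(norm f)\<^sup>2"]
      by (subst sum.cong[OF refl, of _ _ "\<lambda>n. ((norm f)\<^sup>2) ^ n /\<^sub>R fact n"])
        (auto simp: divide_inverse mult.commute intro!: sum_le_suminf)
    finally show "sum ?f F \<le> exp ((norm f)\<^sup>2)" .
  qed
qed simp


section \<open>The space L2\<close>

text \<open>Vector-valued functions on the half-line are functions on \<open>real\<close> of which only the
  values on \<open>{0..}\<close> matter.  Strong measurability for arbitrary Hilbert spaces is taken in the
  form given by Pettis' theorem: weakly measurable with separable range.\<close>

abbreviation Rplus :: "real measure" where "Rplus \<equiv> lebesgue_on {0..}"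

definition strongly_measurable :: "(real \<Rightarrow> 'k::complex_hilbert) \<Rightarrow> bool" where
  "strongly_measurable f \<longleftrightarrow>
    (\<forall>h. (\<lambda>s. cinner h (f s)) \<in> borel_measurable Rplus) \<and>
    (\<exists>D. countable D \<and> f ` {0..} \<subseteq> closure D)"

definition square_integrable :: "(real \<Rightarrow> 'k::complex_hilbert) \<Rightarrow> bool" where
  "square_integrable f \<longleftrightarrow>
    strongly_measurable f \<and> integrable Rplus (\<lambda>s. (norm (f s))\<^sup>2)"

lemma scaleC_minus_one: "(- 1) *\<^sub>C (x::'a::complex_normed_vector) = - x"
  using scaleC_of_real[of "-1" x] by simp

lemma strongly_measurable_zero: "strongly_measurable (\<lambda>_. 0)"
  unfolding strongly_measurable_def
  by (auto intro!: exI[of _ "{0}"] simp: bounded_linear.linear[THEN linear_0] bounded_linear_cinner_right)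

lemma strongly_measurable_add:
  assumes "strongly_measurable f" "strongly_measurable g"
  shows "strongly_measurable (\<lambda>s. f s + g s)"
proof -
  obtain D E where D: "countable D" "f ` {0..} \<subseteq> closure D" and E: "countable E" "g ` {0..} \<subseteq> closure E"
    using assms unfolding strongly_measurable_def by blast
  let ?H = "(\<lambda>(x, y). x + y) ` (D \<times> E)"
  have "(\<lambda>(x, y). x + y) ` closure (D \<times> E) \<subseteq> closure ?H"
    by (rule image_closure_subset) (auto simp: closure_subset case_prod_beta intro!: continuous_intros
        intro: subsetD[OF closure_subset])
  then have "f s + g s \<in> closure ?H" if "s \<ge> 0" for s
    using D(2) E(2) that unfolding closure_Times by (auto simp: image_subset_iff)
  moreover have "countable ?H" using D E by auto
  ultimately have "\<exists>D. countable D \<and> (\<lambda>s. f s + g s) ` {0..} \<subseteq> closure D" by (intro exI[of _ ?H]) auto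
  then show ?thesis
    using assms unfolding strongly_measurable_def
    by (auto simp: cinner_add_right intro!: borel_measurable_add)
qed

lemma strongly_measurable_scaleC:
  assumes "strongly_measurable f"
  shows "strongly_measurable (\<lambda>s. c *\<^sub>C f s)"
proof -
  obtain D where D: "countable D" "f ` {0..} \<subseteq> closure D"
    using assms unfolding strongly_measurable_def by blast
  have "(*\<^sub>C) c ` closure D \<subseteq> closure ((*\<^sub>C) c ` D)"
    by (rule image_closure_subset)
      (auto intro!: linear_continuous_on bounded_linear_scaleC_right intro: subsetD[OF closure_subset])
  then have "\<exists>D. countable D \<and> (\<lambda>s. c *\<^sub>C f s) ` {0..} \<subseteq> closure D"
    using D by (intro exI[of _ "(*\<^sub>C) c ` D"]) auto
  then show ?thesis
    using assms unfolding strongly_measurable_def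
    by (auto simp: cinner_scaleC_right intro!: borel_measurable_times borel_measurable_const)
qed

lemma borel_measurable_norm_squared:
  assumes "strongly_measurable f"
  shows "(\<lambda>s. (norm (f s))\<^sup>2) \<in> borel_measurable Rplus"
proof -
  obtain D where D: "countable D" "f ` {0..} \<subseteq> closure D"
    using assms unfolding strongly_measurable_def by blast
  let ?q = "\<lambda>d s. 2 * inner d (f s) - (norm d)\<^sup>2"
  have q: "?q d s = (norm (f s))\<^sup>2 - (norm (f s - d))\<^sup>2" for d s
    by (simp add: power2_norm_eq_inner inner_diff_left inner_diff_right inner_commute)
  then have q_le: "?q d s \<le> (norm (f s))\<^sup>2" for d s by simp
  have ne: "D \<noteq> {}" using D(2) by auto
  have "(norm (f s))\<^sup>2 = (SUP d\<in>D. ?q d s)" if "s \<in> {0..}" for s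
  proof (rule antisym)
    show "(SUP d\<in>D. ?q d s) \<le> (norm (f s))\<^sup>2"
      using ne q_le by (intro cSUP_least)
    have "f s \<in> closure D" using D(2) that by blast
    then obtain d where d: "\<And>n. d n \<in> D" "d \<longlonglongrightarrow> f s"
      unfolding closure_sequential by blast
    have "(\<lambda>n. ?q (d n) s) \<longlonglongrightarrow> (norm (f s))\<^sup>2 - (norm (f s - f s))\<^sup>2"
      unfolding q by (intro tendsto_intros d)
    then have lim: "(\<lambda>n. ?q (d n) s) \<longlonglongrightarrow> (norm (f s))\<^sup>2" by simp
    have "?q (d n) s \<le> (SUP d\<in>D. ?q d s)" for n
      using d(1) q_le by (intro cSUP_upper) (auto simp: bdd_above_def)
    then show "(norm (f s))\<^sup>2 \<le> (SUP d\<in>D. ?q d s)"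
      by (intro LIMSEQ_le_const2[OF lim]) auto
  qed
  moreover have "(\<lambda>s. SUP d\<in>D. ?q d s) \<in> borel_measurable Rplus"
  proof (rule borel_measurable_cSUP[OF D(1)])
    fix d
    have [measurable]: "(\<lambda>s. cinner d (f s)) \<in> borel_measurable Rplus"
      using assms by (simp add: strongly_measurable_def)
    have "(\<lambda>s. Re (cinner d (f s))) \<in> borel_measurable Rplus" by measurable
    then show "?q d \<in> borel_measurable Rplus" by (simp add: Re_cinner)
  qed (use q_le in \<open>auto simp: bdd_above_def\<close>)
  ultimately show ?thesis
    by (subst measurable_cong[where g = "\<lambda>s. SUP d\<in>D. ?q d s"]) auto
qed

lemma strongly_measurable_diff:
  assumes "strongly_measurable f" "strongly_measurable g"
  shows "strongly_measurable (\<lambda>s. f s - g s)"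
proof -
  have "(\<lambda>s. f s - g s) = (\<lambda>s. f s + (-1) *\<^sub>C g s)"
    by (simp add: scaleC_minus_one)
  then show ?thesis
    using strongly_measurable_add[OF assms(1) strongly_measurable_scaleC[OF assms(2)]] by metis
qed

lemma borel_measurable_cinner:
  fixes f g :: "real \<Rightarrow> 'k::complex_hilbert"
  assumes "strongly_measurable f" "strongly_measurable g"
  shows "(\<lambda>s. cinner (f s) (g s)) \<in> borel_measurable Rplus"
proof -
  have re: "(\<lambda>s. Re (cinner (f s) (g s))) \<in> borel_measurable Rplus"
    if "strongly_measurable f" "strongly_measurable g" for f g :: "real \<Rightarrow> 'k"
  proof -
    have "(\<lambda>s. ((norm (f s + g s))\<^sup>2 - (norm (f s - g s))\<^sup>2) / 4) \<in> borel_measurable Rplus"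
      by (intro borel_measurable_divide borel_measurable_diff borel_measurable_norm_squared
          strongly_measurable_add strongly_measurable_diff that) auto
    also have "(\<lambda>s. ((norm (f s + g s))\<^sup>2 - (norm (f s - g s))\<^sup>2) / 4) = (\<lambda>s. Re (cinner (f s) (g s)))"
      by (auto simp: fun_eq_iff Re_cinner power2_norm_eq_inner inner_add_left inner_add_right
          inner_diff_left inner_diff_right inner_commute)
    finally show ?thesis .
  qed
  have "(\<lambda>s. Re (cinner (f s) ((- \<i>) *\<^sub>C g s))) \<in> borel_measurable Rplus"
    by (intro re strongly_measurable_scaleC assms)
  then have "(\<lambda>s. Im (cinner (f s) (g s))) \<in> borel_measurable Rplus"
    by (simp add: cinner_scaleC_right)
  then show ?thesis
    using re[OF assms] by (subst borel_measurable_complex_iff) simp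
qed

lemma square_integrable_zero: "square_integrable (\<lambda>_. 0)"
  by (simp add: square_integrable_def strongly_measurable_zero)

lemma square_integrable_scaleC: "square_integrable f \<Longrightarrow> square_integrable (\<lambda>s. c *\<^sub>C f s)"
  by (simp add: square_integrable_def strongly_measurable_scaleC norm_scaleC power_mult_distrib)

lemma square_integrable_add:
  assumes "square_integrable f" "square_integrable g"
  shows "square_integrable (\<lambda>s. f s + g s)"
proof -
  have sm: "strongly_measurable (\<lambda>s. f s + g s)"
    using assms by (simp add: square_integrable_def strongly_measurable_add)
  have "integrable Rplus (\<lambda>s. (norm (f s + g s))\<^sup>2)"
  proof (rule Bochner_Integration.integrable_bound)
    show "integrable Rplus (\<lambda>s. 2 * (norm (f s))\<^sup>2 + 2 * (norm (g s))\<^sup>2)"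
      using assms by (auto simp: square_integrable_def)
    have "(norm (f s + g s))\<^sup>2 \<le> 2 * (norm (f s))\<^sup>2 + 2 * (norm (g s))\<^sup>2" for s
    proof -
      have "(norm (f s + g s))\<^sup>2 \<le> (norm (f s) + norm (g s))\<^sup>2"
        by (intro power_mono norm_triangle_ineq) auto
      also have "\<dots> \<le> 2 * (norm (f s))\<^sup>2 + 2 * (norm (g s))\<^sup>2"
        using sum_squares_bound[of "norm (f s)" "norm (g s)"] by (simp add: power2_sum)
      finally show ?thesis .
    qed
    then show "AE s in Rplus. norm ((norm (f s + g s))\<^sup>2) \<le> norm (2 * (norm (f s))\<^sup>2 + 2 * (norm (g s))\<^sup>2)"
      by (intro AE_I2) simp
  qed (rule borel_measurable_norm_squared[OF sm])
  then show ?thesis using sm by (simp add: square_integrable_def)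
qed

lemma square_integrable_uminus: "square_integrable f \<Longrightarrow> square_integrable (\<lambda>s. - f s)"
  using square_integrable_scaleC[of f "-1"] by (simp add: scaleC_minus_one)

lemma integrable_cinner:
  assumes "square_integrable f" "square_integrable g"
  shows "integrable Rplus (\<lambda>s. cinner (f s) (g s))"
proof (rule Bochner_Integration.integrable_bound)
  show "integrable Rplus (\<lambda>s. (norm (f s))\<^sup>2 + (norm (g s))\<^sup>2)"
    using assms by (auto simp: square_integrable_def)
  show "(\<lambda>s. cinner (f s) (g s)) \<in> borel_measurable Rplus"
    using assms by (simp add: borel_measurable_cinner square_integrable_def)
  have "cmod (cinner (f s) (g s)) \<le> (norm (f s))\<^sup>2 + (norm (g s))\<^sup>2" for s
    using norm_cinner_le[of "f s" "g s"] sum_squares_bound[of "norm (f s)" "norm (g s)"]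
      mult_nonneg_nonneg[OF norm_ge_zero[of "f s"] norm_ge_zero[of "g s"]] by linarith
  then show "AE s in Rplus. norm (cinner (f s) (g s)) \<le> norm ((norm (f s))\<^sup>2 + (norm (g s))\<^sup>2)"
    by (intro AE_I2) simp
qed

definition l2_eq :: "(real \<Rightarrow> 'k::complex_hilbert) \<Rightarrow> (real \<Rightarrow> 'k) \<Rightarrow> bool" where
  "l2_eq f g \<longleftrightarrow> square_integrable f \<and> square_integrable g \<and> (AE s in Rplus. f s = g s)"

quotient_type (overloaded) 'k L2 = "real \<Rightarrow> 'k::complex_hilbert" / partial: l2_eq
proof (rule part_equivpI)
  show "\<exists>f :: real \<Rightarrow> 'k. l2_eq f f"
    by (rule exI[of _ "\<lambda>_. 0"]) (simp add: l2_eq_def square_integrable_zero)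
  show "symp (l2_eq :: (real \<Rightarrow> 'k) \<Rightarrow> _)" by (rule sympI) (auto simp: l2_eq_def eq_commute)
  show "transp (l2_eq :: (real \<Rightarrow> 'k) \<Rightarrow> _)" by (rule transpI) (auto simp: l2_eq_def)
qed

text \<open>\<open>abs_L2 f\<close> is the class of the square-integrable function \<open>f\<close>.\<close>

lift_definition L2_scale :: "complex \<Rightarrow> 'k::complex_hilbert L2 \<Rightarrow> 'k L2" is "\<lambda>c f s. c *\<^sub>C f s"
  unfolding l2_eq_def by (auto simp: square_integrable_scaleC)

lift_definition L2_ip :: "'k::complex_hilbert L2 \<Rightarrow> 'k L2 \<Rightarrow> complex" is
  "\<lambda>f g. \<integral>s. cinner (f s) (g s) \<partial>Rplus"
proof -
  fix f f' g g' :: "real \<Rightarrow> 'k" assume *: "l2_eq f f'" "l2_eq g g'"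
  then have "(\<lambda>s. cinner (f s) (g s)) \<in> borel_measurable Rplus"
    "(\<lambda>s. cinner (f' s) (g' s)) \<in> borel_measurable Rplus"
    by (auto simp: l2_eq_def square_integrable_def borel_measurable_cinner)
  then show "(\<integral>s. cinner (f s) (g s) \<partial>Rplus) = (\<integral>s. cinner (f' s) (g' s) \<partial>Rplus)"
    using * by (intro integral_cong_AE) (auto simp: l2_eq_def)
qed

instantiation L2 :: (complex_hilbert) real_inner
begin
lift_definition zero_L2 :: "'a L2" is "\<lambda>_. 0" by (simp add: l2_eq_def square_integrable_zero)
lift_definition plus_L2 :: "'a L2 \<Rightarrow> 'a L2 \<Rightarrow> 'a L2" is "\<lambda>f g s. f s + g s"
  unfolding l2_eq_def by (auto simp: square_integrable_add)
lift_definition uminus_L2 :: "'a L2 \<Rightarrow> 'a L2" is "\<lambda>f s. - f s"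
  unfolding l2_eq_def by (auto simp: square_integrable_uminus)
definition minus_L2 :: "'a L2 \<Rightarrow> 'a L2 \<Rightarrow> 'a L2" where "minus_L2 f g = f + - g"
definition scaleR_L2 :: "real \<Rightarrow> 'a L2 \<Rightarrow> 'a L2" where "scaleR_L2 r f = L2_scale (complex_of_real r) f"
definition inner_L2 :: "'a L2 \<Rightarrow> 'a L2 \<Rightarrow> real" where "inner_L2 f g = Re (L2_ip f g)"
definition norm_L2 :: "'a L2 \<Rightarrow> real" where "norm_L2 f = sqrt (inner f f)"
definition dist_L2 :: "'a L2 \<Rightarrow> 'a L2 \<Rightarrow> real" where "dist_L2 f g = norm (f - g)"
definition sgn_L2 :: "'a L2 \<Rightarrow> 'a L2" where "sgn_L2 f = inverse (norm f) *\<^sub>R f"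
definition uniformity_L2 :: "('a L2 \<times> 'a L2) filter" where
  "uniformity_L2 = (INF e\<in>{0<..}. principal {(x::'a L2, y). dist x y < e})"
definition open_L2 :: "'a L2 set \<Rightarrow> bool" where
  "open_L2 U = (\<forall>x\<in>U. eventually (\<lambda>(x', y). x' = x \<longrightarrow> y \<in> U) uniformity)"

lemma l2_eqI: "square_integrable f \<Longrightarrow> (\<And>s. f s = g s) \<Longrightarrow> l2_eq f g"
  by (subgoal_tac "f = g") (auto simp: l2_eq_def)

lemma L2_vector_facts:
  fixes x y z :: "'a L2"
  shows "x + y + z = x + (y + z)" "x + y = y + x" "0 + x = x" "- x + x = 0"
    "L2_scale c (x + y) = L2_scale c x + L2_scale c y"
    "L2_scale (c + d) x = L2_scale c x + L2_scale d x"
    "L2_scale c (L2_scale d x) = L2_scale (c * d) x" "L2_scale 1 x = x"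
  by (transfer, rule l2_eqI,
      auto simp: l2_eq_def scaleC_add_right scaleC_add_left scaleC_scaleC
        intro!: square_integrable_add square_integrable_scaleC square_integrable_uminus
          square_integrable_zero)+

lemma L2_ip_facts:
  fixes x y z :: "'a L2"
  shows "L2_ip x y = cnj (L2_ip y x)"
    and "L2_ip x (y + z) = L2_ip x y + L2_ip x z"
    and "L2_ip x (L2_scale c y) = c * L2_ip x y"
    and "0 \<le> Re (L2_ip x x)" and "Re (L2_ip x x) = 0 \<longleftrightarrow> x = 0"
proof -
  show "L2_ip x y = cnj (L2_ip y x)"
    by transfer (subst cinner_commute, simp flip: integral_cnj)
  show "L2_ip x (y + z) = L2_ip x y + L2_ip x z"
    by transfer (simp add: cinner_add_right l2_eq_def integrable_cinner)
  show "L2_ip x (L2_scale c y) = c * L2_ip x y"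
    by transfer (simp add: cinner_scaleC_right)
  have eq: "Re (\<integral>s. cinner (f s) (f s) \<partial>Rplus) = (\<integral>s. (norm (f s))\<^sup>2 \<partial>Rplus)"
    if "l2_eq f f" for f :: "real \<Rightarrow> 'a"
    by (simp add: cinner_self del: of_real_power)
  show "0 \<le> Re (L2_ip x x)" by transfer (simp add: eq)
  show "Re (L2_ip x x) = 0 \<longleftrightarrow> x = 0"
  proof transfer
    fix f :: "real \<Rightarrow> 'a" assume f: "l2_eq f f"
    then have "(\<integral>s. (norm (f s))\<^sup>2 \<partial>Rplus) = 0 \<longleftrightarrow> (AE s in Rplus. (norm (f s))\<^sup>2 = 0)"
      by (intro integral_nonneg_eq_0_iff_AE) (auto simp: l2_eq_def square_integrable_def)
    then show "Re (\<integral>s. cinner (f s) (f s) \<partial>Rplus) = 0 \<longleftrightarrow> l2_eq f (\<lambda>_. 0)"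
      using f by (simp add: eq) (simp add: l2_eq_def square_integrable_zero)
  qed
qed

instance
proof
  fix x y z :: "'a L2" and a b :: real
  show "x + y + z = x + (y + z)" "x + y = y + x" "0 + x = x" "- x + x = 0"
    by (rule L2_vector_facts)+
  show "x - y = x + - y" by (rule minus_L2_def)
  show "a *\<^sub>R (x + y) = a *\<^sub>R x + a *\<^sub>R y" "(a + b) *\<^sub>R x = a *\<^sub>R x + b *\<^sub>R x"
    "a *\<^sub>R b *\<^sub>R x = (a * b) *\<^sub>R x" "1 *\<^sub>R x = x"
    by (simp_all add: scaleR_L2_def L2_vector_facts)
  show "inner x y = inner y x"
    using L2_ip_facts(1)[of x y] by (simp add: inner_L2_def)
  show "inner (x + y) z = inner x z + inner y z"
    unfolding inner_L2_def
    by (metis L2_ip_facts(1,2) complex_cnj_add plus_complex.simps(1))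
  show "inner (a *\<^sub>R x) y = a * inner x y"
  proof -
    have "L2_ip (L2_scale (complex_of_real a) x) y = cnj (complex_of_real a * L2_ip y x)"
      by (metis L2_ip_facts(1,3))
    also have "\<dots> = complex_of_real a * L2_ip x y"
      unfolding complex_cnj_mult complex_cnj_complex_of_real L2_ip_facts(1)[of x y] ..
    finally show ?thesis by (simp add: inner_L2_def scaleR_L2_def)
  qed
  show "0 \<le> inner x x" "inner x x = 0 \<longleftrightarrow> x = 0"
    by (simp_all add: inner_L2_def L2_ip_facts(4,5))
qed (rule norm_L2_def dist_L2_def sgn_L2_def uniformity_L2_def open_L2_def)+
end

instantiation L2 :: (complex_hilbert) complex_normed_vector
begin
definition scaleC_L2 :: "complex \<Rightarrow> 'a L2 \<Rightarrow> 'a L2" where "scaleC_L2 = L2_scale"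
instance
proof
  fix x y :: "'a L2" and c d :: complex and a :: real
  show "c *\<^sub>C (x + y) = c *\<^sub>C x + c *\<^sub>C y" "(c + d) *\<^sub>C x = c *\<^sub>C x + d *\<^sub>C x"
    "c *\<^sub>C d *\<^sub>C x = (c * d) *\<^sub>C x"
    by (simp_all add: scaleC_L2_def L2_vector_facts)
  show "complex_of_real a *\<^sub>C x = a *\<^sub>R x" by (simp add: scaleC_L2_def scaleR_L2_def)
  have "L2_ip (c *\<^sub>C x) (c *\<^sub>C x) = complex_of_real ((cmod c)\<^sup>2) * L2_ip x x"
    unfolding scaleC_L2_def complex_norm_square
    by (metis (no_types, lifting) L2_ip_facts(1,3) complex_cnj_mult mult.assoc mult.commute)
  then have "inner (c *\<^sub>C x) (c *\<^sub>C x) = (cmod c)\<^sup>2 * inner x x"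
    by (simp add: inner_L2_def del: of_real_power)
  then show "norm (c *\<^sub>C x) = cmod c * norm x"
    by (simp add: norm_eq_sqrt_inner real_sqrt_mult)
qed
end

lemma norm_L2_squared:
  assumes "square_integrable f"
  shows "(norm (abs_L2 f))\<^sup>2 = (\<integral>s. (norm (f s))\<^sup>2 \<partial>Rplus)"
proof -
  have "l2_eq f f" using assms by (simp add: l2_eq_def)
  then have "L2_ip (abs_L2 f) (abs_L2 f) = (\<integral>s. cinner (f s) (f s) \<partial>Rplus)"
    by (simp add: L2_ip.abs_eq)
  then show ?thesis
    by (simp add: power2_norm_eq_inner inner_L2_def cinner_self del: of_real_power)
qed

lemma abs_L2_diff:
  assumes "square_integrable f" "square_integrable g"
  shows "abs_L2 f - abs_L2 g = abs_L2 (\<lambda>s. f s - g s)" "square_integrable (\<lambda>s. f s - g s)"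
proof -
  have "l2_eq f f" "l2_eq g g" "l2_eq (\<lambda>s. - g s) (\<lambda>s. - g s)"
    using assms by (auto simp: l2_eq_def square_integrable_uminus)
  then show "abs_L2 f - abs_L2 g = abs_L2 (\<lambda>s. f s - g s)"
    by (simp add: minus_L2_def uminus_L2.abs_eq plus_L2.abs_eq)
  show "square_integrable (\<lambda>s. f s - g s)"
    using square_integrable_add[OF assms(1) square_integrable_uminus[OF assms(2)]] by simp
qed

lemma L2_fast_Cauchy_limit:
  fixes F :: "nat \<Rightarrow> real \<Rightarrow> 'k::complex_hilbert"
  assumes F: "\<And>n. square_integrable (F n)"
    and fast: "\<And>n. norm (abs_L2 (F (Suc n)) - abs_L2 (F n)) \<le> (1/2) ^ n"
    and Cauchy: "Cauchy (\<lambda>n. abs_L2 (F n))"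
  obtains g where "square_integrable g" "(\<lambda>n. abs_L2 (F n)) \<longlonglongrightarrow> abs_L2 g"
proof -
  have sm: "strongly_measurable (F n)" for n using F by (simp add: square_integrable_def)
  have [measurable]: "(\<lambda>s. (norm (F m s - F n s))\<^sup>2) \<in> borel_measurable Rplus" for m n
    by (intro borel_measurable_norm_squared strongly_measurable_diff sm)
  have nn: "(\<integral>\<^sup>+s. ennreal ((norm (F m s - F n s))\<^sup>2) \<partial>Rplus)
      = ennreal ((norm (abs_L2 (F m) - abs_L2 (F n)))\<^sup>2)" for m n
  proof -
    have d: "square_integrable (\<lambda>s. F m s - F n s)" using abs_L2_diff[OF F F] by blast
    then have "integrable Rplus (\<lambda>s. (norm (F m s - F n s))\<^sup>2)" by (simp add: square_integrable_def)
    then show ?thesis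
      by (subst nn_integral_eq_integral) (auto simp: abs_L2_diff[OF F F] norm_L2_squared[OF d])
  qed
  define G where "G s = (\<Sum>n. ennreal (2 ^ n * (norm (F (Suc n) s - F n s))\<^sup>2))" for s
  have G[measurable]: "G \<in> borel_measurable Rplus" unfolding G_def by measurable
  have "(\<integral>\<^sup>+s. G s \<partial>Rplus)
      = (\<Sum>n. \<integral>\<^sup>+s. ennreal (2 ^ n) * ennreal ((norm (F (Suc n) s - F n s))\<^sup>2) \<partial>Rplus)"
    unfolding G_def by (subst nn_integral_suminf) (auto simp: ennreal_mult)
  also have "\<dots> = (\<Sum>n. ennreal (2 ^ n * (norm (abs_L2 (F (Suc n)) - abs_L2 (F n)))\<^sup>2))"
    by (subst nn_integral_cmult) (auto simp: nn ennreal_mult)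
  also have "\<dots> \<le> (\<Sum>n. ennreal ((1/2) ^ n))"
  proof (intro suminf_le ennreal_leI)
    fix n
    have "2 ^ n * (norm (abs_L2 (F (Suc n)) - abs_L2 (F n)))\<^sup>2 \<le> 2 ^ n * ((1/2) ^ n)\<^sup>2"
      by (intro mult_left_mono power_mono fast) auto
    also have "\<dots> = (1/2) ^ n" by (simp add: power2_eq_square field_simps)
    finally show "2 ^ n * (norm (abs_L2 (F (Suc n)) - abs_L2 (F n)))\<^sup>2 \<le> (1/2) ^ n" .
  qed auto
  also have "\<dots> < \<infinity>"
    by (subst suminf_ennreal2) (auto intro: summable_geometric)
  finally have "AE s in Rplus. G s \<noteq> \<infinity>" by (intro nn_integral_PInf_AE) auto
  define A where "A = {s \<in> space Rplus. G s \<noteq> \<infinity>}"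
  have A: "A \<in> sets Rplus" unfolding A_def by measurable
  have conv: "convergent (\<lambda>n. F n s)" if "s \<in> A" for s
  proof -
    have "G s \<noteq> \<infinity>" using that by (simp add: A_def)
    then have sum: "summable (\<lambda>n. 2 ^ n * (norm (F (Suc n) s - F n s))\<^sup>2)"
      unfolding G_def by (intro summable_suminf_not_top) (auto simp: infinity_ennreal_def)
    have "summable (\<lambda>n. norm (F (Suc n) s - F n s))"
    proof (rule summable_comparison_test')
      show "summable (\<lambda>n. (1/2) ^ n + 2 ^ n * (norm (F (Suc n) s - F n s))\<^sup>2)"
        by (intro summable_add sum summable_geometric) auto
      fix n :: nat
      let ?x = "norm (F (Suc n) s - F n s)"
      show "norm ?x \<le> (1/2) ^ n + 2 ^ n * ?x\<^sup>2"
      proof (cases "?x \<le> (1/2) ^ n")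
        case True
        moreover have "0 \<le> 2 ^ n * ?x\<^sup>2" by simp
        ultimately show ?thesis unfolding real_norm_def abs_norm_cancel by linarith
      next
        case False
        then have "1 \<le> 2 ^ n * ?x" by (simp add: field_simps)
        then have "?x * 1 \<le> ?x * (2 ^ n * ?x)" by (intro mult_left_mono) auto
        also have "\<dots> = 2 ^ n * ?x\<^sup>2" by (simp add: power2_eq_square)
        finally have "?x \<le> 2 ^ n * ?x\<^sup>2" by simp
        moreover have "0 \<le> (1/2 :: real) ^ n" by simp
        ultimately show ?thesis unfolding real_norm_def abs_norm_cancel by linarith
      qed
    qed
    then have "Cauchy (\<lambda>n. F n s)"
    proof -
      assume S: "summable (\<lambda>n. norm (F (Suc n) s - F n s))"
      show ?thesis
      proof (rule metric_CauchyI)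
        fix e :: real assume "0 < e"
        then obtain N where N: "\<And>m n. m \<ge> N \<Longrightarrow> norm (\<Sum>i=m..<n. norm (F (Suc i) s - F i s)) < e"
          using S unfolding summable_Cauchy by blast
        have le: "norm (F n s - F m s) < e" if "N \<le> m" "m \<le> n" for m n
        proof -
          have "F n s - F m s = (\<Sum>i=m..<n. F (Suc i) s - F i s)"
            using sum_Suc_diff'[OF that(2), of "\<lambda>i. F i s"] by simp
          then have "norm (F n s - F m s) \<le> (\<Sum>i=m..<n. norm (F (Suc i) s - F i s))"
            by (simp add: norm_sum)
          also have "\<dots> < e" using N[OF that(1), of n] by simp
          finally show ?thesis .
        qed
        have "dist (F m s) (F n s) < e" if "N \<le> m" "N \<le> n" for m n
          using le[of m n] le[of n m] that by (cases "m \<le> n") (auto simp: dist_norm norm_minus_commute)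
        then show "\<exists>M. \<forall>m\<ge>M. \<forall>n\<ge>M. dist (F m s) (F n s) < e" by blast
      qed
    qed
    then show ?thesis by (rule Cauchy_convergent)
  qed
  define g where "g s = (if s \<in> A then lim (\<lambda>n. F n s) else 0)" for s
  have lim: "(\<lambda>n. F n s) \<longlonglongrightarrow> g s" if "s \<in> A" for s
    using conv[OF that] that by (simp add: g_def convergent_LIMSEQ_iff)
  have AE_A: "AE s in Rplus. s \<in> A"
    using \<open>AE s in Rplus. G s \<noteq> \<infinity>\<close> AE_space by eventually_elim (simp add: A_def)
  have sm_g: "strongly_measurable g"
    unfolding strongly_measurable_def
  proof (intro conjI allI)
    fix h :: 'k
    show "(\<lambda>s. cinner h (g s)) \<in> borel_measurable Rplus"
    proof (rule borel_measurable_LIMSEQ_metric)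
      fix n
      have [measurable]: "(\<lambda>s. cinner h (F n s)) \<in> borel_measurable Rplus"
        using sm by (simp add: strongly_measurable_def)
      show "(\<lambda>s. if s \<in> A then cinner h (F n s) else 0) \<in> borel_measurable Rplus"
        using A by measurable
    next
      fix s
      show "(\<lambda>n. if s \<in> A then cinner h (F n s) else 0) \<longlonglongrightarrow> cinner h (g s)"
        using bounded_linear.tendsto[OF bounded_linear_cinner_right lim]
          linear_0[OF bounded_linear.linear[OF bounded_linear_cinner_right[of h]]]
        by (cases "s \<in> A") (auto simp: g_def)
    qed
  next
    obtain D where D: "\<And>n. countable (D n)" "\<And>n. F n ` {0..} \<subseteq> closure (D n)"
      using sm unfolding strongly_measurable_def by metis
    let ?E = "insert 0 (\<Union>n. D n)"
    have "g s \<in> closure ?E" for s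
    proof (cases "s \<in> A")
      case True
      then have "F n s \<in> closure ?E" for n
        using D(2)[of n] closure_mono[of "D n" ?E] by (force simp: A_def space_restrict_space)
      then show ?thesis
        using closed_sequentially[OF closed_closure, of "\<lambda>n. F n s"] lim[OF True] by blast
    next
      case False then show ?thesis using closure_subset[of ?E] by (auto simp: g_def)
    qed
    then show "\<exists>D. countable D \<and> g ` {0..} \<subseteq> closure D"
      using D(1) by (intro exI[of _ ?E]) auto
  qed
  have fatou: "(\<integral>\<^sup>+s. ennreal ((norm (g s - F n s))\<^sup>2) \<partial>Rplus) \<le> ennreal (e\<^sup>2)"
    if N: "\<forall>m\<ge>N. norm (abs_L2 (F m) - abs_L2 (F n)) \<le> e" for n N e
  proof -
    have "(\<integral>\<^sup>+s. ennreal ((norm (g s - F n s))\<^sup>2) \<partial>Rplus)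
        = (\<integral>\<^sup>+s. liminf (\<lambda>m. ennreal ((norm (F m s - F n s))\<^sup>2)) \<partial>Rplus)"
    proof (rule nn_integral_cong_AE)
      show "AE s in Rplus. ennreal ((norm (g s - F n s))\<^sup>2)
          = liminf (\<lambda>m. ennreal ((norm (F m s - F n s))\<^sup>2))"
        using AE_A
      proof eventually_elim
        fix s assume "s \<in> A"
        then have "(\<lambda>m. ennreal ((norm (F m s - F n s))\<^sup>2)) \<longlonglongrightarrow> ennreal ((norm (g s - F n s))\<^sup>2)"
          by (intro tendsto_intros tendsto_ennrealI lim)
        then show "ennreal ((norm (g s - F n s))\<^sup>2) = liminf (\<lambda>m. ennreal ((norm (F m s - F n s))\<^sup>2))"
          by (rule lim_imp_Liminf[OF sequentially_bot, symmetric])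
      qed
    qed
    also have "\<dots> \<le> liminf (\<lambda>m. \<integral>\<^sup>+s. ennreal ((norm (F m s - F n s))\<^sup>2) \<partial>Rplus)"
      by (intro nn_integral_liminf) measurable
    also have "\<dots> \<le> ennreal (e\<^sup>2)"
      unfolding nn
    proof (rule order_trans[OF Liminf_mono])
      show "\<forall>\<^sub>F m in sequentially. ennreal ((norm (abs_L2 (F m) - abs_L2 (F n)))\<^sup>2) \<le> ennreal (e\<^sup>2)"
        using N by (auto simp: eventually_sequentially intro!: ennreal_leI power_mono exI[of _ N])
    qed (simp add: Liminf_const)
    finally show ?thesis .
  qed
  have sq_diff: "square_integrable (\<lambda>s. g s - F n s)" if N: "\<forall>m\<ge>N. norm (abs_L2 (F m) - abs_L2 (F n)) \<le> e" for n N e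
    unfolding square_integrable_def
  proof
    show sd: "strongly_measurable (\<lambda>s. g s - F n s)" by (intro strongly_measurable_diff sm sm_g)
    show "integrable Rplus (\<lambda>s. (norm (g s - F n s))\<^sup>2)"
    proof (rule integrableI_bounded)
      show "(\<lambda>s. (norm (g s - F n s))\<^sup>2) \<in> borel_measurable Rplus"
        by (rule borel_measurable_norm_squared[OF sd])
      show "(\<integral>\<^sup>+s. ennreal (norm ((norm (g s - F n s))\<^sup>2)) \<partial>Rplus) < \<infinity>"
        using fatou[OF N] by (simp add: le_less_trans)
    qed
  qed
  have C: "\<exists>N. \<forall>n\<ge>N. \<forall>m\<ge>N. norm (abs_L2 (F m) - abs_L2 (F n)) \<le> e" if "e > 0" for e
    using CauchyD[OF Cauchy that] less_imp_le by blast
  obtain N1 where N1: "\<forall>n\<ge>N1. \<forall>m\<ge>N1. norm (abs_L2 (F m) - abs_L2 (F n)) \<le> 1" using C[of 1] by auto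
  have "square_integrable (\<lambda>s. (g s - F N1 s) + F N1 s)"
    by (intro square_integrable_add sq_diff[of N1 N1 1] F) (use N1 in auto)
  then have g: "square_integrable g" by simp
  have "(\<lambda>n. abs_L2 (F n)) \<longlonglongrightarrow> abs_L2 g"
  proof (rule LIMSEQ_I)
    fix e :: real assume e: "0 < e"
    then obtain N where N: "\<forall>n\<ge>N. \<forall>m\<ge>N. norm (abs_L2 (F m) - abs_L2 (F n)) \<le> e / 2"
      using C[of "e / 2"] by auto
    have "norm (abs_L2 (F n) - abs_L2 g) < e" if "n \<ge> N" for n
    proof -
      have Nn: "\<forall>m\<ge>N. norm (abs_L2 (F m) - abs_L2 (F n)) \<le> e / 2" using N that by blast
      note d = sq_diff[OF Nn]
      have "ennreal ((norm (abs_L2 g - abs_L2 (F n)))\<^sup>2) = (\<integral>\<^sup>+s. ennreal ((norm (g s - F n s))\<^sup>2) \<partial>Rplus)"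
        using d unfolding abs_L2_diff(1)[OF g F] norm_L2_squared[OF d]
        by (intro nn_integral_eq_integral[symmetric]) (auto simp: square_integrable_def)
      also have "\<dots> \<le> ennreal ((e / 2)\<^sup>2)" by (rule fatou[OF Nn])
      finally have "(norm (abs_L2 g - abs_L2 (F n)))\<^sup>2 \<le> (e / 2)\<^sup>2"
        by (subst (asm) ennreal_le_iff) auto
      then have "norm (abs_L2 g - abs_L2 (F n)) \<le> e / 2"
        by (rule power2_le_imp_le) (use e in simp)
      then show ?thesis using e by (simp add: norm_minus_commute)
    qed
    then show "\<exists>N. \<forall>n\<ge>N. norm (abs_L2 (F n) - abs_L2 g) < e" by blast
  qed
  with g show ?thesis by (rule that)
qed

instantiation L2 :: (complex_hilbert) complex_hilbert
begin
definition cinner_L2 :: "'a L2 \<Rightarrow> 'a L2 \<Rightarrow> complex" where "cinner_L2 = L2_ip"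
instance
proof
  fix x y z :: "'a L2" and c :: complex
  show "cinner x y = cnj (cinner y x)" "cinner x (y + z) = cinner x y + cinner x z"
    "cinner x (c *\<^sub>C y) = c * cinner x y"
    unfolding cinner_L2_def scaleC_L2_def by (rule L2_ip_facts)+
  show "Re (cinner x y) = inner x y" by (simp add: inner_L2_def cinner_L2_def)
next
  fix X :: "nat \<Rightarrow> 'a L2"
  assume X: "Cauchy X"
  have "\<forall>n. \<exists>N. \<forall>p\<ge>N. \<forall>q\<ge>N. norm (X p - X q) < (1/2) ^ n"
    using CauchyD[OF X] by simp
  then obtain N where N: "\<And>n p q. p \<ge> N n \<Longrightarrow> q \<ge> N n \<Longrightarrow> norm (X p - X q) < (1/2) ^ n"
    by metis
  define r where "r n = n + (\<Sum>i\<le>n. N i)" for n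
  have r: "strict_mono r" unfolding strict_mono_Suc_iff r_def by simp
  have rN: "r n \<ge> N n" for n unfolding r_def by (simp add: member_le_sum trans_le_add2)
  have "\<forall>n. \<exists>f. square_integrable f \<and> X (r n) = abs_L2 f"
  proof
    fix n show "\<exists>f. square_integrable f \<and> X (r n) = abs_L2 f"
      using Quotient_rep_reflp[OF Quotient_L2, of "X (r n)"] Quotient_abs_rep[OF Quotient_L2, of "X (r n)"]
      by (intro exI[of _ "rep_L2 (X (r n))"]) (simp add: l2_eq_def)
  qed
  then obtain F where F: "\<And>n. square_integrable (F n)" "\<And>n. X (r n) = abs_L2 (F n)" by metis
  have fast: "norm (abs_L2 (F (Suc n)) - abs_L2 (F n)) \<le> (1/2) ^ n" for n
  proof -
    have "r n \<le> r (Suc n)" using strict_monoD[OF r, of n "Suc n"] by simp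
    then show ?thesis using N[of n "r (Suc n)" "r n"] rN[of n] by (simp flip: F(2))
  qed
  have C: "Cauchy (\<lambda>n. abs_L2 (F n))"
    using Cauchy_subseq_Cauchy[OF X r] by (simp add: o_def F(2))
  obtain g where "(\<lambda>n. abs_L2 (F n)) \<longlonglongrightarrow> abs_L2 g"
    using L2_fast_Cauchy_limit[OF F(1) fast C] by blast
  then have "(X \<circ> r) \<longlonglongrightarrow> abs_L2 g" by (simp add: o_def F(2))
  then have "X \<longlonglongrightarrow> abs_L2 g" by (rule Cauchy_converges_subseq[OF X r])
  then show "convergent X" by (auto simp: convergent_def)
qed
end


section \<open>Operator spaces and their spatial tensor products\<close>

abbreviation cspan :: "'a::complex_normed_vector set \<Rightarrow> 'a set" where
  "cspan \<equiv> module.span (*\<^sub>C)"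

abbreviation csubspace :: "'a::complex_normed_vector set \<Rightarrow> bool" where
  "csubspace \<equiv> module.subspace (*\<^sub>C)"

definition clinear_on ::
  "'a::complex_normed_vector set \<Rightarrow> ('a \<Rightarrow> 'b::complex_normed_vector) \<Rightarrow> bool" where
  "clinear_on A f \<longleftrightarrow> (\<forall>x\<in>A. \<forall>y\<in>A. f (x + y) = f x + f y) \<and> (\<forall>c. \<forall>x\<in>A. f (c *\<^sub>C x) = c *\<^sub>C f x)"

text \<open>The space \<open>B(H; K)\<close>; \<open>'a \<Rightarrow>\<^sub>L 'b\<close> consists of the real-linear bounded operators.\<close>

definition bounded_ops :: "('a::complex_hilbert \<Rightarrow>\<^sub>L 'b::complex_hilbert) set" where
  "bounded_ops = {T. clinear_on UNIV (blinfun_apply T)}"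

definition operator_space :: "('a::complex_hilbert \<Rightarrow>\<^sub>L 'a) set \<Rightarrow> bool" where
  "operator_space C \<longleftrightarrow> C \<subseteq> bounded_ops \<and> csubspace C \<and> closed C"

text \<open>The norm of the \<open>n \<times> n\<close> operator matrix \<open>[X i j]\<close> as an operator between \<open>n\<close>-fold
  Hilbert space direct sums.\<close>

definition matrix_norm ::
  "nat \<Rightarrow> (nat \<Rightarrow> nat \<Rightarrow> 'a::complex_hilbert \<Rightarrow>\<^sub>L 'b::complex_hilbert) \<Rightarrow> real" where
  "matrix_norm n X = (SUP \<xi> \<in> {\<xi>. (\<Sum>j<n. (norm (\<xi> j))\<^sup>2) \<le> 1}.
     sqrt (\<Sum>i<n. (norm (\<Sum>j<n. blinfun_apply (X i j) (\<xi> j)))\<^sup>2))"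

definition cb_bound ::
  "('a::complex_hilbert \<Rightarrow>\<^sub>L 'a) set \<Rightarrow> ('a \<Rightarrow>\<^sub>L 'a \<Rightarrow> 'b::complex_hilbert \<Rightarrow>\<^sub>L 'b) \<Rightarrow> real \<Rightarrow> bool" where
  "cb_bound C \<phi> M \<longleftrightarrow> (\<forall>n X. (\<forall>i<n. \<forall>j<n. X i j \<in> C) \<longrightarrow>
     matrix_norm n (\<lambda>i j. \<phi> (X i j)) \<le> M * matrix_norm n X)"

definition CB ::
  "('a::complex_hilbert \<Rightarrow>\<^sub>L 'a) set \<Rightarrow> ('b::complex_hilbert \<Rightarrow>\<^sub>L 'b) set \<Rightarrow>
    ('a \<Rightarrow>\<^sub>L 'a \<Rightarrow> 'b \<Rightarrow>\<^sub>L 'b) set" where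
  "CB C D = {\<phi>. clinear_on C \<phi> \<and> \<phi> ` C \<subseteq> D \<and> (\<exists>M. cb_bound C \<phi> M)}"

definition complete_contractions ::
  "('a::complex_hilbert \<Rightarrow>\<^sub>L 'a) set \<Rightarrow> ('b::complex_hilbert \<Rightarrow>\<^sub>L 'b) set \<Rightarrow>
    ('a \<Rightarrow>\<^sub>L 'a \<Rightarrow> 'b \<Rightarrow>\<^sub>L 'b) set" where
  "complete_contractions C D = {\<phi>. clinear_on C \<phi> \<and> \<phi> ` C \<subseteq> D \<and> cb_bound C \<phi> 1}"

definition op_tensor ::
  "('a::complex_hilbert \<Rightarrow>\<^sub>L 'a) \<Rightarrow> ('b::complex_hilbert \<Rightarrow>\<^sub>L 'b) \<Rightarrow> ('a, 'b) htens \<Rightarrow>\<^sub>L ('a, 'b) htens"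
  (infixr "\<otimes>\<^sub>o" 70) where
  "a \<otimes>\<^sub>o b = (THE T. T \<in> bounded_ops \<and>
     (\<forall>x y. blinfun_apply T (x \<otimes>\<^sub>h y) = blinfun_apply a x \<otimes>\<^sub>h blinfun_apply b y))"

definition spatial_tensor ::
  "('a::complex_hilbert \<Rightarrow>\<^sub>L 'a) set \<Rightarrow> ('b::complex_hilbert \<Rightarrow>\<^sub>L 'b) set \<Rightarrow>
    (('a, 'b) htens \<Rightarrow>\<^sub>L ('a, 'b) htens) set" (infixr "\<otimes>\<^sub>s" 70) where
  "A \<otimes>\<^sub>s B = closure (cspan {a \<otimes>\<^sub>o b | a b. a \<in> A \<and> b \<in> B})"

text \<open>\<open>T\<close> is the continuous linear extension of \<open>a \<otimes> b \<mapsto> \<beta> a b\<close> to the spatial tensor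
  product.  It is unique there, and it exists in all uses below, where \<open>\<beta>\<close> is the tensor product
  of two completely bounded maps.\<close>

definition is_tensor_ext ::
  "('a::complex_hilbert \<Rightarrow>\<^sub>L 'a) set \<Rightarrow> ('b::complex_hilbert \<Rightarrow>\<^sub>L 'b) set \<Rightarrow>
    ('a \<Rightarrow>\<^sub>L 'a \<Rightarrow> 'b \<Rightarrow>\<^sub>L 'b \<Rightarrow> 'c::complex_normed_vector) \<Rightarrow>
    (('a, 'b) htens \<Rightarrow>\<^sub>L ('a, 'b) htens \<Rightarrow> 'c) \<Rightarrow> bool" where
  "is_tensor_ext A B \<beta> T \<longleftrightarrow>
     clinear_on (A \<otimes>\<^sub>s B) T \<and> (\<exists>M. \<forall>u\<in>A \<otimes>\<^sub>s B. norm (T u) \<le> M * norm u) \<and>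
     (\<forall>a\<in>A. \<forall>b\<in>B. T (a \<otimes>\<^sub>o b) = \<beta> a b)"

definition tensor_ext ::
  "('a::complex_hilbert \<Rightarrow>\<^sub>L 'a) set \<Rightarrow> ('b::complex_hilbert \<Rightarrow>\<^sub>L 'b) set \<Rightarrow>
    ('a \<Rightarrow>\<^sub>L 'a \<Rightarrow> 'b \<Rightarrow>\<^sub>L 'b \<Rightarrow> 'c::complex_normed_vector) \<Rightarrow>
    ('a, 'b) htens \<Rightarrow>\<^sub>L ('a, 'b) htens \<Rightarrow> 'c" where
  "tensor_ext A B \<beta> = (SOME T. is_tensor_ext A B \<beta> T)"

section \<open>Operator space coalgebras and convolution\<close>

text \<open>Equality of operators on \<open>(H \<otimes> H) \<otimes> H\<close> and \<open>H \<otimes> (H \<otimes> H)\<close> under the canonical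
  identification of these two spaces.\<close>

definition eq_up_to_assoc ::
  "((('a::complex_hilbert, 'a) htens, 'a) htens \<Rightarrow>\<^sub>L (('a, 'a) htens, 'a) htens) \<Rightarrow>
   (('a, ('a, 'a) htens) htens \<Rightarrow>\<^sub>L ('a, ('a, 'a) htens) htens) \<Rightarrow> bool" where
  "eq_up_to_assoc S T \<longleftrightarrow> (\<forall>x y z x' y' z'.
     cinner ((x \<otimes>\<^sub>h y) \<otimes>\<^sub>h z) (blinfun_apply S ((x' \<otimes>\<^sub>h y') \<otimes>\<^sub>h z')) =
     cinner (x \<otimes>\<^sub>h y \<otimes>\<^sub>h z) (blinfun_apply T (x' \<otimes>\<^sub>h y' \<otimes>\<^sub>h z')))"

text \<open>For the counit, \<open>\<complex>\<close> is identified with \<open>B(\<complex>)\<close>, a scalar acting by multiplication.\<close>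

definition operator_space_coalgebra ::
  "('h::complex_hilbert \<Rightarrow>\<^sub>L 'h) set \<Rightarrow> ('h \<Rightarrow>\<^sub>L 'h \<Rightarrow> complex) \<Rightarrow>
    ('h \<Rightarrow>\<^sub>L 'h \<Rightarrow> ('h, 'h) htens \<Rightarrow>\<^sub>L ('h, 'h) htens) \<Rightarrow> bool" where
  "operator_space_coalgebra C \<epsilon> \<Delta> \<longleftrightarrow>
     operator_space C \<and>
     (\<lambda>x. blinfun_mult_right (\<epsilon> x)) \<in> complete_contractions C bounded_ops \<and>
     \<Delta> \<in> complete_contractions C (C \<otimes>\<^sub>s C) \<and>
     (\<exists>\<Delta>_id id_\<Delta>.
        is_tensor_ext C C (\<lambda>a b. \<Delta> a \<otimes>\<^sub>o b) \<Delta>_id \<and>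
        is_tensor_ext C C (\<lambda>a b. a \<otimes>\<^sub>o \<Delta> b) id_\<Delta> \<and>
        (\<forall>x\<in>C. eq_up_to_assoc (\<Delta>_id (\<Delta> x)) (id_\<Delta> (\<Delta> x)))) \<and>
     (\<exists>\<epsilon>_id id_\<epsilon>.
        is_tensor_ext C C (\<lambda>a b. \<epsilon> a *\<^sub>C b) \<epsilon>_id \<and>
        is_tensor_ext C C (\<lambda>a b. \<epsilon> b *\<^sub>C a) id_\<epsilon> \<and>
        (\<forall>x\<in>C. \<epsilon>_id (\<Delta> x) = x \<and> id_\<epsilon> (\<Delta> x) = x))"

definition bounded_functionals ::
  "('h::complex_hilbert \<Rightarrow>\<^sub>L 'h) set \<Rightarrow> ('h \<Rightarrow>\<^sub>L 'h \<Rightarrow> complex) set" where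
  "bounded_functionals C = {\<omega>. clinear_on C \<omega> \<and> (\<exists>M. \<forall>x\<in>C. cmod (\<omega> x) \<le> M * norm x)}"

definition functional_norm ::
  "('h::complex_hilbert \<Rightarrow>\<^sub>L 'h) set \<Rightarrow> ('h \<Rightarrow>\<^sub>L 'h \<Rightarrow> complex) \<Rightarrow> real" where
  "functional_norm C \<omega> = (SUP x\<in>{x \<in> C. norm x \<le> 1}. cmod (\<omega> x))"

definition convolution ::
  "('h::complex_hilbert \<Rightarrow>\<^sub>L 'h) set \<Rightarrow> ('h \<Rightarrow>\<^sub>L 'h \<Rightarrow> ('h, 'h) htens \<Rightarrow>\<^sub>L ('h, 'h) htens) \<Rightarrow>
    ('h \<Rightarrow>\<^sub>L 'h \<Rightarrow> complex) \<Rightarrow> ('h \<Rightarrow>\<^sub>L 'h \<Rightarrow> complex) \<Rightarrow> 'h \<Rightarrow>\<^sub>L 'h \<Rightarrow> complex" where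
  "convolution C \<Delta> \<omega>\<^sub>1 \<omega>\<^sub>2 x = tensor_ext C C (\<lambda>a b. \<omega>\<^sub>1 a * \<omega>\<^sub>2 b) (\<Delta> x)"

definition convolution_semigroup ::
  "('h::complex_hilbert \<Rightarrow>\<^sub>L 'h) set \<Rightarrow> ('h \<Rightarrow>\<^sub>L 'h \<Rightarrow> complex) \<Rightarrow>
    ('h \<Rightarrow>\<^sub>L 'h \<Rightarrow> ('h, 'h) htens \<Rightarrow>\<^sub>L ('h, 'h) htens) \<Rightarrow>
    (real \<Rightarrow> 'h \<Rightarrow>\<^sub>L 'h \<Rightarrow> complex) \<Rightarrow> bool" where
  "convolution_semigroup C \<epsilon> \<Delta> \<Lambda> \<longleftrightarrow>
     (\<forall>t\<ge>0. \<Lambda> t \<in> bounded_functionals C) \<and>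
     (\<forall>x\<in>C. \<Lambda> 0 x = \<epsilon> x) \<and>
     (\<forall>s\<ge>0. \<forall>t\<ge>0. \<forall>x\<in>C. \<Lambda> (s + t) x = convolution C \<Delta> (\<Lambda> s) (\<Lambda> t) x)"

definition norm_continuous ::
  "('h::complex_hilbert \<Rightarrow>\<^sub>L 'h) set \<Rightarrow> (real \<Rightarrow> 'h \<Rightarrow>\<^sub>L 'h \<Rightarrow> complex) \<Rightarrow> bool" where
  "norm_continuous C \<Lambda> \<longleftrightarrow>
     (\<forall>t\<ge>0. ((\<lambda>s. functional_norm C (\<lambda>x. \<Lambda> s x - \<Lambda> t x)) \<longlongrightarrow> 0) (at t within {0..}))"

section \<open>Processes\<close>

type_synonym 'k fock = "'k L2 list ell2"

definition restr :: "real set \<Rightarrow> (real \<Rightarrow> 'k::complex_hilbert) \<Rightarrow> real \<Rightarrow> 'k" where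
  "restr I f = (\<lambda>s. if s \<in> I then f s else 0)"

definition step_functions :: "(real \<Rightarrow> 'k::complex_hilbert) set" where
  "step_functions = {f. \<exists>(n::nat) c t. (\<forall>i<n. 0 \<le> t i) \<and>
     f = (\<lambda>s. \<Sum>i<n. restr {0..<t i} (\<lambda>_. c i) s)}"

lemma square_integrable_restr_const: "square_integrable (restr {0..<t} (\<lambda>_. c))"
proof -
  have [measurable]: "{0..<t} \<in> sets Rplus" by (auto simp: sets_restrict_space_iff)
  have "strongly_measurable (restr {0..<t} (\<lambda>_. c))"
    unfolding strongly_measurable_def
  proof (intro conjI allI)
    fix h
    have "(\<lambda>s. cinner h (restr {0..<t} (\<lambda>_. c) s)) =
        (\<lambda>s. if s \<in> {0..<t} then cinner h c else cinner h 0)"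
      by (auto simp: restr_def fun_eq_iff)
    also have "\<dots> \<in> borel_measurable Rplus" by measurable
    finally show "(\<lambda>s. cinner h (restr {0..<t} (\<lambda>_. c) s)) \<in> borel_measurable Rplus" .
    have "restr {0..<t} (\<lambda>_. c) ` {0..} \<subseteq> closure {0, c}"
      using closure_subset[of "{0, c}"] by (auto simp: restr_def)
    then show "\<exists>D. countable D \<and> restr {0..<t} (\<lambda>_. c) ` {0..} \<subseteq> closure D"
      by (intro exI[of _ "{0, c}"]) simp
  qed
  moreover have "integrable Rplus (\<lambda>s. (norm (restr {0..<t} (\<lambda>_. c) s))\<^sup>2)"
  proof -
    have "(\<lambda>s. (norm (restr {0..<t} (\<lambda>_. c) s))\<^sup>2) = (\<lambda>s. indicator {0..<t} s *\<^sub>R (norm c)\<^sup>2)"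
      by (auto simp: restr_def fun_eq_iff)
    moreover have "emeasure Rplus {0..<t} < \<infinity>"
      by (subst emeasure_restrict_space) (cases "0 \<le> t"; auto)+
    ultimately show ?thesis by (simp add: integrable_indicator)
  qed
  ultimately show ?thesis by (simp add: square_integrable_def)
qed

lemma square_integrable_step_functions:
  assumes "f \<in> step_functions" shows "square_integrable f"
proof -
  obtain n :: nat and c t where f: "f = (\<lambda>s. \<Sum>i<n. restr {0..<t i} (\<lambda>_. c i) s)"
    using assms unfolding step_functions_def by blast
  have "square_integrable (\<lambda>s. \<Sum>i<n. restr {0..<t i} (\<lambda>_. c i) s)"
    by (induction n) (simp_all add: square_integrable_zero square_integrable_add
        square_integrable_restr_const)
  then show ?thesis by (simp add: f)
qed

lemma exp_vec_in_sym_fock: "exp_vec f \<in> sym_fock"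
proof -
  have "(\<Prod>b\<leftarrow>bs. cinner b f) = (\<Prod>b\<leftarrow>bs'. cinner b f)" if "mset bs = mset bs'" for bs bs'
    using that by (metis mset_map prod_mset_prod_list)
  then have "Rep_ell2 (exp_vec f) bs = Rep_ell2 (exp_vec f) bs'" if "mset bs = mset bs'" for bs bs'
    using that mset_eq_setD[OF that] mset_eq_length[OF that] unfolding exp_vec.rep_eq by metis
  moreover have "Rep_ell2 (exp_vec f) bs = 0" if "\<not> set bs \<subseteq> onb" for bs
    using that unfolding exp_vec.rep_eq by (rule if_not_P)
  ultimately show ?thesis unfolding sym_fock_def by blast
qed

text \<open>The adjoint of the right shift by \<open>t\<close>.\<close>

definition left_shift :: "real \<Rightarrow> (real \<Rightarrow> 'k::complex_hilbert) \<Rightarrow> real \<Rightarrow> 'k" where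
  "left_shift t f = (\<lambda>s. if 0 \<le> s then f (s + t) else 0)"

definition expv :: "(real \<Rightarrow> 'k::complex_hilbert) \<Rightarrow> 'k fock" where
  "expv f = exp_vec (abs_L2 f)"

definition exp_domain :: "'k::complex_hilbert fock set" where
  "exp_domain = cspan (expv ` step_functions)"

definition mat_el ::
  "(real \<Rightarrow> 'x \<Rightarrow> 'k::complex_hilbert fock \<Rightarrow> 'k fock) \<Rightarrow> (real \<Rightarrow> 'k) \<Rightarrow> (real \<Rightarrow> 'k) \<Rightarrow> real \<Rightarrow> 'x \<Rightarrow> complex"
where
  "mat_el k f' f t x = cinner (expv f') (k t x (expv f))"

definition process_on ::
  "('h::complex_hilbert \<Rightarrow>\<^sub>L 'h) set \<Rightarrow> (real \<Rightarrow> 'h \<Rightarrow>\<^sub>L 'h \<Rightarrow> 'k::complex_hilbert fock \<Rightarrow> 'k fock) \<Rightarrow> bool"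
where
  "process_on C k \<longleftrightarrow>
     (\<forall>t\<ge>0. (\<forall>x\<in>C. clinear_on exp_domain (k t x) \<and> k t x ` exp_domain \<subseteq> sym_fock) \<and>
        (\<forall>v\<in>exp_domain. clinear_on C (\<lambda>x. k t x v))) \<and>
     (\<forall>f'\<in>step_functions. \<forall>f\<in>step_functions. \<forall>x\<in>C.
        (\<lambda>s. mat_el k f' f s x) \<in> borel_measurable Rplus \<and>
        (\<forall>t\<ge>0. mat_el k f' f t x =
           cinner (expv (restr {t..} f')) (expv (restr {t..} f)) *
           mat_el k (restr {0..<t} f') (restr {0..<t} f) t x))"

definition weakly_bounded_process ::
  "('h::complex_hilbert \<Rightarrow>\<^sub>L 'h) set \<Rightarrow> (real \<Rightarrow> 'h \<Rightarrow>\<^sub>L 'h \<Rightarrow> 'k::complex_hilbert fock \<Rightarrow> 'k fock) \<Rightarrow> bool"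
where
  "weakly_bounded_process C k \<longleftrightarrow> process_on C k \<and>
     (\<forall>t\<ge>0. \<forall>f'\<in>step_functions. \<forall>f\<in>step_functions. mat_el k f' f t \<in> bounded_functionals C)"

section \<open>Quantum stochastic differential equations and convolution cocycles\<close>

definition hat :: "'k \<Rightarrow> complex \<times> 'k" where "hat c = (1, c)"

definition op_mat_el ::
  "('x \<Rightarrow> 'b::complex_hilbert \<Rightarrow>\<^sub>L 'b) \<Rightarrow> 'b \<Rightarrow> 'b \<Rightarrow> 'x \<Rightarrow> complex" where
  "op_mat_el \<phi> \<zeta>' \<zeta> x = cinner \<zeta>' (blinfun_apply (\<phi> x) \<zeta>)"

definition weak_solution ::
  "('h::complex_hilbert \<Rightarrow>\<^sub>L 'h) set \<Rightarrow> ('h \<Rightarrow>\<^sub>L 'h \<Rightarrow> complex) \<Rightarrow>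
    ('h \<Rightarrow>\<^sub>L 'h \<Rightarrow> ('h, 'h) htens \<Rightarrow>\<^sub>L ('h, 'h) htens) \<Rightarrow>
    ('h \<Rightarrow>\<^sub>L 'h \<Rightarrow> (complex \<times> 'k::complex_hilbert) \<Rightarrow>\<^sub>L (complex \<times> 'k)) \<Rightarrow>
    (real \<Rightarrow> 'h \<Rightarrow>\<^sub>L 'h \<Rightarrow> 'k fock \<Rightarrow> 'k fock) \<Rightarrow> bool" where
  "weak_solution C \<epsilon> \<Delta> \<phi> k \<longleftrightarrow> weakly_bounded_process C k \<and>
     (\<forall>f'\<in>step_functions. \<forall>f\<in>step_functions. \<forall>x\<in>C.
        (\<forall>\<zeta>' \<zeta>. continuous_on {0..}
           (\<lambda>s. convolution C \<Delta> (mat_el k f' f s) (op_mat_el \<phi> \<zeta>' \<zeta>) x)) \<and>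
        (\<forall>t\<ge>0. mat_el k f' f t x = cinner (expv f') (expv f) * \<epsilon> x +
           integral {0..t} (\<lambda>s. convolution C \<Delta> (mat_el k f' f s)
             (op_mat_el \<phi> (hat (f' s)) (hat (f s))) x)))"

definition weak_cocycle ::
  "('h::complex_hilbert \<Rightarrow>\<^sub>L 'h) set \<Rightarrow> ('h \<Rightarrow>\<^sub>L 'h \<Rightarrow> ('h, 'h) htens \<Rightarrow>\<^sub>L ('h, 'h) htens) \<Rightarrow>
    (real \<Rightarrow> 'h \<Rightarrow>\<^sub>L 'h \<Rightarrow> 'k::complex_hilbert fock \<Rightarrow> 'k fock) \<Rightarrow> bool" where
  "weak_cocycle C \<Delta> l \<longleftrightarrow> weakly_bounded_process C l \<and>
     (\<forall>f'\<in>step_functions. \<forall>f\<in>step_functions. \<forall>s\<ge>0. \<forall>t\<ge>0. \<forall>x\<in>C.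
        mat_el l f' f (s + t) x =
          cinner (expv (restr {s + t..} f')) (expv (restr {s + t..} f)) *
          convolution C \<Delta>
            (mat_el l (restr {0..<s} f') (restr {0..<s} f) s)
            (mat_el l (left_shift s (restr {s..<s + t} f')) (left_shift s (restr {s..<s + t} f)) t) x)"

definition associated_semigroup ::
  "(real \<Rightarrow> 'x \<Rightarrow> 'k::complex_hilbert fock \<Rightarrow> 'k fock) \<Rightarrow> 'k \<Rightarrow> 'k \<Rightarrow> real \<Rightarrow> 'x \<Rightarrow> complex" where
  "associated_semigroup l c' c t x = exp (- complex_of_real t * cinner c' c) *
     mat_el l (restr {0..<t} (\<lambda>_. c')) (restr {0..<t} (\<lambda>_. c)) t x"

definition markov_regular ::
  "('h::complex_hilbert \<Rightarrow>\<^sub>L 'h) set \<Rightarrow> (real \<Rightarrow> 'h \<Rightarrow>\<^sub>L 'h \<Rightarrow> 'k::complex_hilbert fock \<Rightarrow> 'k fock) \<Rightarrow> bool"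
where
  "markov_regular C l \<longleftrightarrow> norm_continuous C (associated_semigroup l 0 0)"

end

theory Submission
  imports Defs
begin

text \<open>
  A bounded functional \<open>f\<close> on an operator space \<open>A\<close> has a slice map
  \<open>f \<otimes> id : A \<otimes>\<^sub>s B \<rightarrow> B\<close>, and convolution is \<open>f \<star> g = g \<circ> (f \<otimes> id) \<circ> \<Delta> = f \<circ> (id \<otimes> g) \<circ> \<Delta>\<close>.
  Hence \<open>\<star>\<close> is an associative, submultiplicative product on the bounded functionals with right unit \<open>\<epsilon>\<close>.
  For a weak solution, the uniform boundedness principle makes the matrix elements of \<open>l\<^sub>t\<close>
  on exponential vectors bounded in norm on bounded intervals of \<open>t\<close>; the integral equation then makes them Lipschitz in norm.  For fixed \<open>s\<close>,
  both sides of the cocycle identity solve, as functions of \<open>t\<close>, the same convolution integral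
  equation driven by the shifted step functions; their difference vanishes by Picard iteration.
\<close>

section \<open>Bounded extensions and orthonormal bases\<close>

text \<open>Operator tensors are given by a definite description and tensor extensions by choice, so
  every identity about convolution rests on two facts: a bounded extension exists for the spatial
  norm, and it is unique on the closed span of elementary tensors. A weak solution is controlled
  only for each t separately, and continuity in t is given only for each x and each fixed pair of
  noise vectors. Picard iteration and norm continuity need one constant for all t in an interval and
  all x; it has to be extracted from this pointwise information. In the cocycle identity, a fixed
  functional \<omega> acts on the left of the equation by a change of argument: (\<omega> \<star> k)
  x is k at (\<omega> \<otimes> id)(\<Delta> x), which lies in C again. So the equation is simply
  evaluated at this element and no integral is interchanged with \<star>. Associativity then
  restores the form of the equation, and the right unit law yields its initial value.\<close>

instance complex_hilbert \<subseteq> banach ..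

section \<open>Complex spans and linear maps on subspaces\<close>

interpretation complex_module: module "(*\<^sub>C) :: complex \<Rightarrow> 'a \<Rightarrow> 'a::complex_normed_vector"
  by unfold_locales (simp_all add: scaleC_add_right scaleC_add_left scaleC_scaleC)

lemma cinner_scaleC_sum_right:
  "cinner x (\<Sum>i\<in>F. c i *\<^sub>C f i) = (\<Sum>i\<in>F. c i * cinner x (f i :: 'a::complex_hilbert))"
  by (simp add: cinner_sum_right cinner_scaleC_right)

lemma cinner_sum_left: "cinner (\<Sum>i\<in>F. f i) (x :: 'a::complex_hilbert) = (\<Sum>i\<in>F. cinner (f i) x)"
  by (subst cinner_commute) (simp add: cinner_sum_right flip: cinner_commute)

lemma cinner_diff_right: "cinner x (y - z) = cinner x y - cinner x (z :: 'a::complex_hilbert)"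
  by (rule linear_diff[OF bounded_linear.linear[OF bounded_linear_cinner_right]])

lemma cinner_zero_right [simp]: "cinner x (0 :: 'a::complex_hilbert) = 0"
  by (rule linear_0[OF bounded_linear.linear[OF bounded_linear_cinner_right]])

lemma cinner_self_eq_0_iff [simp]: "cinner x x = 0 \<longleftrightarrow> x = (0 :: 'a::complex_hilbert)"
  by (simp add: cinner_self)

lemma cinner_ext:
  fixes x y :: "'a::complex_hilbert"
  assumes "\<And>z. cinner z x = cinner z y"
  shows "x = y"
  using assms[of "x - y"] cinner_diff_right[of "x - y" x y] by simp

text \<open>The sum runs over indices, not over vectors, because two families with a common index
  set are combined below and neither has to be injective.\<close>

lemma cspan_image_explicit:
  assumes "u \<in> cspan (f ` I)"
  obtains F c where "finite F" "F \<subseteq> I" "u = (\<Sum>i\<in>F. c i *\<^sub>C f i)"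
proof -
  obtain t r where t: "finite t" "t \<subseteq> f ` I" and u: "u = (\<Sum>a\<in>t. r a *\<^sub>C a)"
    using assms unfolding complex_module.span_explicit by blast
  obtain F where F: "F \<subseteq> I" "inj_on f F" "t = f ` F" using t(2) by (meson subset_image_inj)
  have "u = (\<Sum>i\<in>F. r (f i) *\<^sub>C f i)" unfolding u F(3) by (rule sum.reindex_cong[OF F(2)]) auto
  moreover have "finite F" using t(1) F finite_imageD by blast
  ultimately show ?thesis using F(1) by (intro that[of F "\<lambda>i. r (f i)"]) auto
qed

lemma csubspace_closure:
  assumes "csubspace (S :: 'a::complex_normed_vector set)"
  shows "csubspace (closure S)"
proof (rule complex_module.subspaceI)
  show "0 \<in> closure S"
    using complex_module.subspace_0[OF assms] closure_subset by blast
next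
  fix x y assume "x \<in> closure S" "y \<in> closure S"
  then obtain f g where "\<And>n::nat. f n \<in> S" "f \<longlonglongrightarrow> x" "\<And>n::nat. g n \<in> S" "g \<longlonglongrightarrow> y"
    unfolding closure_sequential by blast
  then show "x + y \<in> closure S"
    unfolding closure_sequential
    by (intro exI[of _ "\<lambda>n. f n + g n"]) (auto intro: tendsto_add complex_module.subspace_add[OF assms])
next
  fix c and x assume "x \<in> closure S"
  then obtain f where "\<And>n::nat. f n \<in> S" "f \<longlonglongrightarrow> x"
    unfolding closure_sequential by blast
  then show "c *\<^sub>C x \<in> closure S"
    unfolding closure_sequential
    by (intro exI[of _ "\<lambda>n. c *\<^sub>C f n"])
      (auto intro: complex_module.subspace_scale[OF assms] bounded_linear.tendsto[OF bounded_linear_scaleC_right])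
qed

lemma clinear_onD:
  assumes "clinear_on A f" "x \<in> A"
  shows "y \<in> A \<Longrightarrow> f (x + y) = f x + f y" "f (c *\<^sub>C x) = c *\<^sub>C f x"
  using assms unfolding clinear_on_def by auto

lemma clinear_on_zero:
  assumes "clinear_on A f" "csubspace A" shows "f 0 = 0"
  using clinear_onD(2)[OF assms(1) complex_module.subspace_0[OF assms(2)], of 0] by simp

lemma clinear_on_diff:
  assumes "clinear_on A f" "csubspace A" "x \<in> A" "y \<in> A"
  shows "f (x - y) = f x - f y"
proof -
  have "f (x + (- 1) *\<^sub>C y) = f x + (- 1) *\<^sub>C f y"
    using clinear_onD(1)[OF assms(1,3), of "(- 1) *\<^sub>C y"] clinear_onD(2)[OF assms(1,4), of "- 1"]
      complex_module.subspace_scale[OF assms(2,4), of "- 1"] by simp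
  then show ?thesis by (simp add: scaleC_minus_one)
qed

lemma clinear_on_sum:
  assumes "clinear_on A f" "csubspace A" "finite F" "\<And>i. i \<in> F \<Longrightarrow> g i \<in> A"
  shows "f (\<Sum>i\<in>F. c i *\<^sub>C g i) = (\<Sum>i\<in>F. c i *\<^sub>C f (g i))"
  using assms(3,4)
proof (induction F)
  case (insert i F)
  have "(\<Sum>i\<in>F. c i *\<^sub>C g i) \<in> A" "c i *\<^sub>C g i \<in> A"
    using insert.prems by (auto intro!: complex_module.subspace_sum[OF assms(2)]
        complex_module.subspace_scale[OF assms(2)])
  then show ?case
    using insert clinear_onD(1)[OF assms(1), of "c i *\<^sub>C g i"] clinear_onD(2)[OF assms(1), of "g i"] by simp
qed (use clinear_on_zero[OF assms(1,2)] in simp)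

text \<open>The extension is read off the closure of the graph, which is itself the graph of a map.\<close>

lemma bounded_extension:
  fixes v :: "'i \<Rightarrow> 'a::complex_normed_vector" and w :: "'i \<Rightarrow> 'b::{complex_normed_vector, complete_space}"
  assumes bound: "\<And>F c. finite F \<Longrightarrow> F \<subseteq> I \<Longrightarrow>
      norm (\<Sum>i\<in>F. c i *\<^sub>C w i) \<le> M * norm (\<Sum>i\<in>F. c i *\<^sub>C v i)"
  obtains T where "clinear_on (closure (cspan (v ` I))) T"
    "\<And>u. u \<in> closure (cspan (v ` I)) \<Longrightarrow> norm (T u) \<le> M * norm u"
    "\<And>i. i \<in> I \<Longrightarrow> T (v i) = w i"
proof -
  define G where "G = cspan ((\<lambda>i. (v i, w i)) ` I)"
  have sums: "(\<Sum>i\<in>F. c i *\<^sub>C (v i, w i)) = (\<Sum>i\<in>F. c i *\<^sub>C v i, \<Sum>i\<in>F. c i *\<^sub>C w i)" for F c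
    by (simp add: scaleC_prod_def prod_eq_iff fst_sum snd_sum)
  have G_bound: "norm q \<le> M * norm p" if pq: "(p, q) \<in> G" for p q
  proof -
    obtain F c where F: "finite F" "F \<subseteq> I" "(p, q) = (\<Sum>i\<in>F. c i *\<^sub>C (v i, w i))"
      using pq unfolding G_def by (rule cspan_image_explicit)
    then show ?thesis using bound[OF F(1,2), of c] unfolding sums by simp
  qed
  have subG: "csubspace G" by (simp add: G_def)
  note sub = csubspace_closure[OF subG]
  have cl_bound: "norm q \<le> M * norm p" if pq: "(p, q) \<in> closure G" for p q
  proof -
    obtain f where f: "\<And>n::nat. f n \<in> G" "f \<longlonglongrightarrow> (p, q)"
      using pq unfolding closure_sequential by blast
    have "(\<lambda>n. norm (snd (f n))) \<longlonglongrightarrow> norm q" "(\<lambda>n. M * norm (fst (f n))) \<longlonglongrightarrow> M * norm p"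
      using f(2) by (auto intro!: tendsto_intros dest: tendsto_fst tendsto_snd)
    then show ?thesis by (rule LIMSEQ_le) (use f(1) G_bound in \<open>auto simp: prod_eq_iff\<close>)
  qed
  \<comment> \<open>By linearity (0, q - q') lies in the closed graph, and the norm bound at 0
    forces q = q'. This is why the closure of the graph is again a graph.\<close>
  have unique: "q = q'" if "(p, q) \<in> closure G" "(p, q') \<in> closure G" for p q q'
    using cl_bound[of 0 "q - q'"] complex_module.subspace_diff[OF sub that] by simp
  have G_ex: "\<exists>q. (p, q) \<in> G" if p: "p \<in> cspan (v ` I)" for p
  proof -
    obtain F c where F: "finite F" "F \<subseteq> I" "p = (\<Sum>i\<in>F. c i *\<^sub>C v i)"
      using p by (rule cspan_image_explicit)
    have "(\<Sum>i\<in>F. c i *\<^sub>C (v i, w i)) \<in> G"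
      unfolding G_def using F(2)
      by (intro complex_module.span_sum complex_module.span_scale complex_module.span_base) auto
    then show ?thesis unfolding sums F(3) by blast
  qed
  have cl_ex: "\<exists>q. (p, q) \<in> closure G" if p: "p \<in> closure (cspan (v ` I))" for p
  proof -
    obtain f where f: "\<And>n::nat. f n \<in> cspan (v ` I)" "f \<longlonglongrightarrow> p"
      using p unfolding closure_sequential by blast
    obtain g where g: "\<And>n. (f n, g n) \<in> G" using G_ex[OF f(1)] by metis
    have "Cauchy g"
    proof (rule metric_CauchyI)
      fix e :: real assume "0 < e"
      have "(f m - f n, g m - g n) \<in> G" for m n
        using complex_module.subspace_diff[OF subG g[of m] g[of n]] by simp
      \<comment> \<open>M may be negative; \<bar>M\<bar> + 1 is a strictly positive replacement by
        which e can be divided.\<close>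
      then have le: "dist (g m) (g n) \<le> (\<bar>M\<bar> + 1) * dist (f m) (f n)" for m n
        using G_bound[of "f m - f n" "g m - g n"]
          mult_right_mono[of M "\<bar>M\<bar> + 1" "norm (f m - f n)"] by (force simp: dist_norm)
      have "0 < e / (\<bar>M\<bar> + 1)" using \<open>0 < e\<close> by auto
      then obtain N where N: "\<forall>m\<ge>N. \<forall>n\<ge>N. dist (f m) (f n) < e / (\<bar>M\<bar> + 1)"
        using metric_CauchyD[OF LIMSEQ_imp_Cauchy[OF f(2)]] by blast
      have "dist (g m) (g n) < e" if "m \<ge> N" "n \<ge> N" for m n
      proof -
        have "(\<bar>M\<bar> + 1) * dist (f m) (f n) < e" using N that by (simp add: field_simps)
        then show ?thesis using le[of m n] by linarith
      qed
      then show "\<exists>N. \<forall>m\<ge>N. \<forall>n\<ge>N. dist (g m) (g n) < e" by blast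
    qed
    then obtain q where "g \<longlonglongrightarrow> q" using Cauchy_convergent convergent_def by blast
    then have "(\<lambda>n. (f n, g n)) \<longlonglongrightarrow> (p, q)" by (intro tendsto_Pair f)
    then show ?thesis unfolding closure_sequential using g by (intro exI[of _ q] exI[of _ "\<lambda>n. (f n, g n)"]) blast
  qed
  define T where "T p = (THE q. (p, q) \<in> closure G)" for p
  have T: "T p = q" if "(p, q) \<in> closure G" for p q
    unfolding T_def using that unique by blast
  have TG: "(p, T p) \<in> closure G" if "p \<in> closure (cspan (v ` I))" for p
    using cl_ex[OF that] T by metis
  show ?thesis
  proof
    show "clinear_on (closure (cspan (v ` I))) T"
      unfolding clinear_on_def
    proof (intro conjI allI ballI)
      fix x y assume "x \<in> closure (cspan (v ` I))" "y \<in> closure (cspan (v ` I))"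
      then show "T (x + y) = T x + T y"
        using complex_module.subspace_add[OF sub TG TG] by (auto intro!: T)
    next
      fix c x assume "x \<in> closure (cspan (v ` I))"
      then show "T (c *\<^sub>C x) = c *\<^sub>C T x"
        using complex_module.subspace_scale[OF sub TG, of x c] by (auto intro!: T simp: scaleC_prod_def)
    qed
  next
    fix u assume "u \<in> closure (cspan (v ` I))"
    then show "norm (T u) \<le> M * norm u" by (intro cl_bound TG)
  next
    fix i assume "i \<in> I"
    then have "(v i, w i) \<in> G" unfolding G_def by (intro complex_module.span_base) auto
    then show "T (v i) = w i" using closure_subset by (intro T) auto
  qed
qed

lemma clinear_on_closure_unique:
  fixes T U :: "'a::complex_normed_vector \<Rightarrow> 'b::complex_normed_vector"
  assumes T: "clinear_on (closure (cspan S)) T" "\<And>u. u \<in> closure (cspan S) \<Longrightarrow> norm (T u) \<le> M * norm u"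
    and U: "clinear_on (closure (cspan S)) U" "\<And>u. u \<in> closure (cspan S) \<Longrightarrow> norm (U u) \<le> N * norm u"
    and eq: "\<And>s. s \<in> S \<Longrightarrow> T s = U s" and u: "u \<in> closure (cspan S)"
  shows "T u = U u"
proof -
  let ?X = "closure (cspan S)"
  have sub: "csubspace ?X" by (intro csubspace_closure) simp
  have inX: "cspan S \<subseteq> ?X" by (rule closure_subset)
  have span_eq: "T x = U x" if "x \<in> cspan S" for x
  proof -
    have "x \<in> cspan (id ` S)" using that by simp
    then obtain F c where F: "finite F" "F \<subseteq> S" "x = (\<Sum>i\<in>F. c i *\<^sub>C id i)"
      by (rule cspan_image_explicit)
    have "i \<in> ?X" if "i \<in> F" for i using that F(2) inX complex_module.span_base by blast
    then show ?thesis
      unfolding F(3) using F(2) eq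
      by (subst clinear_on_sum[OF T(1) sub F(1)] clinear_on_sum[OF U(1) sub F(1)],
          force)+ (auto intro!: sum.cong)
  qed
  obtain f where f: "\<And>n::nat. f n \<in> cspan S" "f \<longlonglongrightarrow> u"
    using u unfolding closure_sequential by blast
  have lim: "(\<lambda>n. V (f n)) \<longlonglongrightarrow> V u"
    if V: "clinear_on ?X V" "\<And>u. u \<in> ?X \<Longrightarrow> norm (V u) \<le> K * norm u" for V :: "'a \<Rightarrow> 'b" and K
  proof (rule LIM_zero_cancel, rule Lim_null_comparison)
    have "norm (V (f n) - V u) \<le> K * norm (f n - u)" for n
      using V(2)[of "f n - u"] clinear_on_diff[OF V(1) sub, of "f n" u] u f(1)[of n] inX
        complex_module.subspace_diff[OF sub, of "f n" u] by auto
    then show "\<forall>\<^sub>F n in sequentially. norm (V (f n) - V u) \<le> K * norm (f n - u)" by simp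
    show "(\<lambda>n. K * norm (f n - u)) \<longlonglongrightarrow> 0"
      using f(2) by (intro tendsto_mult_right_zero tendsto_norm_zero LIM_zero)
  qed
  have "(\<lambda>n. T (f n)) \<longlonglongrightarrow> U u" using lim[OF U] span_eq[OF f(1)] by simp
  then show ?thesis using LIMSEQ_unique lim[OF T] by blast
qed

section \<open>Expansions in orthonormal bases\<close>

lemma cinner_orthonormal_sum:
  assumes "orthonormal B" "finite F" "F \<subseteq> B" "b \<in> F"
  shows "cinner b (\<Sum>b\<in>F. c b *\<^sub>C b) = c b"
proof -
  have "cinner b (\<Sum>b\<in>F. c b *\<^sub>C b) = (\<Sum>b'\<in>F. if b = b' then c b' else 0)"
    unfolding cinner_scaleC_sum_right
    using assms by (intro sum.cong) (auto simp: orthonormal_def subset_iff)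
  then show ?thesis using assms by simp
qed

lemma norm_orthonormal_sum:
  assumes "orthonormal B" "finite F" "F \<subseteq> B"
  shows "(norm (\<Sum>b\<in>F. c b *\<^sub>C b))\<^sup>2 = (\<Sum>b\<in>F. (cmod (c b))\<^sup>2)"
proof -
  let ?s = "\<Sum>b\<in>F. c b *\<^sub>C b"
  have "cinner ?s ?s = (\<Sum>b\<in>F. cnj (c b) * cinner b ?s)"
    by (subst cinner_sum_left) (simp add: cinner_scaleC_left)
  also have "\<dots> = (\<Sum>b\<in>F. complex_of_real ((cmod (c b))\<^sup>2))"
    using cinner_orthonormal_sum[OF assms, of _ c]
    by (intro sum.cong) (auto simp: complex_norm_square mult.commute simp del: of_real_power)
  finally show ?thesis by (simp add: cinner_self flip: of_real_sum del: of_real_power)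
qed

text \<open>This covers arbitrary orthonormal sets, because the expansions are also applied to the
  products of two bases and not only to \<open>onb\<close>.\<close>

lemma orthonormal_bessel:
  assumes "orthonormal B" "finite F" "F \<subseteq> B"
  shows "(\<Sum>b\<in>F. (cmod (cinner b x))\<^sup>2) \<le> (norm x)\<^sup>2"
proof -
  let ?s = "\<Sum>b\<in>F. cinner b x *\<^sub>C b"
  have "cinner x ?s = (\<Sum>b\<in>F. complex_of_real ((cmod (cinner b x))\<^sup>2))"
    unfolding cinner_scaleC_sum_right
    by (intro sum.cong) (auto simp: complex_norm_square cinner_commute[of x] simp del: of_real_power)
  then have "inner x ?s = (\<Sum>b\<in>F. (cmod (cinner b x))\<^sup>2)" by (simp flip: Re_cinner)
  moreover have "inner ?s ?s = (\<Sum>b\<in>F. (cmod (cinner b x))\<^sup>2)"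
    using norm_orthonormal_sum[OF assms] by (simp add: power2_norm_eq_inner)
  moreover have "0 \<le> inner (x - ?s) (x - ?s)" by simp
  ultimately show ?thesis
    by (simp add: inner_diff_left inner_diff_right inner_commute power2_norm_eq_inner)
qed

text \<open>If v were nonzero, its normalisation could be adjoined to B, against the maximality that
  defines a basis here.\<close>

lemma orthonormal_basis_orthogonal:
  assumes B: "orthonormal_basis B" and v: "\<And>b. b \<in> B \<Longrightarrow> cinner b v = 0"
  shows "v = 0"
proof (rule ccontr)
  assume "v \<noteq> 0"
  define e where "e = complex_of_real (1 / norm v) *\<^sub>C v"
  have "norm e = 1" using \<open>v \<noteq> 0\<close> by (simp add: e_def norm_scaleC norm_divide)
  then have ee: "cinner e e = 1" by (simp add: cinner_self)
  have be: "cinner b e = 0" "cinner e b = 0" if "b \<in> B" for b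
    using v[OF that] cinner_commute[of e b] by (simp_all add: e_def cinner_scaleC_right)
  have "e \<notin> B" using be(1)[of e] ee by auto
  have "orthonormal (insert e B)"
    using B ee be \<open>e \<notin> B\<close> unfolding orthonormal_basis_def orthonormal_def by auto
  then have "insert e B = B" using B unfolding orthonormal_basis_def by blast
  then show False using \<open>e \<notin> B\<close> by blast
qed

text \<open>B may be uncountable, so the sum converges along finite subsets. For nested sets the
  squared distance of partial sums is the difference of the sums of squared coefficients; sets that
  nearly exhaust the supremum of these therefore give a Cauchy sequence. Its limit has the same
  coefficients as x, hence equals x.\<close>

lemma has_sum_orthonormal_basis:
  assumes B: "orthonormal_basis B"
  shows "((\<lambda>b. cinner b x *\<^sub>C b) has_sum x) B"
proof -
  have on: "orthonormal B" using B by (simp add: orthonormal_basis_def)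
  define S where "S F = (\<Sum>b\<in>F. cinner b x *\<^sub>C b)" for F
  define N where "N F = (\<Sum>b\<in>F. (cmod (cinner b x))\<^sup>2)" for F
  define s where "s = Sup (N ` {F. finite F \<and> F \<subseteq> B})"
  have bdd: "bdd_above (N ` {F. finite F \<and> F \<subseteq> B})"
    using orthonormal_bessel[OF on] unfolding N_def by (intro bdd_aboveI2[of _ _ "(norm x)\<^sup>2"]) auto
  have N_le: "N F \<le> s" if "finite F" "F \<subseteq> B" for F
    unfolding s_def using that bdd by (intro cSUP_upper) auto
  have S_diff: "(norm (S F - S G))\<^sup>2 = N F - N G" if "finite F" "F \<subseteq> B" "G \<subseteq> F" for F G
  proof -
    have "S F - S G = S (F - G)" "N F - N G = N (F - G)"
      unfolding S_def N_def by (simp_all only: sum_diff[OF that(1,3)])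
    then show ?thesis
      using norm_orthonormal_sum[OF on, of "F - G" "\<lambda>b. cinner b x"] that by (auto simp: S_def N_def)
  qed
  \<comment> \<open>The defect is squared so that taking the root in \<open>near\<close> leaves 1 /
    Suc n.\<close>
  have "\<exists>F. finite F \<and> F \<subseteq> B \<and> s - (1 / Suc n)\<^sup>2 < N F" for n
  proof -
    have "s - (1 / Suc n)\<^sup>2 < Sup (N ` {F. finite F \<and> F \<subseteq> B})" by (simp add: s_def)
    then show ?thesis by (subst (asm) less_cSup_iff[OF _ bdd]) auto
  qed
  then obtain Fn where Fn: "\<And>n. finite (Fn n)" "\<And>n. Fn n \<subseteq> B" "\<And>n. s - (1 / Suc n)\<^sup>2 < N (Fn n)"
    by metis
  have near: "norm (S F - S (Fn n)) \<le> 1 / Suc n" if "finite F" "F \<subseteq> B" "Fn n \<subseteq> F" for F n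
  proof (rule power2_le_imp_le)
    show "(norm (S F - S (Fn n)))\<^sup>2 \<le> (1 / Suc n)\<^sup>2"
      using S_diff[OF that] N_le[OF that(1,2)] Fn(3)[of n] by linarith
  qed simp
  \<comment> \<open>The sets need not be nested, so both sums are compared with the sum over the
    union.\<close>
  have near2: "norm (S (Fn m) - S (Fn n)) \<le> 1 / Suc m + 1 / Suc n" for m n
  proof -
    have "norm (S (Fn m \<union> Fn n) - S (Fn n)) \<le> 1 / Suc n" "norm (S (Fn m \<union> Fn n) - S (Fn m)) \<le> 1 / Suc m"
      using near[of "Fn m \<union> Fn n" n] near[of "Fn m \<union> Fn n" m] Fn(1,2) by auto
    then show ?thesis
      using norm_triangle_ineq4[of "S (Fn m \<union> Fn n) - S (Fn n)" "S (Fn m \<union> Fn n) - S (Fn m)"] by simp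
  qed
  have "Cauchy (\<lambda>n. S (Fn n))"
  proof (rule CauchyI)
    fix e :: real assume "0 < e"
    then obtain K where K: "inverse (real (Suc K)) < e / 2" using reals_Archimedean[of "e / 2"] by auto
    have "norm (S (Fn m) - S (Fn n)) < e" if "m \<ge> K" "n \<ge> K" for m n
    proof -
      have "1 / real (Suc m) \<le> inverse (Suc K)" "1 / real (Suc n) \<le> inverse (Suc K)"
        using that by (auto simp: field_simps)
      then show ?thesis using near2[of m n] K by linarith
    qed
    then show "\<exists>K. \<forall>m\<ge>K. \<forall>n\<ge>K. norm (S (Fn m) - S (Fn n)) < e" by blast
  qed
  then obtain y where y: "(\<lambda>n. S (Fn n)) \<longlonglongrightarrow> y" using Cauchy_convergent convergent_def by blast
  have y_near: "norm (y - S (Fn n)) \<le> 1 / Suc n" for n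
  proof (rule LIMSEQ_le)
    show "(\<lambda>m. norm (S (Fn m) - S (Fn n))) \<longlonglongrightarrow> norm (y - S (Fn n))" by (intro tendsto_intros y)
    show "(\<lambda>m. 1 / Suc m + 1 / Suc n) \<longlonglongrightarrow> 1 / Suc n"
      using tendsto_add[OF LIMSEQ_Suc[OF lim_1_over_n] tendsto_const[of "1 / Suc n"]] by simp
  qed (use near2 in auto)
  have y_sum: "((\<lambda>b. cinner b x *\<^sub>C b) has_sum y) B"
    unfolding has_sum_def tendsto_iff eventually_finite_subsets_at_top
  proof (intro allI impI)
    fix e :: real assume "0 < e"
    then obtain n where n: "inverse (real (Suc n)) < e / 2" using reals_Archimedean[of "e / 2"] by auto
    have "dist (sum (\<lambda>b. cinner b x *\<^sub>C b) F) y < e" if "finite F" "Fn n \<subseteq> F" "F \<subseteq> B" for F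
    proof -
      have "norm (S F - y) \<le> norm (S F - S (Fn n)) + norm (y - S (Fn n))"
        using norm_triangle_ineq4[of "S F - S (Fn n)" "y - S (Fn n)"] by simp
      also have "\<dots> < e"
        using near[OF that(1,3,2)] y_near[of n] n unfolding inverse_eq_divide by linarith
      finally show ?thesis by (simp add: dist_norm S_def)
    qed
    then show "\<exists>X. finite X \<and> X \<subseteq> B \<and> (\<forall>Y. finite Y \<and> X \<subseteq> Y \<and> Y \<subseteq> B \<longrightarrow>
        dist (sum (\<lambda>b. cinner b x *\<^sub>C b) Y) y < e)"
      using Fn(1,2) by (intro exI[of _ "Fn n"]) simp
  qed
  have "cinner b (x - y) = 0" if b: "b \<in> B" for b
  proof -
    have "((\<lambda>b'. cinner b (cinner b' x *\<^sub>C b')) has_sum cinner b y) B"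
      using has_sum_bounded_linear[OF bounded_linear_cinner_right y_sum] by (simp add: o_def)
    moreover have "((\<lambda>b'. cinner b (cinner b' x *\<^sub>C b')) has_sum cinner b x) B"
      using b on by (intro has_sum_finite_neutralI[of "{b}"]) (auto simp: orthonormal_def cinner_scaleC_right)
    ultimately show ?thesis by (simp add: cinner_diff_right has_sum_unique)
  qed
  then have "x - y = 0" by (rule orthonormal_basis_orthogonal[OF B])
  then show ?thesis using y_sum by simp
qed

lemma parseval:
  assumes "orthonormal_basis B"
  shows "((\<lambda>b. cnj (cinner b x) * cinner b y) has_sum cinner x y) B"
proof -
  have "(\<lambda>b. cinner x (cinner b y *\<^sub>C b)) = (\<lambda>b. cnj (cinner b x) * cinner b y)"
    by (auto simp: cinner_scaleC_right cinner_commute[of x])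
  then show ?thesis
    using has_sum_bounded_linear[OF bounded_linear_cinner_right[of x] has_sum_orthonormal_basis[OF assms, of y]]
    by (simp add: o_def)
qed

lemma closure_cspan_orthonormal_basis:
  assumes "orthonormal_basis B"
  shows "closure (cspan B) = UNIV"
proof -
  have "x \<in> closure (cspan B)" for x
    unfolding closure_approachable
  proof (intro allI impI)
    fix e :: real assume "0 < e"
    then obtain X where "finite X" "X \<subseteq> B" "dist (sum (\<lambda>b. cinner b x *\<^sub>C b) X) x < e"
      using has_sum_orthonormal_basis[OF assms, of x] unfolding has_sum_def tendsto_iff eventually_finite_subsets_at_top by blast
    moreover have "sum (\<lambda>b. cinner b x *\<^sub>C b) X \<in> cspan B"
      using \<open>X \<subseteq> B\<close> by (intro complex_module.span_sum complex_module.span_scale complex_module.span_base) auto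
    ultimately show "\<exists>y\<in>cspan B. dist y x < e" by blast
  qed
  then show ?thesis by blast
qed

section \<open>Operators on tensor products of Hilbert spaces\<close>

lemma cinner_htens_onb:
  assumes "b \<in> onb" "b' \<in> onb"
  shows "cinner (b \<otimes>\<^sub>h b') u = Rep_ell2 (Rep_htens u) (b, b')"
proof -
  have on: "cinner x y = (if x = y then 1 else 0)" if "x \<in> onb" "y \<in> onb" for x y :: "'x::complex_hilbert"
    using orthonormal_basis_onb that unfolding orthonormal_basis_def orthonormal_def by blast
  have "cinner (b \<otimes>\<^sub>h b') u = (\<Sum>\<^sub>\<infinity>p. cnj (Rep_ell2 (htensor_coeffs b b') p) * Rep_ell2 (Rep_htens u) p)"
    by (simp add: cinner_htens.rep_eq htensor.rep_eq cinner_ell2_def ell2_ip.rep_eq)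
  also have "\<dots> = Rep_ell2 (Rep_htens u) (b, b')"
    using assms
    by (intro infsumI has_sum_finite_neutralI[of "{(b, b')}"]) (auto simp: htensor_coeffs.rep_eq on split: if_splits)
  finally show ?thesis .
qed

lemma htens_eqI:
  assumes "\<And>b b'. b \<in> onb \<Longrightarrow> b' \<in> onb \<Longrightarrow> cinner (b \<otimes>\<^sub>h b') u = cinner (b \<otimes>\<^sub>h b') v"
  shows "u = v"
proof -
  have "Rep_ell2 (Rep_htens u) p = Rep_ell2 (Rep_htens v) p" for p
    using assms[of "fst p" "snd p"] Rep_htens[of u] Rep_htens[of v]
    by (cases p; cases "p \<in> onb \<times> onb") (auto simp: cinner_htens_onb)
  then show ?thesis by (metis Rep_ell2_inject Rep_htens_inject ext)
qed

text \<open>The coordinate sum over pairs is evaluated one leg at a time, with Parseval in each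
  leg.\<close>

lemma cinner_htensor: "cinner (x \<otimes>\<^sub>h y) (x' \<otimes>\<^sub>h y') = cinner x x' * cinner y y'"
proof -
  let ?f = "\<lambda>p. (cnj (cinner (fst p) x) * cinner (fst p) x') * (cnj (cinner (snd p) y) * cinner (snd p) y')"
  let ?g = "\<lambda>p. cnj (Rep_ell2 (htensor_coeffs x y) p) * Rep_ell2 (htensor_coeffs x' y') p"
  have "(?g has_sum cinner (x \<otimes>\<^sub>h y) (x' \<otimes>\<^sub>h y')) UNIV"
    unfolding cinner_htens.rep_eq htensor.rep_eq cinner_ell2_def ell2_ip.rep_eq
    by (intro has_sum_infsum ell2_inner) (use Rep_ell2 in auto)
  then have sum: "(?f has_sum cinner (x \<otimes>\<^sub>h y) (x' \<otimes>\<^sub>h y')) (onb \<times> onb)"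
    by (subst has_sum_cong_neutral[where T = UNIV and g = ?g])
      (auto simp: htensor_coeffs.rep_eq algebra_simps)
  have "((\<lambda>b. (cnj (cinner b x) * cinner b x') * cinner y y') has_sum cinner (x \<otimes>\<^sub>h y) (x' \<otimes>\<^sub>h y')) onb"
    by (rule has_sum_SigmaD[OF sum])
      (auto intro!: has_sum_cmult_right parseval orthonormal_basis_onb)
  moreover have "((\<lambda>b. (cnj (cinner b x) * cinner b x') * cinner y y') has_sum cinner x x' * cinner y y') onb"
    by (intro has_sum_cmult_left parseval orthonormal_basis_onb)
  ultimately show ?thesis by (rule has_sum_unique)
qed

lemma norm_htensor: "norm (x \<otimes>\<^sub>h y) = norm x * norm y"
proof -
  have "(norm (x \<otimes>\<^sub>h y))\<^sup>2 = (norm x * norm y)\<^sup>2"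
    using cinner_htensor[of x y x y] unfolding cinner_self power_mult_distrib
    by (metis of_real_eq_iff of_real_mult)
  then show ?thesis by (rule power2_eq_imp_eq) auto
qed

lemma htensor_scaleC_left: "(c *\<^sub>C x) \<otimes>\<^sub>h y = c *\<^sub>C (x \<otimes>\<^sub>h y)"
  by (rule htens_eqI) (simp add: cinner_htensor cinner_scaleC_right algebra_simps)

text \<open>The products of basis vectors form an orthonormal basis: an orthonormal extension by e
  would make every coordinate of e vanish. The span of all product vectors contains them, so it is
  dense.\<close>

lemma closure_cspan_htensor: "closure (cspan (range (\<lambda>(x, y). x \<otimes>\<^sub>h y))) = (UNIV :: ('a::complex_hilbert, 'b::complex_hilbert) htens set)"
proof -
  let ?B = "(\<lambda>(x, y). x \<otimes>\<^sub>h y) ` (onb \<times> onb) :: ('a, 'b) htens set"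
  have on: "cinner x y = (if x = y then 1 else 0)" if "x \<in> onb" "y \<in> onb" for x y :: "'x::complex_hilbert"
    using orthonormal_basis_onb that unfolding orthonormal_basis_def orthonormal_def by blast
  have "orthonormal_basis ?B"
    unfolding orthonormal_basis_def
  proof (intro conjI allI impI)
    show "orthonormal ?B"
      unfolding orthonormal_def
    proof safe
      fix x x' :: 'a and y y' :: 'b assume *: "x \<in> onb" "y \<in> onb" "x' \<in> onb" "y' \<in> onb"
      \<comment> \<open>Orthonormality of a set distinguishes vectors, not index pairs, so equal
        products must come from equal factors.\<close>
      have "x = x' \<and> y = y'" if eq: "x \<otimes>\<^sub>h y = x' \<otimes>\<^sub>h y'"
        using * cinner_htensor[of x y x y] cinner_htensor[of x y x' y'] unfolding eq[symmetric]
        by (auto simp: on split: if_splits)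
      then show "cinner (x \<otimes>\<^sub>h y) (x' \<otimes>\<^sub>h y') = (if x \<otimes>\<^sub>h y = x' \<otimes>\<^sub>h y' then 1 else 0)"
        using * by (auto simp: cinner_htensor on)
    qed
    fix B' assume B': "orthonormal B' \<and> ?B \<subseteq> B'"
    have "e \<in> ?B" if "e \<in> B'" for e
    proof (rule ccontr)
      assume "e \<notin> ?B"
      have "e = 0"
      proof (rule htens_eqI)
        fix b :: 'a and b' :: 'b assume b: "b \<in> onb" "b' \<in> onb"
        then have "b \<otimes>\<^sub>h b' \<in> ?B" by (intro image_eqI[of _ _ "(b, b')"]) auto
        then show "cinner (b \<otimes>\<^sub>h b') e = cinner (b \<otimes>\<^sub>h b') 0"
          using B' that \<open>e \<notin> ?B\<close> unfolding orthonormal_def by (metis cinner_zero_right subsetD)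
      qed
      then show False using B' that unfolding orthonormal_def by (metis cinner_zero_right zero_neq_one)
    qed
    then show "B' = ?B" using B' by blast
  qed
  then have "UNIV = closure (cspan ?B)" by (simp add: closure_cspan_orthonormal_basis)
  also have "\<dots> \<subseteq> closure (cspan (range (\<lambda>(x, y). x \<otimes>\<^sub>h y)))"
    by (intro closure_mono complex_module.span_mono) auto
  finally show ?thesis by blast
qed

lemma finite_has_sum_sum:
  fixes f :: "'i \<Rightarrow> 'b \<Rightarrow> 'c::{topological_comm_monoid_add}"
  assumes "finite F" "\<And>i. i \<in> F \<Longrightarrow> (f i has_sum s i) B"
  shows "((\<lambda>b. \<Sum>i\<in>F. f i b) has_sum (\<Sum>i\<in>F. s i)) B"
  using assms by (induction F) (auto intro!: has_sum_add)

lemma cinner_sum_sum: "cinner (\<Sum>i\<in>F. f i) (\<Sum>j\<in>F. g j) = (\<Sum>i\<in>F. \<Sum>j\<in>F. cinner (f i) (g j :: 'a::complex_hilbert))"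
  by (simp add: cinner_sum_left) (simp add: cinner_sum_right)

text \<open>Expanding one leg in its basis turns the norm of a sum of product vectors into a sum of
  squared norms in the other leg. An operator acting on that leg can then be estimated term by
  term.\<close>

lemma norm_sum_htensor:
  fixes x :: "'i \<Rightarrow> 'a::complex_hilbert" and y :: "'i \<Rightarrow> 'b::complex_hilbert"
  assumes F: "finite F"
  shows "((\<lambda>b. (norm (\<Sum>i\<in>F. cinner b (y i) *\<^sub>C x i))\<^sup>2) has_sum (norm (\<Sum>i\<in>F. x i \<otimes>\<^sub>h y i))\<^sup>2) onb"
    and "((\<lambda>b. (norm (\<Sum>i\<in>F. cinner b (x i) *\<^sub>C y i))\<^sup>2) has_sum (norm (\<Sum>i\<in>F. x i \<otimes>\<^sub>h y i))\<^sup>2) onb"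
proof -
  have *: "((\<lambda>b. (norm (\<Sum>i\<in>F. cinner b (v i) *\<^sub>C u i))\<^sup>2) has_sum Re (\<Sum>i\<in>F. \<Sum>j\<in>F. cinner (u i) (u j) * cinner (v i) (v j))) onb"
    for u :: "'i \<Rightarrow> 'c::complex_hilbert" and v :: "'i \<Rightarrow> 'd::complex_hilbert"
  proof -
    have "(norm (\<Sum>i\<in>F. cinner b (v i) *\<^sub>C u i))\<^sup>2 =
        Re (\<Sum>i\<in>F. \<Sum>j\<in>F. cinner (u i) (u j) * (cnj (cinner b (v i)) * cinner b (v j)))" for b
    proof -
      have "(norm (\<Sum>i\<in>F. cinner b (v i) *\<^sub>C u i))\<^sup>2 = Re (cinner (\<Sum>i\<in>F. cinner b (v i) *\<^sub>C u i) (\<Sum>i\<in>F. cinner b (v i) *\<^sub>C u i))"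
        by (simp add: cinner_self)
      then show ?thesis
        unfolding cinner_sum_sum by (simp add: cinner_scaleC_left cinner_scaleC_right algebra_simps)
    qed
    moreover have "((\<lambda>b. \<Sum>i\<in>F. \<Sum>j\<in>F. cinner (u i) (u j) * (cnj (cinner b (v i)) * cinner b (v j))) has_sum
        (\<Sum>i\<in>F. \<Sum>j\<in>F. cinner (u i) (u j) * cinner (v i) (v j))) onb"
      by (intro finite_has_sum_sum F has_sum_cmult_right parseval orthonormal_basis_onb)
    ultimately show ?thesis by (simp only: has_sum_Re)
  qed
  have n: "(norm (\<Sum>i\<in>F. x i \<otimes>\<^sub>h y i))\<^sup>2 = Re (\<Sum>i\<in>F. \<Sum>j\<in>F. cinner (x i) (x j) * cinner (y i) (y j))"
  proof -
    have "(norm (\<Sum>i\<in>F. x i \<otimes>\<^sub>h y i))\<^sup>2 = Re (cinner (\<Sum>i\<in>F. x i \<otimes>\<^sub>h y i) (\<Sum>i\<in>F. x i \<otimes>\<^sub>h y i))"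
      by (simp add: cinner_self)
    then show ?thesis unfolding cinner_sum_sum cinner_htensor .
  qed
  show "((\<lambda>b. (norm (\<Sum>i\<in>F. cinner b (y i) *\<^sub>C x i))\<^sup>2) has_sum (norm (\<Sum>i\<in>F. x i \<otimes>\<^sub>h y i))\<^sup>2) onb"
    unfolding n by (rule *)
  show "((\<lambda>b. (norm (\<Sum>i\<in>F. cinner b (x i) *\<^sub>C y i))\<^sup>2) has_sum (norm (\<Sum>i\<in>F. x i \<otimes>\<^sub>h y i))\<^sup>2) onb"
    using *[of x y] unfolding n by (simp add: mult.commute)
qed

lemma bounded_ops_apply:
  assumes "T \<in> bounded_ops"
  shows "blinfun_apply T (c *\<^sub>C x) = c *\<^sub>C blinfun_apply T x"
    "blinfun_apply T (\<Sum>i\<in>F. c' i *\<^sub>C y i) = (\<Sum>i\<in>F. c' i *\<^sub>C blinfun_apply T (y i))"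
  using assms by (simp_all add: bounded_ops_def clinear_on_def blinfun.sum_right)

text \<open>These are the bounds for T \<otimes> 1 and 1 \<otimes> T on the algebraic tensor
  product; their composition bounds a general tensor of operators.\<close>

lemma norm_sum_apply_htensor_le:
  assumes F: "finite F" and T: "T \<in> bounded_ops"
  shows "norm (\<Sum>i\<in>F. blinfun_apply T (x i) \<otimes>\<^sub>h y i) \<le> norm T * norm (\<Sum>i\<in>F. x i \<otimes>\<^sub>h y i)"
    and "norm (\<Sum>i\<in>F. z i \<otimes>\<^sub>h blinfun_apply T (x i)) \<le> norm T * norm (\<Sum>i\<in>F. z i \<otimes>\<^sub>h x i)"
proof -
  have le: "(norm (\<Sum>i\<in>F. c i *\<^sub>C blinfun_apply T (x i)))\<^sup>2 \<le> (norm T)\<^sup>2 * (norm (\<Sum>i\<in>F. c i *\<^sub>C x i))\<^sup>2" for c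
    unfolding bounded_ops_apply(2)[OF T, symmetric] power_mult_distrib[symmetric]
    by (intro power_mono norm_blinfun) auto
  have "(norm (\<Sum>i\<in>F. blinfun_apply T (x i) \<otimes>\<^sub>h y i))\<^sup>2 \<le> (norm T)\<^sup>2 * (norm (\<Sum>i\<in>F. x i \<otimes>\<^sub>h y i))\<^sup>2"
    by (rule has_sum_mono[OF norm_sum_htensor(1)[OF F] has_sum_cmult_right[OF norm_sum_htensor(1)[OF F]] le])
  then show "norm (\<Sum>i\<in>F. blinfun_apply T (x i) \<otimes>\<^sub>h y i) \<le> norm T * norm (\<Sum>i\<in>F. x i \<otimes>\<^sub>h y i)"
    unfolding power_mult_distrib[symmetric] by (rule power2_le_imp_le) simp
  have "(norm (\<Sum>i\<in>F. z i \<otimes>\<^sub>h blinfun_apply T (x i)))\<^sup>2 \<le> (norm T)\<^sup>2 * (norm (\<Sum>i\<in>F. z i \<otimes>\<^sub>h x i))\<^sup>2"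
    by (rule has_sum_mono[OF norm_sum_htensor(2)[OF F] has_sum_cmult_right[OF norm_sum_htensor(2)[OF F]] le])
  then show "norm (\<Sum>i\<in>F. z i \<otimes>\<^sub>h blinfun_apply T (x i)) \<le> norm T * norm (\<Sum>i\<in>F. z i \<otimes>\<^sub>h x i)"
    unfolding power_mult_distrib[symmetric] by (rule power2_le_imp_le) simp
qed

text \<open>The description defining \<open>a \<otimes>\<^sub>o b\<close> has to be shown to denote.
  Existence comes from factoring it as (1 \<otimes> b)(a \<otimes> 1) on finite sums and extending;
  uniqueness comes from the density of the span of product vectors.\<close>

lemma
  assumes a: "a \<in> bounded_ops" and b: "b \<in> bounded_ops"
  shows op_tensor_bounded_ops: "a \<otimes>\<^sub>o b \<in> bounded_ops"
    and op_tensor_apply: "blinfun_apply (a \<otimes>\<^sub>o b) (x \<otimes>\<^sub>h y) = blinfun_apply a x \<otimes>\<^sub>h blinfun_apply b y"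
proof -
  have bound: "norm (\<Sum>p\<in>F. c p *\<^sub>C (case p of (x, y) \<Rightarrow> blinfun_apply a x \<otimes>\<^sub>h blinfun_apply b y)) \<le>
      (norm a * norm b) * norm (\<Sum>p\<in>F. c p *\<^sub>C (case p of (x, y) \<Rightarrow> x \<otimes>\<^sub>h y))" if F: "finite F" for F c
  proof -
    \<comment> \<open>Absorbing the scalar into the first leg gives the plain sums that the norm
      estimates speak about.\<close>
    have eq: "(\<Sum>p\<in>F. c p *\<^sub>C (case p of (x, y) \<Rightarrow> f x \<otimes>\<^sub>h g y)) = (\<Sum>p\<in>F. (c p *\<^sub>C f (fst p)) \<otimes>\<^sub>h g (snd p))"
      for f :: "'a \<Rightarrow> 'a" and g :: "'b \<Rightarrow> 'b"
      by (intro sum.cong) (auto simp: htensor_scaleC_left)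
    have "norm (\<Sum>p\<in>F. (c p *\<^sub>C blinfun_apply a (fst p)) \<otimes>\<^sub>h blinfun_apply b (snd p)) \<le>
        norm b * norm (\<Sum>p\<in>F. (c p *\<^sub>C blinfun_apply a (fst p)) \<otimes>\<^sub>h snd p)"
      by (rule norm_sum_apply_htensor_le(2)[OF F b])
    also have "\<dots> \<le> norm b * (norm a * norm (\<Sum>p\<in>F. (c p *\<^sub>C fst p) \<otimes>\<^sub>h snd p))"
      using norm_sum_apply_htensor_le(1)[OF F a, of "\<lambda>p. c p *\<^sub>C fst p" snd]
      by (intro mult_left_mono) (simp_all add: bounded_ops_apply(1)[OF a])
    finally show ?thesis
      using eq[of "\<lambda>x. x" "\<lambda>x. x"] unfolding eq by (simp add: mult.commute mult.left_commute)
  qed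
  obtain T where T: "clinear_on UNIV T" "\<And>u. norm (T u) \<le> (norm a * norm b) * norm u"
      "\<And>x y. T (x \<otimes>\<^sub>h y) = blinfun_apply a x \<otimes>\<^sub>h blinfun_apply b y"
    using bounded_extension[OF bound, of UNIV] unfolding closure_cspan_htensor by auto
  have "bounded_linear T"
    using T(1,2) by (intro bounded_linear_intro[of _ "norm a * norm b"])
      (auto simp: clinear_on_def mult.commute simp flip: scaleC_of_real)
  note app = bounded_linear_Blinfun_apply[OF this]
  let ?P = "\<lambda>T. T \<in> bounded_ops \<and> (\<forall>x y. blinfun_apply T (x \<otimes>\<^sub>h y) = blinfun_apply a x \<otimes>\<^sub>h blinfun_apply b y)"
  have P: "?P (Blinfun T)" using T by (simp add: bounded_ops_def app)
  have "U = Blinfun T" if U: "?P U" for U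
  proof (rule blinfun_eqI)
    fix u
    have V: "clinear_on (closure (cspan (range (\<lambda>(x, y). x \<otimes>\<^sub>h y)))) (blinfun_apply V)"
      "norm (blinfun_apply V u) \<le> norm V * norm u" if "?P V" for V u
      using that by (simp_all add: closure_cspan_htensor bounded_ops_def norm_blinfun)
    show "blinfun_apply U u = blinfun_apply (Blinfun T) u"
      by (rule clinear_on_closure_unique[OF V[OF U] V[OF P]])
        (use U P in \<open>auto simp: closure_cspan_htensor\<close>)
  qed
  then have "a \<otimes>\<^sub>o b = Blinfun T" unfolding op_tensor_def using P by (intro the_equality) blast+
  then show "a \<otimes>\<^sub>o b \<in> bounded_ops"
    "blinfun_apply (a \<otimes>\<^sub>o b) (x \<otimes>\<^sub>h y) = blinfun_apply a x \<otimes>\<^sub>h blinfun_apply b y"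
    using P by simp_all
qed

section \<open>Slice maps\<close>

lemma csubspace_bounded_ops: "csubspace bounded_ops"
  by (rule complex_module.subspaceI)
    (auto simp: bounded_ops_def clinear_on_def blinfun.add_left scaleC_blinfun.rep_eq
      scaleC_add_right scaleC_scaleC mult.commute)

lemma closed_bounded_ops: "closed (bounded_ops :: ('a::complex_hilbert \<Rightarrow>\<^sub>L 'b::complex_hilbert) set)"
  unfolding closed_sequential_limits
proof (intro allI impI)
  fix X and T :: "'a \<Rightarrow>\<^sub>L 'b" assume *: "(\<forall>n. X n \<in> bounded_ops) \<and> X \<longlonglongrightarrow> T"
  then have lim: "(\<lambda>n. blinfun_apply (X n) x) \<longlonglongrightarrow> blinfun_apply T x" for x
    by (intro tendsto_intros) auto
  have "blinfun_apply T (c *\<^sub>C x) = c *\<^sub>C blinfun_apply T x" for c x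
  proof (rule LIMSEQ_unique)
    show "(\<lambda>n. blinfun_apply (X n) (c *\<^sub>C x)) \<longlonglongrightarrow> blinfun_apply T (c *\<^sub>C x)" by (rule lim)
    show "(\<lambda>n. blinfun_apply (X n) (c *\<^sub>C x)) \<longlonglongrightarrow> c *\<^sub>C blinfun_apply T x"
      using * bounded_linear.tendsto[OF bounded_linear_scaleC_right lim]
      by (simp add: bounded_ops_apply)
  qed
  then show "T \<in> bounded_ops" by (simp add: bounded_ops_def clinear_on_def blinfun.add_right)
qed

lemma spatial_tensor_eq: "A \<otimes>\<^sub>s B = closure (cspan ((\<lambda>p. fst p \<otimes>\<^sub>o snd p) ` (A \<times> B)))"
  unfolding spatial_tensor_def by (rule arg_cong[where f = "\<lambda>S. closure (cspan S)"]) force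

lemma op_tensor_in_spatial_tensor: "a \<in> A \<Longrightarrow> b \<in> B \<Longrightarrow> a \<otimes>\<^sub>o b \<in> A \<otimes>\<^sub>s B"
  unfolding spatial_tensor_def by (rule subsetD[OF closure_subset], rule complex_module.span_base) blast

lemma operator_space_spatial_tensor:
  assumes "operator_space A" "operator_space B"
  shows "operator_space (A \<otimes>\<^sub>s B)"
  unfolding operator_space_def
proof (intro conjI)
  show "A \<otimes>\<^sub>s B \<subseteq> bounded_ops"
    unfolding spatial_tensor_def
    by (intro closure_minimal complex_module.span_minimal csubspace_bounded_ops closed_bounded_ops)
      (use assms op_tensor_bounded_ops in \<open>force simp: operator_space_def\<close>)
  show "csubspace (A \<otimes>\<^sub>s B)" "closed (A \<otimes>\<^sub>s B)"
    unfolding spatial_tensor_def by (auto intro: csubspace_closure)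
qed

lemma is_tensor_ext_unique:
  assumes T: "is_tensor_ext A B \<beta> T" and U: "is_tensor_ext A B \<beta> U" and u: "u \<in> A \<otimes>\<^sub>s B"
  shows "T u = U u"
proof -
  have bounds: "\<exists>M. \<forall>u\<in>A \<otimes>\<^sub>s B. norm (T u) \<le> M * norm u" "\<exists>N. \<forall>u\<in>A \<otimes>\<^sub>s B. norm (U u) \<le> N * norm u"
    using T U unfolding is_tensor_ext_def by blast+
  then obtain M N where "\<forall>u\<in>A \<otimes>\<^sub>s B. norm (T u) \<le> M * norm u" "\<forall>u\<in>A \<otimes>\<^sub>s B. norm (U u) \<le> N * norm u"
    by blast
  moreover have "T s = U s" if "s \<in> (\<lambda>p. fst p \<otimes>\<^sub>o snd p) ` (A \<times> B)" for s
    using T U that unfolding is_tensor_ext_def by auto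
  ultimately show ?thesis
    using T U u unfolding is_tensor_ext_def spatial_tensor_eq
    by - (rule clinear_on_closure_unique[of "(\<lambda>p. fst p \<otimes>\<^sub>o snd p) ` (A \<times> B)" T M U N]; simp)
qed

text \<open>The chosen extension is determined only on the spatial tensor product, hence the
  membership condition on u.\<close>

lemma tensor_ext_eq:
  assumes "is_tensor_ext A B \<beta> T" "u \<in> A \<otimes>\<^sub>s B"
  shows "tensor_ext A B \<beta> u = T u"
proof (rule is_tensor_ext_unique[OF _ assms])
  show "is_tensor_ext A B \<beta> (tensor_ext A B \<beta>)" unfolding tensor_ext_def using assms(1) by (rule someI[of "is_tensor_ext A B \<beta>"])
qed

lemma is_tensor_extI:
  fixes \<beta> :: "_ \<Rightarrow> _ \<Rightarrow> 'c::{complex_normed_vector, complete_space}"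
  assumes bound: "\<And>F c. finite F \<Longrightarrow> F \<subseteq> A \<times> B \<Longrightarrow>
      norm (\<Sum>p\<in>F. c p *\<^sub>C \<beta> (fst p) (snd p)) \<le> M * norm (\<Sum>p\<in>F. c p *\<^sub>C (fst p \<otimes>\<^sub>o snd p))"
  obtains T where "is_tensor_ext A B \<beta> T" "\<forall>u\<in>A \<otimes>\<^sub>s B. norm (T u) \<le> M * norm u"
proof (rule bounded_extension[OF bound])
  fix T
  assume T: "clinear_on (closure (cspan ((\<lambda>p. fst p \<otimes>\<^sub>o snd p) ` (A \<times> B)))) T"
    "\<And>u. u \<in> closure (cspan ((\<lambda>p. fst p \<otimes>\<^sub>o snd p) ` (A \<times> B))) \<Longrightarrow> norm (T u) \<le> M * norm u"
    "\<And>p. p \<in> A \<times> B \<Longrightarrow> T (fst p \<otimes>\<^sub>o snd p) = \<beta> (fst p) (snd p)"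
  have "T (a \<otimes>\<^sub>o b) = \<beta> a b" if "a \<in> A" "b \<in> B" for a b using T(3)[of "(a, b)"] that by simp
  with T(1,2) have "is_tensor_ext A B \<beta> T"
    unfolding is_tensor_ext_def spatial_tensor_eq by blast
  then show ?thesis using T(2) by (intro that ballI) (unfold spatial_tensor_eq)
qed

lemma norm_blinfun_cinner_bound:
  fixes T :: "'a::complex_hilbert \<Rightarrow>\<^sub>L 'b::complex_hilbert"
  assumes "0 \<le> K" "\<And>x x'. cmod (cinner x (blinfun_apply T x')) \<le> K * norm x * norm x'"
  shows "norm T \<le> K"
proof (rule norm_blinfun_bound[OF assms(1)])
  fix x
  let ?y = "blinfun_apply T x"
  have "norm ?y * norm ?y = cmod (cinner ?y ?y)"
    unfolding cinner_self by (simp add: power2_eq_square norm_mult)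
  also have "\<dots> \<le> (K * norm x) * norm ?y" using assms(2)[of ?y x] by (simp add: mult.commute mult.left_commute)
  finally show "norm ?y \<le> K * norm x"
    using assms(1) by (cases "?y = 0") (auto simp: mult_le_cancel_right)
qed

lemma blinfun_eq_cinnerI:
  fixes S T :: "'a::complex_hilbert \<Rightarrow>\<^sub>L 'b::complex_hilbert"
  assumes "\<And>x x'. cinner x (blinfun_apply S x') = cinner x (blinfun_apply T x')"
  shows "S = T"
  by (rule blinfun_eqI, rule cinner_ext, rule assms)

lemma bounded_functionals_bound:
  assumes "f \<in> bounded_functionals C"
  obtains M where "0 \<le> M" "\<And>x. x \<in> C \<Longrightarrow> cmod (f x) \<le> M * norm x"
proof -
  obtain M where M: "\<And>x. x \<in> C \<Longrightarrow> cmod (f x) \<le> M * norm x"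
    using assms unfolding bounded_functionals_def by blast
  have "cmod (f x) \<le> \<bar>M\<bar> * norm x" if "x \<in> C" for x
    using M[OF that] mult_right_mono[OF abs_ge_self[of M] norm_ge_zero[of x]] by linarith
  then show ?thesis by (intro that[of "\<bar>M\<bar>"]) auto
qed

lemma bounded_functionals_clinear: "f \<in> bounded_functionals C \<Longrightarrow> clinear_on C f"
  by (simp add: bounded_functionals_def)

lemma cinner_blinfun_sum:
  "cinner x (blinfun_apply (\<Sum>i\<in>F. c i *\<^sub>C T i) x') = (\<Sum>i\<in>F. c i * cinner x (blinfun_apply (T i) x'))"
  by (simp add: blinfun.sum_left cinner_sum_right scaleC_blinfun.rep_eq cinner_scaleC_right)

text \<open>\<open>R\<close> and \<open>L\<close> are the slices of \<open>S\<close> by the vector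
  functionals of (y, y') and of (x, x'). They are described by matrix elements because the callers
  already have them as finite sums, whose norm is to be bounded by that of \<open>S\<close>.\<close>

lemma norm_slice_le:
  fixes S :: "('a::complex_hilbert, 'b::complex_hilbert) htens \<Rightarrow>\<^sub>L ('a, 'b) htens"
  shows "(\<And>x x'. cinner x (blinfun_apply R x') = cinner (x \<otimes>\<^sub>h y) (blinfun_apply S (x' \<otimes>\<^sub>h y'))) \<Longrightarrow>
      norm R \<le> norm S * norm y * norm y'"
    and "(\<And>y y'. cinner y (blinfun_apply L y') = cinner (x \<otimes>\<^sub>h y) (blinfun_apply S (x' \<otimes>\<^sub>h y'))) \<Longrightarrow>
      norm L \<le> norm S * norm x * norm x'"
proof -
  have S: "cmod (cinner (x \<otimes>\<^sub>h y) (blinfun_apply S (x' \<otimes>\<^sub>h y'))) \<le> norm S * (norm x * norm y) * (norm x' * norm y')" for x y x' y'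
  proof -
    have "cmod (cinner (x \<otimes>\<^sub>h y) (blinfun_apply S (x' \<otimes>\<^sub>h y'))) \<le> norm (x \<otimes>\<^sub>h y) * (norm S * norm (x' \<otimes>\<^sub>h y'))"
      by (intro order_trans[OF norm_cinner_le] mult_left_mono norm_blinfun norm_ge_zero)
    then show ?thesis by (simp add: norm_htensor algebra_simps)
  qed
  show "norm R \<le> norm S * norm y * norm y'"
    if R: "\<And>x x'. cinner x (blinfun_apply R x') = cinner (x \<otimes>\<^sub>h y) (blinfun_apply S (x' \<otimes>\<^sub>h y'))"
    by (rule norm_blinfun_cinner_bound) (use S[of _ y _ y'] in \<open>auto simp: R algebra_simps\<close>)
  show "norm L \<le> norm S * norm x * norm x'"
    if L: "\<And>y y'. cinner y (blinfun_apply L y') = cinner (x \<otimes>\<^sub>h y) (blinfun_apply S (x' \<otimes>\<^sub>h y'))"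
    by (rule norm_blinfun_cinner_bound) (use S[of x _ x' _] in \<open>auto simp: L algebra_simps\<close>)
qed

definition slice_left where "slice_left A B f = tensor_ext A B (\<lambda>a b. f a *\<^sub>C b)"
definition slice_right where "slice_right A B g = tensor_ext A B (\<lambda>a b. g b *\<^sub>C a)"

text \<open>A functional on an operator space is automatically completely bounded; this is the step
  where that enters.  A matrix element of \<open>(f \<otimes> id) u\<close> is \<open>f\<close> applied to a slice of \<open>u\<close> by a
  vector functional, and such slices are contractive.\<close>

lemma
  fixes A :: "('a::complex_hilbert \<Rightarrow>\<^sub>L 'a) set" and B :: "('b::complex_hilbert \<Rightarrow>\<^sub>L 'b) set"
  assumes A: "operator_space A" and B: "operator_space B" and f: "clinear_on A f"
    and M: "0 \<le> M" "\<And>a. a \<in> A \<Longrightarrow> cmod (f a) \<le> M * norm a"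
  shows is_tensor_ext_slice_left_bound: "is_tensor_ext A B (\<lambda>a b. f a *\<^sub>C b) (slice_left A B f)"
    and norm_slice_left_le: "u \<in> A \<otimes>\<^sub>s B \<Longrightarrow> norm (slice_left A B f u) \<le> M * norm u"
proof -
  have subA: "csubspace A" using A by (simp add: operator_space_def)
  have "norm (\<Sum>p\<in>F. c p *\<^sub>C (f (fst p) *\<^sub>C snd p)) \<le> M * norm (\<Sum>p\<in>F. c p *\<^sub>C (fst p \<otimes>\<^sub>o snd p))"
    if F: "finite F" "F \<subseteq> A \<times> B" for F and c
  proof (rule norm_blinfun_cinner_bound)
    let ?S = "\<Sum>p\<in>F. c p *\<^sub>C (fst p \<otimes>\<^sub>o snd p)"
    fix y y'
    let ?R = "\<Sum>p\<in>F. (c p * cinner y (blinfun_apply (snd p) y')) *\<^sub>C fst p"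
    have "norm ?R \<le> norm ?S * norm y * norm y'"
    proof (rule norm_slice_le(1))
      fix x x'
      show "cinner x (blinfun_apply ?R x') = cinner (x \<otimes>\<^sub>h y) (blinfun_apply ?S (x' \<otimes>\<^sub>h y'))"
        unfolding cinner_blinfun_sum
      proof (rule sum.cong)
        fix p assume "p \<in> F"
        then have "fst p \<in> bounded_ops" "snd p \<in> bounded_ops"
          using subsetD[OF F(2)] A B unfolding operator_space_def mem_Times_iff by blast+
        then show "c p * cinner y (blinfun_apply (snd p) y') * cinner x (blinfun_apply (fst p) x') =
            c p * cinner (x \<otimes>\<^sub>h y) (blinfun_apply (fst p \<otimes>\<^sub>o snd p) (x' \<otimes>\<^sub>h y'))"
          by (simp add: op_tensor_apply cinner_htensor)
      qed simp
    qed
    moreover have "cinner y (blinfun_apply (\<Sum>p\<in>F. c p *\<^sub>C (f (fst p) *\<^sub>C snd p)) y') = f ?R"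
      using F unfolding cinner_blinfun_sum
      by (subst clinear_on_sum[OF f subA F(1)])
        (auto simp: scaleC_blinfun.rep_eq cinner_scaleC_right scaleC_complex_def mult.assoc mult.commute
          intro!: sum.cong)
    moreover have "?R \<in> A"
      using F(2) by (auto intro!: complex_module.subspace_sum[OF subA] complex_module.subspace_scale[OF subA])
    ultimately show "cmod (cinner y (blinfun_apply (\<Sum>p\<in>F. c p *\<^sub>C (f (fst p) *\<^sub>C snd p)) y')) \<le>
        M * norm ?S * norm y * norm y'"
      using M(2)[of ?R] mult_left_mono[of "norm ?R" "norm ?S * norm y * norm y'" M] M(1)
      by (simp add: mult.assoc)
  qed (use M in simp)
  then obtain T where T: "is_tensor_ext A B (\<lambda>a b. f a *\<^sub>C b) T" "\<forall>u\<in>A \<otimes>\<^sub>s B. norm (T u) \<le> M * norm u"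
    by (rule is_tensor_extI) blast
  show "is_tensor_ext A B (\<lambda>a b. f a *\<^sub>C b) (slice_left A B f)"
    unfolding slice_left_def tensor_ext_def using T(1) by (rule someI[of "is_tensor_ext A B (\<lambda>a b. f a *\<^sub>C b)"])
  show "norm (slice_left A B f u) \<le> M * norm u" if "u \<in> A \<otimes>\<^sub>s B"
    unfolding slice_left_def tensor_ext_eq[OF T(1) that] using T(2) that by blast
qed

text \<open>The argument for the left slice with the two legs exchanged: now the slice by a vector
  functional of the first leg is what g is applied to.\<close>

lemma is_tensor_ext_slice_right:
  fixes A :: "('a::complex_hilbert \<Rightarrow>\<^sub>L 'a) set" and B :: "('b::complex_hilbert \<Rightarrow>\<^sub>L 'b) set"
  assumes A: "operator_space A" and B: "operator_space B" and g: "g \<in> bounded_functionals B"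
  shows "is_tensor_ext A B (\<lambda>a b. g b *\<^sub>C a) (slice_right A B g)"
proof -
  have subB: "csubspace B" using B by (simp add: operator_space_def)
  obtain M where M: "0 \<le> M" "\<And>b. b \<in> B \<Longrightarrow> cmod (g b) \<le> M * norm b"
    using bounded_functionals_bound[OF g] by metis
  have "norm (\<Sum>p\<in>F. c p *\<^sub>C (g (snd p) *\<^sub>C fst p)) \<le> M * norm (\<Sum>p\<in>F. c p *\<^sub>C (fst p \<otimes>\<^sub>o snd p))"
    if F: "finite F" "F \<subseteq> A \<times> B" for F and c
  proof (rule norm_blinfun_cinner_bound)
    let ?S = "\<Sum>p\<in>F. c p *\<^sub>C (fst p \<otimes>\<^sub>o snd p)"
    fix x x'
    let ?L = "\<Sum>p\<in>F. (c p * cinner x (blinfun_apply (fst p) x')) *\<^sub>C snd p"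
    have "norm ?L \<le> norm ?S * norm x * norm x'"
    proof (rule norm_slice_le(2))
      fix y y'
      show "cinner y (blinfun_apply ?L y') = cinner (x \<otimes>\<^sub>h y) (blinfun_apply ?S (x' \<otimes>\<^sub>h y'))"
        unfolding cinner_blinfun_sum
      proof (rule sum.cong)
        fix p assume "p \<in> F"
        then have "fst p \<in> bounded_ops" "snd p \<in> bounded_ops"
          using subsetD[OF F(2)] A B unfolding operator_space_def mem_Times_iff by blast+
        then show "c p * cinner x (blinfun_apply (fst p) x') * cinner y (blinfun_apply (snd p) y') =
            c p * cinner (x \<otimes>\<^sub>h y) (blinfun_apply (fst p \<otimes>\<^sub>o snd p) (x' \<otimes>\<^sub>h y'))"
          by (simp add: op_tensor_apply cinner_htensor)
      qed simp
    qed
    moreover have "cinner x (blinfun_apply (\<Sum>p\<in>F. c p *\<^sub>C (g (snd p) *\<^sub>C fst p)) x') = g ?L"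
      using F unfolding cinner_blinfun_sum
      by (subst clinear_on_sum[OF bounded_functionals_clinear[OF g] subB F(1)])
        (auto simp: scaleC_blinfun.rep_eq cinner_scaleC_right scaleC_complex_def mult.assoc mult.commute
          intro!: sum.cong)
    moreover have "?L \<in> B"
      using F(2) by (auto intro!: complex_module.subspace_sum[OF subB] complex_module.subspace_scale[OF subB])
    ultimately show "cmod (cinner x (blinfun_apply (\<Sum>p\<in>F. c p *\<^sub>C (g (snd p) *\<^sub>C fst p)) x')) \<le>
        M * norm ?S * norm x * norm x'"
      using M(2)[of ?L] mult_left_mono[of "norm ?L" "norm ?S * norm x * norm x'" M] M(1)
      by (simp add: mult.assoc)
  qed (use M in simp)
  then obtain T where "is_tensor_ext A B (\<lambda>a b. g b *\<^sub>C a) T"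
    by (rule is_tensor_extI) blast
  then show ?thesis unfolding slice_right_def tensor_ext_def by (rule someI[of "is_tensor_ext A B (\<lambda>a b. g b *\<^sub>C a)"])
qed

lemma is_tensor_ext_slice_left:
  assumes "operator_space A" "operator_space B" "f \<in> bounded_functionals A"
  shows "is_tensor_ext A B (\<lambda>a b. f a *\<^sub>C b) (slice_left A B f)"
  using bounded_functionals_bound[OF assms(3)] is_tensor_ext_slice_left_bound[OF assms(1,2) bounded_functionals_clinear[OF assms(3)]]
  by metis

text \<open>Closedness of D carries membership from finite sums to limits. This keeps slices inside
  the operator space, and \<Delta> \<otimes> id and id \<otimes> \<Delta> inside the triple tensor
  products.\<close>

lemma is_tensor_ext_range:
  assumes T: "is_tensor_ext A B \<beta> T" and D: "csubspace D" "closed D"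
    and \<beta>: "\<And>a b. a \<in> A \<Longrightarrow> b \<in> B \<Longrightarrow> \<beta> a b \<in> D" and u: "u \<in> A \<otimes>\<^sub>s B"
  shows "T u \<in> D"
proof -
  have lin: "clinear_on (A \<otimes>\<^sub>s B) T" using T by (simp add: is_tensor_ext_def)
  obtain M where M: "\<And>u. u \<in> A \<otimes>\<^sub>s B \<Longrightarrow> norm (T u) \<le> M * norm u"
    using T unfolding is_tensor_ext_def by blast
  have sub: "csubspace (A \<otimes>\<^sub>s B)" unfolding spatial_tensor_def by (intro csubspace_closure) simp
  let ?S = "cspan ((\<lambda>p. fst p \<otimes>\<^sub>o snd p) ` (A \<times> B))"
  have S_sub: "?S \<subseteq> A \<otimes>\<^sub>s B" unfolding spatial_tensor_eq by (rule closure_subset)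
  have span: "T v \<in> D" if v: "v \<in> ?S" for v
  proof -
    obtain F c where F: "finite F" "F \<subseteq> A \<times> B" "v = (\<Sum>p\<in>F. c p *\<^sub>C (fst p \<otimes>\<^sub>o snd p))"
      using v by (rule cspan_image_explicit)
    have "T v = (\<Sum>p\<in>F. c p *\<^sub>C T (fst p \<otimes>\<^sub>o snd p))"
      unfolding F(3) using F(2) by (intro clinear_on_sum[OF lin sub F(1)]) (metis op_tensor_in_spatial_tensor mem_Times_iff subsetD)
    also have "\<dots> \<in> D"
      using F(2) T \<beta> unfolding is_tensor_ext_def
      by (intro complex_module.subspace_sum[OF D(1)] complex_module.subspace_scale[OF D(1)]) auto
    finally show ?thesis .
  qed
  obtain v where v: "\<And>n::nat. v n \<in> ?S" "v \<longlonglongrightarrow> u"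
    using u unfolding spatial_tensor_eq closure_sequential by blast
  have "(\<lambda>n. T (v n)) \<longlonglongrightarrow> T u"
  proof (rule LIM_zero_cancel, rule Lim_null_comparison)
    have "norm (T (v n) - T u) \<le> M * norm (v n - u)" for n
      using M[of "v n - u"] clinear_on_diff[OF lin sub, of "v n" u] u v(1)[of n] S_sub
        complex_module.subspace_diff[OF sub, of "v n" u] by auto
    then show "\<forall>\<^sub>F n in sequentially. norm (T (v n) - T u) \<le> M * norm (v n - u)" by simp
    show "(\<lambda>n. M * norm (v n - u)) \<longlonglongrightarrow> 0"
      using v(2) by (intro tendsto_mult_right_zero tendsto_norm_zero LIM_zero)
  qed
  then show ?thesis using closed_sequentially[OF D(2), of "\<lambda>n. T (v n)"] span[OF v(1)] by blast
qed

lemma is_tensor_ext_compose: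
  assumes T: "is_tensor_ext A B \<beta> T" and T_in: "\<And>u. u \<in> A \<otimes>\<^sub>s B \<Longrightarrow> T u \<in> D"
    and g: "clinear_on D g" "\<And>x. x \<in> D \<Longrightarrow> norm (g x) \<le> N * norm x"
  shows "is_tensor_ext A B (\<lambda>a b. g (\<beta> a b)) (\<lambda>u. g (T u))"
proof -
  obtain M where M: "\<And>u. u \<in> A \<otimes>\<^sub>s B \<Longrightarrow> norm (T u) \<le> M * norm u"
    using T unfolding is_tensor_ext_def by blast
  have "norm (g (T u)) \<le> (\<bar>N\<bar> * M) * norm u" if u: "u \<in> A \<otimes>\<^sub>s B" for u
  proof -
    have "norm (g (T u)) \<le> \<bar>N\<bar> * norm (T u)"
      using g(2)[OF T_in[OF u]] mult_right_mono[OF abs_ge_self[of N] norm_ge_zero[of "T u"]] by linarith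
    also have "\<dots> \<le> \<bar>N\<bar> * (M * norm u)" by (intro mult_left_mono M u) auto
    finally show ?thesis by (simp add: mult.assoc)
  qed
  then show ?thesis
    using T T_in g(1) unfolding is_tensor_ext_def clinear_on_def by auto
qed

context
  fixes A :: "('a::complex_hilbert \<Rightarrow>\<^sub>L 'a) set" and B :: "('b::complex_hilbert \<Rightarrow>\<^sub>L 'b) set"
  assumes A: "operator_space A" and B: "operator_space B"
begin

lemma slice_left_in:
  assumes "f \<in> bounded_functionals A" "u \<in> A \<otimes>\<^sub>s B" shows "slice_left A B f u \<in> B"
  using is_tensor_ext_range[OF is_tensor_ext_slice_left[OF A B assms(1)] _ _ _ assms(2), of B] B
  by (auto simp: operator_space_def complex_module.subspace_scale)

lemma slice_right_in:
  assumes "g \<in> bounded_functionals B" "u \<in> A \<otimes>\<^sub>s B" shows "slice_right A B g u \<in> A"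
  using is_tensor_ext_range[OF is_tensor_ext_slice_right[OF A B assms(1)] _ _ _ assms(2), of A] A
  by (auto simp: operator_space_def complex_module.subspace_scale)

text \<open>A Fubini rule: both orders of slicing are bounded and send a \<otimes> b to f a * g b,
  so they coincide with the chosen extension of f \<otimes> g.\<close>

lemma
  assumes f: "f \<in> bounded_functionals A" and g: "g \<in> bounded_functionals B" and u: "u \<in> A \<otimes>\<^sub>s B"
  shows tensor_ext_functional_left: "tensor_ext A B (\<lambda>a b. f a * g b) u = g (slice_left A B f u)"
    and tensor_ext_functional_right: "tensor_ext A B (\<lambda>a b. f a * g b) u = f (slice_right A B g u)"
    and slice_left_right: "g (slice_left A B f u) = f (slice_right A B g u)"
proof -
  obtain M N where M: "\<And>x. x \<in> A \<Longrightarrow> cmod (f x) \<le> M * norm x" and N: "\<And>x. x \<in> B \<Longrightarrow> cmod (g x) \<le> N * norm x"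
    using bounded_functionals_bound[OF f] bounded_functionals_bound[OF g] by metis
  note lin = bounded_functionals_clinear[OF f] bounded_functionals_clinear[OF g]
  have l: "is_tensor_ext A B (\<lambda>a b. f a * g b) (\<lambda>u. g (slice_left A B f u))"
    using is_tensor_ext_compose[OF is_tensor_ext_slice_left[OF A B f] slice_left_in[OF f] lin(2) N]
      clinear_onD(2)[OF lin(2)] by (simp add: is_tensor_ext_def scaleC_complex_def)
  have r: "is_tensor_ext A B (\<lambda>a b. f a * g b) (\<lambda>u. f (slice_right A B g u))"
    using is_tensor_ext_compose[OF is_tensor_ext_slice_right[OF A B g] slice_right_in[OF g] lin(1) M]
      clinear_onD(2)[OF lin(1)] by (simp add: is_tensor_ext_def scaleC_complex_def mult.commute)
  show "tensor_ext A B (\<lambda>a b. f a * g b) u = g (slice_left A B f u)"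
    "tensor_ext A B (\<lambda>a b. f a * g b) u = f (slice_right A B g u)"
    "g (slice_left A B f u) = f (slice_right A B g u)"
    using tensor_ext_eq[OF l u] tensor_ext_eq[OF r u] by simp_all
qed

end

section \<open>Vector functionals and triple slices\<close>

definition vector_functional :: "'a::complex_hilbert \<Rightarrow> 'a \<Rightarrow> 'a \<Rightarrow>\<^sub>L 'a \<Rightarrow> complex" where
  "vector_functional x x' T = cinner x (blinfun_apply T x')"

lemma vector_functional_bounded: "vector_functional x x' \<in> bounded_functionals C"
proof -
  have "cmod (vector_functional x x' T) \<le> (norm x * norm x') * norm T" for T
  proof -
    have "cmod (vector_functional x x' T) \<le> norm x * (norm T * norm x')"
      unfolding vector_functional_def
      by (intro order_trans[OF norm_cinner_le] mult_left_mono norm_blinfun norm_ge_zero)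
    then show ?thesis by (simp add: algebra_simps)
  qed
  moreover have "clinear_on C (vector_functional x x')"
    by (simp add: clinear_on_def vector_functional_def blinfun.add_left cinner_add_right
        scaleC_blinfun.rep_eq cinner_scaleC_right scaleC_complex_def)
  ultimately show ?thesis unfolding bounded_functionals_def by blast
qed

text \<open>At product vectors the functional factorises on elementary tensors, so it is the tensor
  product of two vector functionals and can be evaluated by slicing.\<close>

lemma vector_functional_htensor:
  assumes A: "operator_space A" and B: "operator_space B" and u: "u \<in> A \<otimes>\<^sub>s B"
  shows "vector_functional (x \<otimes>\<^sub>h y) (x' \<otimes>\<^sub>h y') u =
    vector_functional y y' (slice_left A B (vector_functional x x') u)"
proof -
  have "vector_functional (x \<otimes>\<^sub>h y) (x' \<otimes>\<^sub>h y') (a \<otimes>\<^sub>o b) = vector_functional x x' a * vector_functional y y' b"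
    if "a \<in> A" "b \<in> B" for a b
    using that A B by (auto simp: vector_functional_def operator_space_def op_tensor_apply cinner_htensor subset_iff)
  moreover have "vector_functional (x \<otimes>\<^sub>h y) (x' \<otimes>\<^sub>h y') \<in> bounded_functionals (A \<otimes>\<^sub>s B)"
    by (rule vector_functional_bounded)
  ultimately have "is_tensor_ext A B (\<lambda>a b. vector_functional x x' a * vector_functional y y' b)
      (vector_functional (x \<otimes>\<^sub>h y) (x' \<otimes>\<^sub>h y'))"
    unfolding is_tensor_ext_def bounded_functionals_def by auto
  then show ?thesis
    using tensor_ext_eq[OF _ u] tensor_ext_functional_left[OF A B vector_functional_bounded vector_functional_bounded u]
    by metis
qed

lemma slice_left_functional_bounded:
  assumes "operator_space A" "operator_space B" "f \<in> bounded_functionals A" "g \<in> bounded_functionals B"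
  shows "(\<lambda>u. g (slice_left A B f u)) \<in> bounded_functionals (A \<otimes>\<^sub>s B)"
proof -
  obtain N where "\<And>x. x \<in> B \<Longrightarrow> cmod (g x) \<le> N * norm x" using bounded_functionals_bound[OF assms(4)] by metis
  then show ?thesis
    using is_tensor_ext_compose[OF is_tensor_ext_slice_left[OF assms(1-3)] slice_left_in[OF assms(1-3)]
        bounded_functionals_clinear[OF assms(4)]]
    unfolding is_tensor_ext_def bounded_functionals_def by blast
qed

text \<open>Coassociativity is stated in terms of matrix elements on product vectors, so the triple
  slices of the two sides are compared through vector functionals.\<close>

lemma slice_assoc:
  assumes A: "operator_space A" and f: "f \<in> bounded_functionals A" and h: "h \<in> bounded_functionals A"
    and S: "S \<in> (A \<otimes>\<^sub>s A) \<otimes>\<^sub>s A" and T: "T \<in> A \<otimes>\<^sub>s (A \<otimes>\<^sub>s A)" and ST: "eq_up_to_assoc S T"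
  shows "slice_left A A f (slice_right (A \<otimes>\<^sub>s A) A h S) = slice_right A A h (slice_left A (A \<otimes>\<^sub>s A) f T)"
proof (rule blinfun_eq_cinnerI)
  fix y y'
  note AA = operator_space_spatial_tensor[OF A A]
  note v = vector_functional_bounded
  \<comment> \<open>\<theta> is the vector functional of (y, y') tensored with h, a functional on
    the last two legs.\<close>
  define \<theta> where "\<theta> u = h (slice_left A A (vector_functional y y') u)" for u
  have \<theta>: "\<theta> \<in> bounded_functionals (A \<otimes>\<^sub>s A)"
    unfolding \<theta>_def by (rule slice_left_functional_bounded[OF A A v h])
  let ?P = "slice_right (A \<otimes>\<^sub>s A) A h S" and ?Q = "slice_left A (A \<otimes>\<^sub>s A) f T"
  have P: "?P \<in> A \<otimes>\<^sub>s A" by (rule slice_right_in[OF AA A h S])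
  have Q: "?Q \<in> A \<otimes>\<^sub>s A" by (rule slice_left_in[OF A AA f T])
  \<comment> \<open>The matrix elements of both sides at z, z' are matrix elements of S and T at
    triple product vectors, which is exactly what \<open>eq_up_to_assoc\<close> compares.\<close>
  have S_T: "slice_left (A \<otimes>\<^sub>s A) A (vector_functional (x \<otimes>\<^sub>h y) (x' \<otimes>\<^sub>h y')) S =
      slice_left A A (vector_functional y y') (slice_left A (A \<otimes>\<^sub>s A) (vector_functional x x') T)" for x x'
  proof (rule blinfun_eq_cinnerI)
    fix z z'
    have "vector_functional ((x \<otimes>\<^sub>h y) \<otimes>\<^sub>h z) ((x' \<otimes>\<^sub>h y') \<otimes>\<^sub>h z') S =
        vector_functional (x \<otimes>\<^sub>h y \<otimes>\<^sub>h z) (x' \<otimes>\<^sub>h y' \<otimes>\<^sub>h z') T"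
      using ST unfolding eq_up_to_assoc_def vector_functional_def by blast
    then show "cinner z (blinfun_apply (slice_left (A \<otimes>\<^sub>s A) A (vector_functional (x \<otimes>\<^sub>h y) (x' \<otimes>\<^sub>h y')) S) z') =
      cinner z (blinfun_apply (slice_left A A (vector_functional y y') (slice_left A (A \<otimes>\<^sub>s A) (vector_functional x x') T)) z')"
      by (simp add: vector_functional_htensor[OF AA A S] vector_functional_htensor[OF A AA T]
          vector_functional_htensor[OF A A slice_left_in[OF A AA v T]] flip: vector_functional_def)
  qed
  \<comment> \<open>f is arbitrary, so it is kept out of the comparison: the two operators to which
    it will be applied are shown equal, by testing the first leg at x, x'.\<close>
  have "slice_right A A (vector_functional y y') ?P = slice_right A (A \<otimes>\<^sub>s A) \<theta> T"
  proof (rule blinfun_eq_cinnerI)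
    fix x x'
    have "vector_functional x x' (slice_right A A (vector_functional y y') ?P) =
        vector_functional (x \<otimes>\<^sub>h y) (x' \<otimes>\<^sub>h y') ?P"
      by (simp add: vector_functional_htensor[OF A A P] slice_left_right[OF A A v v P])
    also have "\<dots> = h (slice_left (A \<otimes>\<^sub>s A) A (vector_functional (x \<otimes>\<^sub>h y) (x' \<otimes>\<^sub>h y')) S)"
      by (rule slice_left_right[OF AA A v h S, symmetric])
    also have "\<dots> = \<theta> (slice_left A (A \<otimes>\<^sub>s A) (vector_functional x x') T)"
      unfolding S_T \<theta>_def ..
    also have "\<dots> = vector_functional x x' (slice_right A (A \<otimes>\<^sub>s A) \<theta> T)"
      by (rule slice_left_right[OF A AA v \<theta> T])
    finally show "cinner x (blinfun_apply (slice_right A A (vector_functional y y') ?P) x') =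
        cinner x (blinfun_apply (slice_right A (A \<otimes>\<^sub>s A) \<theta> T) x')"
      by (simp add: vector_functional_def)
  qed
  then have "f (slice_right A A (vector_functional y y') ?P) = \<theta> ?Q"
    by (simp add: slice_left_right[OF A AA f \<theta> T])
  then have "vector_functional y y' (slice_left A A f ?P) = vector_functional y y' (slice_right A A h ?Q)"
    by (simp add: slice_left_right[OF A A f v P] \<theta>_def slice_left_right[OF A A v h Q])
  then show "cinner y (blinfun_apply (slice_left A A f ?P) y') = cinner y (blinfun_apply (slice_right A A h ?Q) y')"
    by (simp add: vector_functional_def)
qed

section \<open>Convolution of functionals\<close>

text \<open>This is complete boundedness at n = 1. What has to be checked is that the norm of a 1 by
  1 matrix is the operator norm; the supremum there runs over families on all naturals, of which
  only the entry at 0 is constrained.\<close>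

lemma cb_bound_norm:
  assumes cb: "cb_bound C \<psi> M" and x: "x \<in> C"
  shows "norm (\<psi> x) \<le> M * norm x"
proof -
  have norm1: "matrix_norm 1 (\<lambda>_ _. T) = norm T" for T :: "'c::complex_hilbert \<Rightarrow>\<^sub>L 'd::complex_hilbert"
  proof -
    let ?B = "{\<xi>::nat \<Rightarrow> 'c. (\<Sum>j<1. (norm (\<xi> j))\<^sup>2) \<le> 1}"
    define g where "g \<xi> = sqrt (\<Sum>i<1::nat. (norm (\<Sum>j<1::nat. blinfun_apply T (\<xi> j)))\<^sup>2)" for \<xi> :: "nat \<Rightarrow> 'c"
    have le: "g \<xi> \<le> norm T" if "\<xi> \<in> ?B" for \<xi> :: "nat \<Rightarrow> 'c"
    proof -
      have "norm (\<xi> 0) \<le> 1" using that power2_le_imp_le[of "norm (\<xi> 0)" 1] by simp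
      then have "norm T * norm (\<xi> 0) \<le> norm T * 1" by (intro mult_left_mono) auto
      then show ?thesis using norm_blinfun[of T "\<xi> 0"] by (simp add: g_def)
    qed
    have bdd: "bdd_above (g ` ?B)" using le by (intro bdd_aboveI2[of _ _ "norm T"])
    show ?thesis
      unfolding matrix_norm_def g_def[symmetric]
    proof (rule antisym)
      have "(\<lambda>_. 0) \<in> ?B" by simp
      then have "?B \<noteq> {}" by (rule ex_in_conv[THEN iffD1, OF exI])
      then show "(SUP \<xi>\<in>?B. g \<xi>) \<le> norm T" using le by (rule cSUP_least)
      show "norm T \<le> (SUP \<xi>\<in>?B. g \<xi>)"
      proof (rule norm_blinfun_bound)
        show "0 \<le> (SUP \<xi>\<in>?B. g \<xi>)"
          using cSUP_upper[OF \<open>(\<lambda>_. 0) \<in> ?B\<close> bdd] by (simp add: g_def)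
        fix x
        show "norm (blinfun_apply T x) \<le> (SUP \<xi>\<in>?B. g \<xi>) * norm x"
        proof (cases "x = 0")
          case False
          have "norm (blinfun_apply T x) / norm x = g (\<lambda>_. x /\<^sub>R norm x)"
            by (simp add: g_def blinfun.scaleR_right divide_inverse mult.commute)
          also have "\<dots> \<le> (SUP \<xi>\<in>?B. g \<xi>)" using False by (intro cSUP_upper bdd) simp
          finally show ?thesis using False by (simp add: field_simps)
        qed simp
      qed
    qed
  qed
  have "matrix_norm 1 (\<lambda>_ _. \<psi> x) \<le> M * matrix_norm 1 (\<lambda>_ _. x)"
    using cb[unfolded cb_bound_def, rule_format, of 1 "\<lambda>_ _. x"] x by simp
  then show ?thesis unfolding norm1 .
qed

lemma bounded_functionals_scale: "f \<in> bounded_functionals C \<Longrightarrow> (\<lambda>x. c * f x) \<in> bounded_functionals C"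
proof -
  assume f: "f \<in> bounded_functionals C"
  then obtain M where "\<And>x. x \<in> C \<Longrightarrow> cmod (f x) \<le> M * norm x" using bounded_functionals_bound[OF f] by metis
  then have "cmod (c * f x) \<le> (cmod c * M) * norm x" if "x \<in> C" for x
    using that mult_left_mono[of "cmod (f x)" "M * norm x" "cmod c"] by (simp add: norm_mult mult.assoc)
  then have "\<exists>K. \<forall>x\<in>C. cmod (c * f x) \<le> K * norm x" by blast
  moreover have "clinear_on C (\<lambda>x. c * f x)"
    using f unfolding bounded_functionals_def clinear_on_def scaleC_complex_def
    by (auto simp: algebra_simps)
  ultimately show ?thesis unfolding bounded_functionals_def by blast
qed

lemma bounded_functionals_diff:
  assumes f: "f \<in> bounded_functionals C" and g: "g \<in> bounded_functionals C"
  shows "(\<lambda>x. f x - g x) \<in> bounded_functionals C"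
proof -
  obtain M N where "\<And>x. x \<in> C \<Longrightarrow> cmod (f x) \<le> M * norm x" "\<And>x. x \<in> C \<Longrightarrow> cmod (g x) \<le> N * norm x"
    using bounded_functionals_bound[OF f] bounded_functionals_bound[OF g] by metis
  then have "cmod (f x - g x) \<le> (M + N) * norm x" if "x \<in> C" for x
    using that norm_triangle_ineq4[of "f x" "g x"] by (fastforce simp: algebra_simps)
  then have "\<exists>K. \<forall>x\<in>C. cmod (f x - g x) \<le> K * norm x" by blast
  moreover have "clinear_on C (\<lambda>x. f x - g x)"
    using f g unfolding bounded_functionals_def clinear_on_def scaleC_complex_def
    by (auto simp: algebra_simps)
  ultimately show ?thesis unfolding bounded_functionals_def by blast
qed

locale coalgebra =
  fixes C :: "('h::complex_hilbert \<Rightarrow>\<^sub>L 'h) set" and \<epsilon> \<Delta>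
  assumes coalgebra: "operator_space_coalgebra C \<epsilon> \<Delta>"
begin

lemma operator_space: "operator_space C"
  using coalgebra by (simp add: operator_space_coalgebra_def)

lemma csubspace: "csubspace C" and closed: "closed C"
  using operator_space by (simp_all add: operator_space_def)

lemma
  shows coproduct_in: "x \<in> C \<Longrightarrow> \<Delta> x \<in> C \<otimes>\<^sub>s C" and coproduct_linear: "clinear_on C \<Delta>"
  and norm_coproduct_le: "x \<in> C \<Longrightarrow> norm (\<Delta> x) \<le> 1 * norm x"
  using coalgebra cb_bound_norm[of C \<Delta> 1]
  by (auto simp: operator_space_coalgebra_def complete_contractions_def)

text \<open>The counit is given through operators of multiplication on \<complex>; evaluation at 1
  recovers its scalar values together with linearity and the bound.\<close>

lemma counit_bounded: "\<epsilon> \<in> bounded_functionals C"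
proof -
  let ?\<epsilon> = "\<lambda>x. blinfun_mult_right (\<epsilon> x)"
  have lin: "clinear_on C ?\<epsilon>" and cb: "cb_bound C ?\<epsilon> 1"
    using coalgebra by (auto simp: operator_space_coalgebra_def complete_contractions_def)
  have "cmod (\<epsilon> x) \<le> 1 * norm x" if "x \<in> C" for x
    using norm_blinfun[of "?\<epsilon> x" 1] cb_bound_norm[OF cb that] by simp
  moreover have "clinear_on C \<epsilon>"
    unfolding clinear_on_def
  proof (intro conjI ballI allI)
    fix x y c assume "x \<in> C" "y \<in> C"
    then have "blinfun_apply (?\<epsilon> (x + y)) 1 = blinfun_apply (?\<epsilon> x + ?\<epsilon> y) 1" "blinfun_apply (?\<epsilon> (c *\<^sub>C x)) 1 = blinfun_apply (c *\<^sub>C ?\<epsilon> x) 1"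
      using clinear_onD[OF lin, of x] by simp_all
    then show "\<epsilon> (x + y) = \<epsilon> x + \<epsilon> y" "\<epsilon> (c *\<^sub>C x) = c *\<^sub>C \<epsilon> x"
      by (simp_all add: blinfun.add_left scaleC_blinfun.rep_eq scaleC_complex_def)
  qed
  ultimately show ?thesis unfolding bounded_functionals_def by blast
qed

abbreviation conv (infixl "\<star>" 70) where "f \<star> g \<equiv> convolution C \<Delta> f g"

context
  fixes f g
  assumes f: "f \<in> bounded_functionals C" and g: "g \<in> bounded_functionals C"
begin

lemma
  assumes "x \<in> C"
  shows convolution_left: "(f \<star> g) x = g (slice_left C C f (\<Delta> x))"
    and convolution_right: "(f \<star> g) x = f (slice_right C C g (\<Delta> x))"
  unfolding convolution_def
  by (intro tensor_ext_functional_left[OF operator_space operator_space f g] tensor_ext_functional_right[OF operator_space operator_space f g]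
      coproduct_in assms)+

lemma slice_coproduct_in:
  assumes "x \<in> C"
  shows "slice_left C C f (\<Delta> x) \<in> C" "slice_right C C g (\<Delta> x) \<in> C"
  using assms by (auto intro!: slice_left_in slice_right_in operator_space f g coproduct_in)

lemma convolution_bound:
  assumes M: "0 \<le> M" "\<And>x. x \<in> C \<Longrightarrow> cmod (f x) \<le> M * norm x"
    and N: "0 \<le> N" "\<And>x. x \<in> C \<Longrightarrow> cmod (g x) \<le> N * norm x" and x: "x \<in> C"
  shows "cmod ((f \<star> g) x) \<le> M * N * norm x"
proof -
  have "cmod ((f \<star> g) x) \<le> N * norm (slice_left C C f (\<Delta> x))"
    unfolding convolution_left[OF x] by (intro N slice_coproduct_in x)
  also have "\<dots> \<le> N * (M * norm (\<Delta> x))"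
    using norm_slice_left_le[OF operator_space operator_space bounded_functionals_clinear[OF f] M coproduct_in[OF x]]
    by (intro mult_left_mono N)
  also have "\<dots> \<le> N * (M * norm x)"
    using norm_coproduct_le[OF x] by (intro mult_left_mono M N) simp
  finally show ?thesis by (simp add: mult.assoc mult.commute mult.left_commute)
qed

lemma convolution_bounded: "f \<star> g \<in> bounded_functionals C"
proof -
  obtain M N where "0 \<le> M" "\<And>x. x \<in> C \<Longrightarrow> cmod (f x) \<le> M * norm x"
      "0 \<le> N" "\<And>x. x \<in> C \<Longrightarrow> cmod (g x) \<le> N * norm x"
    using bounded_functionals_bound[OF f] bounded_functionals_bound[OF g] by metis
  then have "\<exists>K. \<forall>x\<in>C. cmod ((f \<star> g) x) \<le> K * norm x" using convolution_bound by blast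
  moreover have "clinear_on C (f \<star> g)"
  proof -
    have "clinear_on (C \<otimes>\<^sub>s C) (slice_left C C f)"
      using is_tensor_ext_slice_left[OF operator_space operator_space f] by (simp add: is_tensor_ext_def)
    note lin = clinear_onD[OF coproduct_linear] clinear_onD[OF this] clinear_onD[OF bounded_functionals_clinear[OF g]]
    show ?thesis
      unfolding clinear_on_def
      using csubspace by (auto simp: convolution_left complex_module.subspace_add complex_module.subspace_scale lin
        coproduct_in slice_coproduct_in)
  qed
  ultimately show ?thesis unfolding bounded_functionals_def by blast
qed

end

text \<open>Slicing with g leaves the first functional outermost, where subtraction is
  pointwise.\<close>

lemma convolution_diff_left:
  assumes f: "f \<in> bounded_functionals C" and f': "f' \<in> bounded_functionals C" and g: "g \<in> bounded_functionals C" and x: "x \<in> C"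
  shows "((\<lambda>x. f x - f' x) \<star> g) x = (f \<star> g) x - (f' \<star> g) x"
  by (simp add: convolution_right[OF _ g x] f f' bounded_functionals_diff)

lemma convolution_counit:
  assumes f: "f \<in> bounded_functionals C" and x: "x \<in> C"
  shows "(f \<star> \<epsilon>) x = f x"
proof -
  obtain E where E: "is_tensor_ext C C (\<lambda>a b. \<epsilon> b *\<^sub>C a) E" "\<forall>x\<in>C. E (\<Delta> x) = x"
    using coalgebra unfolding operator_space_coalgebra_def by blast
  \<comment> \<open>The counit law speaks of some extension E of id \<otimes> \<epsilon>; uniqueness
    transfers it to the chosen slice map.\<close>
  have "slice_right C C \<epsilon> (\<Delta> x) = x"
    using tensor_ext_eq[OF E(1) coproduct_in[OF x]] E(2) x by (simp add: slice_right_def)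
  then show ?thesis by (simp add: convolution_right[OF f counit_bounded x])
qed

text \<open>Both sides are g applied to an element of C. The two elements agree because slicing
  commutes with \<Delta>: \<Delta> (id \<otimes> h) = (id \<otimes> id \<otimes> h)(\<Delta>
  \<otimes> id) and \<Delta> (f \<otimes> id) = (f \<otimes> id \<otimes> id)(id \<otimes>
  \<Delta>). Each relation is checked on elementary tensors and extended by uniqueness, after which
  \<open>slice_assoc\<close> applies.\<close>

lemma convolution_assoc:
  assumes f: "f \<in> bounded_functionals C" and g: "g \<in> bounded_functionals C" and h: "h \<in> bounded_functionals C" and x: "x \<in> C"
  shows "((f \<star> g) \<star> h) x = (f \<star> (g \<star> h)) x"
proof -
  note C = operator_space
  note CC = operator_space_spatial_tensor[OF C C]
  obtain \<Delta>_id id_\<Delta> where \<Delta>_id: "is_tensor_ext C C (\<lambda>a b. \<Delta> a \<otimes>\<^sub>o b) \<Delta>_id"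
    and id_\<Delta>: "is_tensor_ext C C (\<lambda>a b. a \<otimes>\<^sub>o \<Delta> b) id_\<Delta>"
    and assoc: "\<forall>x\<in>C. eq_up_to_assoc (\<Delta>_id (\<Delta> x)) (id_\<Delta> (\<Delta> x))"
    using coalgebra unfolding operator_space_coalgebra_def by blast
  have in1: "\<Delta>_id u \<in> (C \<otimes>\<^sub>s C) \<otimes>\<^sub>s C" if "u \<in> C \<otimes>\<^sub>s C" for u
    using operator_space_spatial_tensor[OF CC C]
    by (intro is_tensor_ext_range[OF \<Delta>_id _ _ _ that] op_tensor_in_spatial_tensor coproduct_in)
      (simp_all add: operator_space_def)
  have in2: "id_\<Delta> u \<in> C \<otimes>\<^sub>s (C \<otimes>\<^sub>s C)" if "u \<in> C \<otimes>\<^sub>s C" for u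
    using operator_space_spatial_tensor[OF C CC]
    by (intro is_tensor_ext_range[OF id_\<Delta> _ _ _ that] op_tensor_in_spatial_tensor coproduct_in)
      (simp_all add: operator_space_def)
  note sr = is_tensor_ext_slice_right[OF C C h] is_tensor_ext_slice_right[OF CC C h]
  note sl = is_tensor_ext_slice_left[OF C C f] is_tensor_ext_slice_left[OF C CC f]
  note \<Delta>x = coproduct_in[OF x]
  have lin_bound: "clinear_on (A \<otimes>\<^sub>s B) T \<and> (\<exists>N. \<forall>u\<in>A \<otimes>\<^sub>s B. norm (T u) \<le> N * norm u)" if "is_tensor_ext A B \<beta> T"
    for A :: "('a::complex_hilbert \<Rightarrow>\<^sub>L 'a) set" and B :: "('b::complex_hilbert \<Rightarrow>\<^sub>L 'b) set" and \<beta> and T :: "_ \<Rightarrow> 'c::complex_normed_vector"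
    using that unfolding is_tensor_ext_def by blast
  have "\<Delta> (slice_right C C h (\<Delta> x)) = slice_right (C \<otimes>\<^sub>s C) C h (\<Delta>_id (\<Delta> x))"
  proof (rule is_tensor_ext_unique[OF _ _ \<Delta>x])
    show "is_tensor_ext C C (\<lambda>a b. \<Delta> (h b *\<^sub>C a)) (\<lambda>u. \<Delta> (slice_right C C h u))"
      by (rule is_tensor_ext_compose[OF sr(1) slice_right_in[OF C C h] coproduct_linear norm_coproduct_le])
    obtain N where N: "\<And>u. u \<in> (C \<otimes>\<^sub>s C) \<otimes>\<^sub>s C \<Longrightarrow> norm (slice_right (C \<otimes>\<^sub>s C) C h u) \<le> N * norm u"
      using lin_bound[OF sr(2)] by blast
    have "is_tensor_ext C C (\<lambda>a b. slice_right (C \<otimes>\<^sub>s C) C h (\<Delta> a \<otimes>\<^sub>o b)) (\<lambda>u. slice_right (C \<otimes>\<^sub>s C) C h (\<Delta>_id u))"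
      by (rule is_tensor_ext_compose[OF \<Delta>_id in1 _ N]) (use lin_bound[OF sr(2)] in auto)
    then show "is_tensor_ext C C (\<lambda>a b. \<Delta> (h b *\<^sub>C a)) (\<lambda>u. slice_right (C \<otimes>\<^sub>s C) C h (\<Delta>_id u))"
      using sr(2) coproduct_in unfolding is_tensor_ext_def by (simp add: clinear_onD(2)[OF coproduct_linear])
  qed
  moreover have "\<Delta> (slice_left C C f (\<Delta> x)) = slice_left C (C \<otimes>\<^sub>s C) f (id_\<Delta> (\<Delta> x))"
  proof (rule is_tensor_ext_unique[OF _ _ \<Delta>x])
    show "is_tensor_ext C C (\<lambda>a b. \<Delta> (f a *\<^sub>C b)) (\<lambda>u. \<Delta> (slice_left C C f u))"
      by (rule is_tensor_ext_compose[OF sl(1) slice_left_in[OF C C f] coproduct_linear norm_coproduct_le])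
    obtain N where N: "\<And>u. u \<in> C \<otimes>\<^sub>s (C \<otimes>\<^sub>s C) \<Longrightarrow> norm (slice_left C (C \<otimes>\<^sub>s C) f u) \<le> N * norm u"
      using lin_bound[OF sl(2)] by blast
    have "is_tensor_ext C C (\<lambda>a b. slice_left C (C \<otimes>\<^sub>s C) f (a \<otimes>\<^sub>o \<Delta> b)) (\<lambda>u. slice_left C (C \<otimes>\<^sub>s C) f (id_\<Delta> u))"
      by (rule is_tensor_ext_compose[OF id_\<Delta> in2 _ N]) (use lin_bound[OF sl(2)] in auto)
    then show "is_tensor_ext C C (\<lambda>a b. \<Delta> (f a *\<^sub>C b)) (\<lambda>u. slice_left C (C \<otimes>\<^sub>s C) f (id_\<Delta> u))"
      using sl(2) coproduct_in unfolding is_tensor_ext_def by (simp add: clinear_onD(2)[OF coproduct_linear])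
  qed
  moreover have "slice_left C C f (slice_right (C \<otimes>\<^sub>s C) C h (\<Delta>_id (\<Delta> x))) =
      slice_right C C h (slice_left C (C \<otimes>\<^sub>s C) f (id_\<Delta> (\<Delta> x)))"
    using assoc x by (intro slice_assoc C f h in1 in2 \<Delta>x) blast
  ultimately show ?thesis
    by (simp add: convolution_right[OF convolution_bounded[OF f g] h x] convolution_left[OF f convolution_bounded[OF g h] x]
        convolution_left[OF f g] convolution_right[OF g h] slice_coproduct_in[OF f h x] slice_coproduct_in[OF f h x])
qed

end

section \<open>Exponential vectors and step functions\<close>

lemma exp_vec_product:
  assumes "set bs \<subseteq> onb"
  shows "cnj (Rep_ell2 (exp_vec f) bs) * Rep_ell2 (exp_vec g) bs =
    inverse (fact (length bs)) * (\<Prod>b\<leftarrow>bs. cnj (cinner b f) * cinner b g)"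
proof -
  let ?s = "complex_of_real (sqrt (fact (length bs)))"
  have P: "cnj (\<Prod>b\<leftarrow>bs. cinner b f) * (\<Prod>b\<leftarrow>bs. cinner b g) = (\<Prod>b\<leftarrow>bs. cnj (cinner b f) * cinner b g)" for bs
    by (induction bs) (auto simp: algebra_simps)
  have "sqrt (fact (length bs)) * sqrt (fact (length bs)) = fact (length bs)" by simp
  then have "?s * ?s = fact (length bs)" by (metis of_real_fact of_real_mult)
  then have s: "inverse ?s * inverse ?s = inverse (fact (length bs))" by (metis inverse_mult_distrib)
  have "cnj (Rep_ell2 (exp_vec f) bs) * Rep_ell2 (exp_vec g) bs =
      (inverse ?s * inverse ?s) * (cnj (\<Prod>b\<leftarrow>bs. cinner b f) * (\<Prod>b\<leftarrow>bs. cinner b g))"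
    using assms by (simp add: exp_vec.rep_eq divide_inverse)
  then show ?thesis unfolding P s .
qed

lemma has_sum_lists:
  fixes f g :: "'a::complex_hilbert"
  shows "((\<lambda>bs. \<Prod>b\<leftarrow>bs. cnj (cinner b f) * cinner b g) has_sum cinner f g ^ n) {bs. set bs \<subseteq> onb \<and> length bs = n}"
proof (induction n)
  case 0
  have "{bs. set bs \<subseteq> onb \<and> length bs = 0} = {[] :: 'a list}" by auto
  then show ?case by (intro has_sum_finiteI) auto
next
  case (Suc n)
  let ?L = "\<lambda>n. {bs :: 'a list. set bs \<subseteq> onb \<and> length bs = n}"
  let ?P = "\<lambda>bs. \<Prod>b\<leftarrow>bs. cnj (cinner b f) * cinner b g"
  \<comment> \<open>The iterated sum determines the total only once the total is known to exist.
    Existence is borrowed from the square summability of the exponential vectors, with the factorial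
    multiplied back in.\<close>
  have "(\<lambda>bs. cnj (Rep_ell2 (exp_vec f) bs) * Rep_ell2 (exp_vec g) bs) summable_on UNIV"
    by (rule ell2_inner) (use Rep_ell2 in auto)
  then have "(\<lambda>bs. fact (Suc n) * (cnj (Rep_ell2 (exp_vec f) bs) * Rep_ell2 (exp_vec g) bs)) summable_on ?L (Suc n)"
    by (intro summable_on_cmult_right) (rule summable_on_subset_banach[OF _ subset_UNIV])
  also have "?this \<longleftrightarrow> ?P summable_on ?L (Suc n)"
    by (rule summable_on_cong) (simp add: exp_vec_product del: fact_Suc)
  finally obtain S where S: "(?P has_sum S) (?L (Suc n))" by (auto simp: summable_on_def)
  have "?L (Suc n) = (\<lambda>p. fst p # snd p) ` (onb \<times> ?L n)"
    by (auto simp: length_Suc_conv image_iff)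
  with S have "(?P has_sum S) ((\<lambda>p. fst p # snd p) ` (onb \<times> ?L n))" by simp
  then have S': "((\<lambda>p. ?P (fst p # snd p)) has_sum S) (onb \<times> ?L n)"
    by (subst (asm) has_sum_reindex) (auto simp: inj_on_def o_def)
  have "((\<lambda>b. (cnj (cinner b f) * cinner b g) * cinner f g ^ n) has_sum S) onb"
    by (rule has_sum_SigmaD[OF S']) (auto intro!: has_sum_cmult_right Suc.IH)
  moreover have "((\<lambda>b. (cnj (cinner b f) * cinner b g) * cinner f g ^ n) has_sum cinner f g * cinner f g ^ n) onb"
    by (intro has_sum_cmult_left parseval orthonormal_basis_onb)
  ultimately have "S = cinner f g ^ Suc n" using has_sum_unique by fastforce
  then show ?case using S by simp
qed

text \<open>Grouping the lists by length produces the exponential series, one power of the inner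
  product for each particle number.\<close>

lemma cinner_exp_vec: "cinner (exp_vec f) (exp_vec g) = exp (cinner f g)"
proof -
  let ?L = "\<lambda>n. {bs :: 'a list. set bs \<subseteq> onb \<and> length bs = n}"
  let ?h = "\<lambda>bs. cnj (Rep_ell2 (exp_vec f) bs) * Rep_ell2 (exp_vec g) bs"
  let ?P = "\<lambda>bs. \<Prod>b\<leftarrow>bs. cnj (cinner b f) * cinner b g"
  have h: "?h bs = inverse (fact n) * ?P bs" if "bs \<in> ?L n" for bs n
    using that exp_vec_product[of bs f g] by auto
  have "(?h has_sum cinner (exp_vec f) (exp_vec g)) UNIV"
    unfolding cinner_ell2_def ell2_ip.rep_eq
    by (intro has_sum_infsum ell2_inner) (use Rep_ell2 in auto)
  then have "(?h has_sum cinner (exp_vec f) (exp_vec g)) {bs. set bs \<subseteq> onb}"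
    by (subst has_sum_cong_neutral[where T = UNIV and g = ?h]) (auto simp: exp_vec.rep_eq)
  also have "{bs. set bs \<subseteq> onb} = snd ` (Sigma UNIV ?L)" by (auto simp: image_iff)
  finally have "((\<lambda>p. ?h (snd p)) has_sum cinner (exp_vec f) (exp_vec g)) (Sigma UNIV ?L)"
    by (subst (asm) has_sum_reindex) (auto simp: inj_on_def o_def case_prod_beta)
  then have "((\<lambda>n. inverse (fact n) * cinner f g ^ n) has_sum cinner (exp_vec f) (exp_vec g)) UNIV"
  proof (rule has_sum_SigmaD)
    fix n
    have "((\<lambda>bs. inverse (fact n) * ?P bs) has_sum inverse (fact n) * cinner f g ^ n) (?L n)"
      by (intro has_sum_cmult_right has_sum_lists)
    then show "((\<lambda>bs. ?h (snd (n, bs))) has_sum inverse (fact n) * cinner f g ^ n) (?L n)"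
      by (subst has_sum_cong[where g = "\<lambda>bs. inverse (fact n) * ?P bs"]) (use h in auto)
  qed
  from has_sum_imp_sums[OF this] have "(\<lambda>n. cinner f g ^ n /\<^sub>R fact n) sums cinner (exp_vec f) (exp_vec g)"
    by (simp add: scaleR_conv_of_real)
  then show ?thesis using exp_converges sums_unique2 by blast
qed

lemma cinner_expv:
  assumes "square_integrable f" "square_integrable g"
  shows "cinner (expv f) (expv g) = exp (\<integral>s. cinner (f s) (g s) \<partial>Rplus)"
  using assms unfolding expv_def cinner_exp_vec cinner_L2_def by (simp add: L2_ip.abs_eq l2_eq_def)

section \<open>Closure properties and shifts of step functions\<close>

lemma restr_in_step_functions: "0 \<le> t \<Longrightarrow> restr {0..<t} (\<lambda>_. c) \<in> step_functions"
  unfolding step_functions_def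
  by (auto intro!: exI[of _ "1::nat"] exI[of _ "\<lambda>_. c"] exI[of _ "\<lambda>_. t"])

lemma step_functions_add_restr:
  assumes "f \<in> step_functions" "0 \<le> t"
  shows "(\<lambda>s. f s + restr {0..<t} (\<lambda>_. c) s) \<in> step_functions"
proof -
  obtain n d u where f: "\<forall>i<n. 0 \<le> u i" "f = (\<lambda>s. \<Sum>i<n::nat. restr {0..<u i} (\<lambda>_. d i) s)"
    using assms(1) unfolding step_functions_def by blast
  have "(\<lambda>s. f s + restr {0..<t} (\<lambda>_. c) s) =
      (\<lambda>s. \<Sum>i<Suc n. restr {0..<(u(n := t)) i} (\<lambda>_. (d(n := c)) i) s)"
    unfolding f(2) by (auto intro!: sum.cong)
  moreover have "\<forall>i<Suc n. 0 \<le> (u(n := t)) i" using f(1) assms(2) by (auto simp: less_Suc_eq)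
  ultimately show ?thesis unfolding step_functions_def by blast
qed

lemma step_functions_induct [consumes 1, case_names zero add]:
  assumes "f \<in> step_functions" "P (\<lambda>_. 0)"
    and add: "\<And>f c t. f \<in> step_functions \<Longrightarrow> P f \<Longrightarrow> 0 \<le> t \<Longrightarrow> P (\<lambda>s. f s + restr {0..<t} (\<lambda>_. c) s)"
  shows "P f"
proof -
  obtain n d u where f: "\<forall>i<n. 0 \<le> u i" "f = (\<lambda>s. \<Sum>i<n::nat. restr {0..<u i} (\<lambda>_. d i) s)"
    using assms(1) unfolding step_functions_def by blast
  let ?f = "\<lambda>n s. \<Sum>i<n::nat. restr {0..<u i} (\<lambda>_. d i) s"
  have "P (?f m) \<and> ?f m \<in> step_functions" if "m \<le> n" for m
    using that
  proof (induction m)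
    case 0
    have "(\<lambda>_. 0) \<in> step_functions" unfolding step_functions_def by (auto intro!: exI[of _ "0::nat"])
    then show ?case using assms(2) by simp
  next
    case (Suc m)
    then have "P (?f m)" "?f m \<in> step_functions" "0 \<le> u m" using f(1) by auto
    then have "P (\<lambda>s. ?f m s + restr {0..<u m} (\<lambda>_. d m) s)"
      "(\<lambda>s. ?f m s + restr {0..<u m} (\<lambda>_. d m) s) \<in> step_functions"
      by (auto intro: add step_functions_add_restr)
    then show ?case by simp
  qed
  then show ?thesis unfolding f(2) by blast
qed

lemma step_functions_zero: "(\<lambda>_. 0) \<in> step_functions"
  unfolding step_functions_def by (auto intro!: exI[of _ "0::nat"])

lemma restr_add: "restr I (\<lambda>s. f s + g s) = (\<lambda>s. restr I f s + restr I g s)"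
  by (auto simp: restr_def)

lemma step_functions_restr_lessThan:
  assumes "f \<in> step_functions" "0 \<le> s"
  shows "restr {0..<s} f \<in> step_functions"
  using assms(1)
proof (induction f rule: step_functions_induct)
  case zero
  show ?case by (simp add: restr_def step_functions_zero)
next
  case (add f c t)
  have "restr {0..<s} (restr {0..<t} (\<lambda>_. c)) = restr {0..<min s t} (\<lambda>_. c)" by (auto simp: restr_def)
  then show ?case
    using add assms(2) step_functions_add_restr[of "restr {0..<s} f" "min s t" c] by (simp add: restr_add)
qed

lemma step_functions_restr_atLeast:
  assumes "f \<in> step_functions" "0 \<le> s"
  shows "restr {s..} f \<in> step_functions"
  using assms(1)
proof (induction f rule: step_functions_induct)
  case zero
  show ?case by (simp add: restr_def step_functions_zero)
next
  case (add f c t)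
  \<comment> \<open>The generating intervals all start at 0, so the interval from s to t is written
    as a difference of two of them; for t < s the two terms cancel.\<close>
  have "restr {s..} (restr {0..<t} (\<lambda>_. c)) = (\<lambda>q. restr {0..<t} (\<lambda>_. c) q + restr {0..<min s t} (\<lambda>_. - c) q)"
    using assms(2) by (auto simp: restr_def)
  then have "restr {s..} (\<lambda>q. f q + restr {0..<t} (\<lambda>_. c) q) =
      (\<lambda>q. (restr {s..} f q + restr {0..<t} (\<lambda>_. c) q) + restr {0..<min s t} (\<lambda>_. - c) q)"
    by (simp add: restr_add add.assoc)
  then show ?case
    using add assms(2) by (auto intro!: step_functions_add_restr)
qed

lemma step_functions_left_shift:
  assumes "f \<in> step_functions" "0 \<le> s"
  shows "left_shift s f \<in> step_functions"
  using assms(1)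
proof (induction f rule: step_functions_induct)
  case zero
  show ?case by (simp add: left_shift_def step_functions_zero)
next
  case (add f c t)
  \<comment> \<open>An interval that ends before s is shifted away altogether; the maximum with 0
    makes it empty while keeping the endpoint admissible.\<close>
  have "left_shift s (\<lambda>q. f q + restr {0..<t} (\<lambda>_. c) q) =
      (\<lambda>q. left_shift s f q + restr {0..<max 0 (t - s)} (\<lambda>_. c) q)"
    using assms(2) by (auto simp: restr_def left_shift_def fun_eq_iff)
  then show ?case using add by (auto intro!: step_functions_add_restr)
qed

lemma simple_function_step:
  assumes "f \<in> step_functions" shows "simple_function borel f"
  using assms
proof (induction f rule: step_functions_induct)
  case (add f c t)
  have "simple_function borel (indicator {0..<t} :: real \<Rightarrow> real)" by (intro simple_function_indicator) simp
  then have "simple_function borel (\<lambda>s. if indicator {0..<t} s = (1::real) then c else 0)"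
    by (rule simple_function_compose1)
  also have "(\<lambda>s. if indicator {0..<t} s = (1::real) then c else 0) = restr {0..<t} (\<lambda>_. c)"
    by (auto simp: restr_def indicator_def)
  finally show ?case by (rule simple_function_compose2[OF add.IH])
qed simp

lemma step_functions_bounded:
  assumes "f \<in> step_functions"
  obtains K where "\<And>s. norm (f s) \<le> K"
proof -
  have "finite (range f)" using simple_functionD(1)[OF simple_function_step[OF assms]] by simp
  then have "bounded (range f)" by (rule finite_imp_bounded)
  then show ?thesis using that unfolding bounded_iff by blast
qed

text \<open>As k vanishes below s, both integrals extend to the whole line, where translation
  invariance applies. Borel measurability allows the passage between \<open>lebesgue\<close> and
  \<open>lborel\<close>.\<close>

lemma lebesgue_integral_Rplus_shift:
  fixes k :: "real \<Rightarrow> complex"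
  assumes k: "k \<in> borel_measurable borel" and zero: "\<And>x. x < s \<Longrightarrow> k x = 0" and s: "0 \<le> s"
  shows "(\<integral>x. k x \<partial>Rplus) = (\<integral>x. k (s + x) \<partial>Rplus)"
proof -
  have "(\<integral>x. k x \<partial>Rplus) = (\<integral>x. indicator {0..} x *\<^sub>R k x \<partial>lebesgue)"
    by (subst integral_restrict_space) auto
  also have "(\<lambda>x. indicator {0..} x *\<^sub>R k x) = k" using zero s by (auto simp: indicator_def fun_eq_iff)
  also have "integral\<^sup>L lebesgue k = integral\<^sup>L lborel k" using k by (intro integral_completion) simp
  also have "\<dots> = (\<integral>x. k (s + x) \<partial>lborel)" using lborel_integral_real_affine[of 1 k s] by simp
  also have "\<dots> = (\<integral>x. k (s + x) \<partial>lebesgue)"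
    using k by (intro integral_completion[symmetric]) simp
  also have "(\<lambda>x. k (s + x)) = (\<lambda>x. indicator {0..} x *\<^sub>R k (s + x))"
    using zero by (auto simp: indicator_def fun_eq_iff)
  also have "(\<integral>x. indicator {0..} x *\<^sub>R k (s + x) \<partial>lebesgue) = (\<integral>x. k (s + x) \<partial>Rplus)"
    by (subst integral_restrict_space) auto
  finally show ?thesis .
qed

text \<open>It identifies the scalar that adaptedness produces at time s with the initial scalar in
  the equation for the shifted functions.\<close>

lemma cinner_expv_left_shift:
  assumes f: "f \<in> step_functions" and g: "g \<in> step_functions" and s: "0 \<le> s"
  shows "cinner (expv (restr {s..} f)) (expv (restr {s..} g)) = cinner (expv (left_shift s f)) (expv (left_shift s g))"
proof -
  let ?k = "\<lambda>x. cinner (restr {s..} f x) (restr {s..} g x)"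
  have "simple_function borel ?k"
    by (rule simple_function_compose2[OF simple_function_step simple_function_step])
      (intro step_functions_restr_atLeast f g s)+
  then have "?k \<in> borel_measurable borel" by (rule borel_measurable_simple_function)
  then have "(\<integral>x. ?k x \<partial>Rplus) = (\<integral>x. ?k (s + x) \<partial>Rplus)"
    by (rule lebesgue_integral_Rplus_shift[OF _ _ s]) (simp add: restr_def)
  also have "\<dots> = (\<integral>x. cinner (left_shift s f x) (left_shift s g x) \<partial>Rplus)"
    by (intro Bochner_Integration.integral_cong) (auto simp: restr_def left_shift_def space_restrict_space add.commute)
  finally show ?thesis
    by (simp add: cinner_expv square_integrable_step_functions step_functions_restr_atLeast step_functions_left_shift f g s)
qed

text \<open>This is the factor between cutting off at a and at b; the normalisation of the
  associated semigroups absorbs it.\<close>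

lemma cinner_expv_interval:
  assumes "0 \<le> a" "a \<le> b"
  shows "cinner (expv (restr {a..} (restr {0..<b} (\<lambda>_. c')))) (expv (restr {a..} (restr {0..<b} (\<lambda>_. c)))) =
    exp (complex_of_real (b - a) * cinner c' c)"
proof -
  have "(\<integral>x. cinner (restr {a..} (restr {0..<b} (\<lambda>_. c')) x) (restr {a..} (restr {0..<b} (\<lambda>_. c)) x) \<partial>Rplus) =
      (\<integral>x. indicator {a..<b} x *\<^sub>R cinner c' c \<partial>Rplus)"
    using assms by (intro Bochner_Integration.integral_cong) (auto simp: restr_def indicator_def)
  also have "\<dots> = (\<integral>x. indicator {0..} x *\<^sub>R indicator {a..<b} x *\<^sub>R cinner c' c \<partial>lebesgue)"
    by (subst integral_restrict_space) auto
  also have "\<dots> = (\<integral>x. indicator {a..<b} x *\<^sub>R cinner c' c \<partial>lebesgue)"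
    using assms by (intro Bochner_Integration.integral_cong) (auto simp: indicator_def)
  also have "\<dots> = complex_of_real (b - a) * cinner c' c"
    using assms by (simp add: scaleR_conv_of_real)
  finally show ?thesis
    using assms
    by (subst cinner_expv) (auto intro!: square_integrable_step_functions step_functions_restr_atLeast restr_in_step_functions)
qed

section \<open>Convolution integral equations\<close>

text \<open>The functionals are linear only on the closed subspace C, so the Baire category argument
  is run in the relative topology of C.\<close>

lemma uniform_boundedness:
  fixes f :: "'i \<Rightarrow> 'a::{complex_normed_vector, banach} \<Rightarrow> complex"
  assumes C: "csubspace C" "closed C"
    and f: "\<And>i. i \<in> I \<Longrightarrow> clinear_on C (f i)" "\<And>i. i \<in> I \<Longrightarrow> \<exists>M. \<forall>x\<in>C. cmod (f i x) \<le> M * norm x"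
    and pointwise: "\<And>x. x \<in> C \<Longrightarrow> \<exists>K. \<forall>i\<in>I. cmod (f i x) \<le> K"
  obtains K where "0 \<le> K" "\<And>i x. i \<in> I \<Longrightarrow> x \<in> C \<Longrightarrow> cmod (f i x) \<le> K * norm x"
proof -
  note scale = complex_module.subspace_scale[OF C(1)]
  define B where "B n = {x \<in> C. \<forall>i\<in>I. cmod (f i x) \<le> real n}" for n
  let ?X = "top_of_set C"
  have cont: "continuous_on C (f i)" if i: "i \<in> I" for i
  proof -
    obtain M where M: "\<And>x. x \<in> C \<Longrightarrow> cmod (f i x) \<le> M * norm x" using f(2)[OF i] by blast
    have "dist (f i x) (f i y) \<le> M * dist x y" if "x \<in> C" "y \<in> C" for x y
      using M[of "x - y"] clinear_on_diff[OF f(1)[OF i] C(1) that] complex_module.subspace_diff[OF C(1) that]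
      by (simp add: dist_norm)
    then have "dist (f i x) (f i y) \<le> \<bar>M\<bar> * dist x y" if "x \<in> C" "y \<in> C" for x y
      using that mult_right_mono[OF abs_ge_self[of M] zero_le_dist[of x y]] by (metis order_trans)
    then have "\<bar>M\<bar>-lipschitz_on C (f i)" by (intro lipschitz_onI) auto
    then show ?thesis by (rule lipschitz_on_continuous_on)
  qed
  have closedin: "closedin ?X (B n)" for n
  proof -
    \<comment> \<open>The outer C matters when I is empty, since the inner intersection is then
      everything.\<close>
    have "B n = C \<inter> (\<Inter>i\<in>I. C \<inter> f i -` cball 0 (real n))" by (auto simp: B_def)
    also have "closedin ?X \<dots>"
    proof (cases "I = {}")
      case False
      have "closedin ?X (C \<inter> f i -` cball 0 (real n))" if "i \<in> I" for i
        using cont[OF that] by (intro continuous_closedin_preimage) auto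
      then have "closedin ?X (\<Inter>i\<in>I. C \<inter> f i -` cball 0 (real n))" by (rule closedin_INT[OF False])
      moreover have "closedin ?X C" by simp
      ultimately show ?thesis by (intro closedin_Int)
    qed simp
    finally show ?thesis .
  qed
  have "\<exists>n. x \<in> B n" if "x \<in> C" for x
  proof -
    obtain K where K: "\<forall>i\<in>I. cmod (f i x) \<le> K" using pointwise[OF \<open>x \<in> C\<close>] by blast
    obtain n :: nat where "K \<le> real n" using real_arch_simple by blast
    then show ?thesis using K \<open>x \<in> C\<close> unfolding B_def by (auto intro!: exI[of _ n] intro: order_trans)
  qed
  then have UB: "\<Union>(range B) = C" by (auto simp: B_def)
  have "0 \<in> C" using complex_module.subspace_0[OF C(1)] .
  have "\<exists>n. ?X interior_of B n \<noteq> {}"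
  proof (rule ccontr)
    assume "\<not> ?thesis"
    moreover have "completely_metrizable_space ?X"
      using completely_metrizable_space_closedin[OF completely_metrizable_space_euclidean] C(2) by auto
    ultimately have "?X interior_of \<Union>(range B) = {}"
      using closedin by (intro Baire_category_alt) auto
    then show False using UB \<open>0 \<in> C\<close> interior_of_topspace[of ?X] by auto
  qed
  then obtain n x0 where x0: "x0 \<in> ?X interior_of B n" by blast
  then obtain T where T: "open T" "x0 \<in> T" "C \<inter> T \<subseteq> B n"
    unfolding interior_of_def openin_open by auto
  have "x0 \<in> C" using x0 interior_of_subset[of ?X "B n"] by (auto simp: B_def)
  obtain r where r: "0 < r" "ball x0 r \<subseteq> T" using T(1,2) openE by blast
  \<comment> \<open>Elements of C of norm r / 2 are differences of two points of \<open>B n\<close>,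
    so the functionals are at most 2 * n there; rescaling by 2 * norm x / r gives the
    constant.\<close>
  define K where "K = 4 * real n / r"
  have "cmod (f i x) \<le> K * norm x" if i: "i \<in> I" and x: "x \<in> C" for i x
  proof (cases "x = 0")
    case True
    then show ?thesis using clinear_on_zero[OF f(1)[OF i] C(1)] by simp
  next
    case False
    let ?c = "complex_of_real (r / (2 * norm x))"
    let ?y = "?c *\<^sub>C x"
    have y: "?y \<in> C" using scale[OF x] .
    have "norm ?y = r / 2" using False r by (simp add: norm_scaleC norm_divide norm_mult)
    then have "x0 + ?y \<in> ball x0 r" using r(1) by (simp add: dist_norm)
    then have "x0 + ?y \<in> B n" "x0 \<in> B n"
      using r(1) r(2) T complex_module.subspace_add[OF C(1) \<open>x0 \<in> C\<close> y] \<open>x0 \<in> C\<close> by auto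
    then have "cmod (f i (x0 + ?y)) \<le> n" "cmod (f i x0) \<le> n" using i by (auto simp: B_def)
    moreover have "f i (x0 + ?y) = f i x0 + f i ?y" using clinear_onD(1)[OF f(1)[OF i] \<open>x0 \<in> C\<close> y] .
    ultimately have "cmod (f i ?y) \<le> 2 * n" using norm_triangle_ineq4[of "f i x0 + f i ?y" "f i x0"] by simp
    moreover have "cmod (f i ?y) = r / (2 * norm x) * cmod (f i x)"
      using r(1) by (simp add: clinear_onD(2)[OF f(1)[OF i] x] scaleC_complex_def norm_mult norm_divide)
    ultimately have "r / (2 * norm x) * cmod (f i x) \<le> 2 * n" by (simp only:)
    then show ?thesis using False r(1) by (simp add: K_def field_simps)
  qed
  moreover have "0 \<le> K" using r(1) by (simp add: K_def)
  ultimately show ?thesis using that by blast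
qed

text \<open>Continuity is available only for a fixed parameter, whereas the generator changes along
  the step functions. The integrand is cut along the finitely many level sets of v and on each it is
  continuous in q.\<close>

lemma integrable_on_simple_continuous:
  fixes \<Phi> :: "'v \<Rightarrow> real \<Rightarrow> complex"
  assumes v: "simple_function borel v" and \<Phi>: "\<And>a. continuous_on {0..} (\<Phi> a)"
  shows "(\<lambda>q. \<Phi> (v q) q) integrable_on {0..t}"
proof -
  let ?E = "\<lambda>a. v -` {a}"
  have fin: "finite (range v)" using simple_functionD(1)[OF v] by simp
  have E: "?E a \<in> sets borel" for a using simple_functionD(2)[OF v, of "{a}"] by simp
  have "(\<lambda>q. \<Sum>a\<in>range v. if q \<in> ?E a then \<Phi> a q else 0) integrable_on {0..t}"
  proof (intro integrable_sum fin)
    fix a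
    \<comment> \<open>Absolute integrability is what passes to an arbitrary measurable
      subset.\<close>
    have "\<Phi> a absolutely_integrable_on {0..t}"
      by (intro absolutely_integrable_continuous_real continuous_on_subset[OF \<Phi>]) auto
    moreover have "?E a \<inter> {0..t} \<in> sets lebesgue"
      using E[of a] by (auto intro!: sets.Int sets_completionI_sets)
    ultimately have "\<Phi> a absolutely_integrable_on (?E a \<inter> {0..t})"
      by (rule set_integrable_subset) auto
    then show "(\<lambda>q. if q \<in> ?E a then \<Phi> a q else 0) integrable_on {0..t}"
      unfolding integrable_restrict_Int by (rule set_lebesgue_integral_eq_integral(1))
  qed
  also have "(\<lambda>q. \<Sum>a\<in>range v. if q \<in> ?E a then \<Phi> a q else 0) = (\<lambda>q. \<Phi> (v q) q)"
    using fin by (auto simp: fun_eq_iff sum.delta')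
  finally show ?thesis .
qed

context coalgebra begin

text \<open>Picard iteration: the \<open>n\<close>-fold iterated integral equation bounds \<open>D r\<close> by
  \<open>K * (N * r) ^ n / n!\<close>.\<close>

lemma convolution_integral_equation_unique:
  fixes D \<psi> :: "real \<Rightarrow> 'h \<Rightarrow>\<^sub>L 'h \<Rightarrow> complex"
  assumes D: "\<And>q. 0 \<le> q \<Longrightarrow> q \<le> T \<Longrightarrow> D q \<in> bounded_functionals C"
    and \<psi>: "\<And>q. \<psi> q \<in> bounded_functionals C"
    and N: "0 \<le> N" "\<And>q x. x \<in> C \<Longrightarrow> cmod (\<psi> q x) \<le> N * norm x"
    and K: "0 \<le> K" "\<And>q x. 0 \<le> q \<Longrightarrow> q \<le> T \<Longrightarrow> x \<in> C \<Longrightarrow> cmod (D q x) \<le> K * norm x"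
    and eq: "\<And>r x. 0 \<le> r \<Longrightarrow> r \<le> T \<Longrightarrow> x \<in> C \<Longrightarrow> ((\<lambda>q. (D q \<star> \<psi> q) x) has_integral D r x) {0..r}"
    and r: "0 \<le> r" "r \<le> T" and x: "x \<in> C"
  shows "D r x = 0"
proof -
  have bound: "cmod (D r x) \<le> K * (N ^ n * (r ^ n / fact n)) * norm x" if "0 \<le> r" "r \<le> T" "x \<in> C" for n r x
    using that
  proof (induction n arbitrary: r x)
    case 0
    then show ?case using K(2) by simp
  next
    case (Suc n)
    have "((\<lambda>q. q ^ n / fact n) has_integral (r ^ Suc n / fact (Suc n) - 0 ^ Suc n / fact (Suc n))) {0..r}"
    proof (rule fundamental_theorem_of_calculus)
      fix q
      have "((\<lambda>q. q ^ Suc n / fact (Suc n)) has_real_derivative (real (Suc n) * q ^ n / fact (Suc n))) (at q within {0..r})"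
        using DERIV_cdivide[OF DERIV_pow[of "Suc n" q "{0..r}"], of "fact (Suc n)"]
        by (simp del: fact_Suc power_Suc of_nat_Suc)
      also have "real (Suc n) * q ^ n / fact (Suc n) = q ^ n / fact n"
        unfolding fact_Suc by (rule mult_divide_mult_cancel_left) simp
      finally show "((\<lambda>q. q ^ Suc n / fact (Suc n)) has_vector_derivative q ^ n / fact n) (at q within {0..r})"
        by (simp add: has_real_derivative_iff_has_vector_derivative)
    qed (use Suc.prems in simp)
    then have "((\<lambda>q. (K * N ^ Suc n * norm x) * (q ^ n / fact n)) has_integral (K * N ^ Suc n * norm x) * (r ^ Suc n / fact (Suc n))) {0..r}"
      by (intro has_integral_mult_right) simp
    moreover have "cmod ((D q \<star> \<psi> q) x) \<le> (K * N ^ Suc n * norm x) * (q ^ n / fact n)" if q: "q \<in> {0..r}" for q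
    proof -
      have "0 \<le> q" "q \<le> T" using q Suc.prems by auto
      then have "cmod ((D q \<star> \<psi> q) x) \<le> (K * (N ^ n * (q ^ n / fact n))) * N * norm x"
        using K(1) N Suc.prems(3) by (intro convolution_bound D \<psi> Suc.IH) auto
      then show ?thesis by (simp add: algebra_simps)
    qed
    ultimately have "cmod (D r x) \<le> (K * N ^ Suc n * norm x) * (r ^ Suc n / fact (Suc n))"
      using eq[OF Suc.prems] integral_norm_bound_integral[of "\<lambda>q. (D q \<star> \<psi> q) x" "{0..r}"]
      by (metis (no_types, lifting) has_integral_integrable_integral)
    then show ?case by (simp add: algebra_simps)
  qed
  have "(\<lambda>n. inverse (fact n) * (N * r) ^ n) \<longlonglongrightarrow> 0" by (rule summable_LIMSEQ_zero[OF summable_exp])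
  then have "(\<lambda>n. (K * norm x) * (inverse (fact n) * (N * r) ^ n)) \<longlonglongrightarrow> 0" by (rule tendsto_mult_right_zero)
  moreover have "cmod (D r x) \<le> (K * norm x) * (inverse (fact n) * (N * r) ^ n)" for n
    using bound[OF r x, of n] by (simp add: power_mult_distrib divide_inverse algebra_simps)
  ultimately have "cmod (D r x) \<le> 0" by (intro LIMSEQ_le_const) auto
  then show ?thesis by simp
qed

end

section \<open>Weak solutions\<close>

locale weak_qsde = coalgebra C \<epsilon> \<Delta>
  for C :: "('h::complex_hilbert \<Rightarrow>\<^sub>L 'h) set" and \<epsilon> \<Delta> +
  fixes \<phi> :: "('h \<Rightarrow>\<^sub>L 'h) \<Rightarrow> (complex \<times> 'k::complex_hilbert) \<Rightarrow>\<^sub>L (complex \<times> 'k)"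
    and l :: "real \<Rightarrow> ('h \<Rightarrow>\<^sub>L 'h) \<Rightarrow> 'k fock \<Rightarrow> 'k fock"
  assumes \<phi>: "\<phi> \<in> CB C bounded_ops" and weak_solution: "weak_solution C \<epsilon> \<Delta> \<phi> l"
begin

abbreviation gen :: "(real \<Rightarrow> 'k) \<Rightarrow> (real \<Rightarrow> 'k) \<Rightarrow> real \<Rightarrow> 'h \<Rightarrow>\<^sub>L 'h \<Rightarrow> complex" where
  "gen f' f s \<equiv> op_mat_el \<phi> (hat (f' s)) (hat (f s))"

text \<open>One M serves all vectors, so bounded step functions yield a bound on the generator that
  is uniform in time.\<close>

lemma op_mat_el_bound:
  obtains M where "0 \<le> M" "\<And>\<zeta>' \<zeta> x. x \<in> C \<Longrightarrow> cmod (op_mat_el \<phi> \<zeta>' \<zeta> x) \<le> (M * norm \<zeta>' * norm \<zeta>) * norm x"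
proof -
  obtain M where "cb_bound C \<phi> M" using \<phi> unfolding CB_def by blast
  note M = cb_bound_norm[OF this]
  have "cmod (op_mat_el \<phi> \<zeta>' \<zeta> x) \<le> (\<bar>M\<bar> * norm \<zeta>' * norm \<zeta>) * norm x" if x: "x \<in> C" for \<zeta>' \<zeta> x
  proof -
    have "cmod (op_mat_el \<phi> \<zeta>' \<zeta> x) \<le> norm \<zeta>' * (norm (\<phi> x) * norm \<zeta>)"
      unfolding op_mat_el_def by (intro order_trans[OF norm_cinner_le] mult_left_mono norm_blinfun norm_ge_zero)
    also have "\<dots> \<le> norm \<zeta>' * ((\<bar>M\<bar> * norm x) * norm \<zeta>)"
      using M[OF x] mult_right_mono[OF abs_ge_self[of M] norm_ge_zero[of x]]
      by (intro mult_left_mono mult_right_mono) auto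
    finally show ?thesis by (simp add: algebra_simps)
  qed
  then show ?thesis by (intro that[of "\<bar>M\<bar>"]) auto
qed

lemma op_mat_el_bounded: "op_mat_el \<phi> \<zeta>' \<zeta> \<in> bounded_functionals C"
proof -
  obtain M where "\<And>\<zeta>' \<zeta> x. x \<in> C \<Longrightarrow> cmod (op_mat_el \<phi> \<zeta>' \<zeta> x) \<le> (M * norm \<zeta>' * norm \<zeta>) * norm x"
    using op_mat_el_bound by metis
  moreover have "clinear_on C \<phi>" using \<phi> by (simp add: CB_def)
  then have "clinear_on C (op_mat_el \<phi> \<zeta>' \<zeta>)"
    by (simp add: clinear_on_def op_mat_el_def blinfun.add_left cinner_add_right
        scaleC_blinfun.rep_eq cinner_scaleC_right scaleC_complex_def)
  ultimately show ?thesis unfolding bounded_functionals_def by blast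
qed

lemma gen_bound:
  assumes f': "f' \<in> step_functions" and f: "f \<in> step_functions"
  obtains N where "0 \<le> N" "\<And>s x. x \<in> C \<Longrightarrow> cmod (gen f' f s x) \<le> N * norm x"
proof -
  obtain M where M: "0 \<le> M" "\<And>\<zeta>' \<zeta> x. x \<in> C \<Longrightarrow> cmod (op_mat_el \<phi> \<zeta>' \<zeta> x) \<le> (M * norm \<zeta>' * norm \<zeta>) * norm x"
    using op_mat_el_bound by metis
  obtain K' K where K': "\<And>s. norm (f' s) \<le> K'" and K: "\<And>s. norm (f s) \<le> K"
    using step_functions_bounded[OF f'] step_functions_bounded[OF f] by metis
  have hat: "norm (hat (g s)) \<le> 1 + L" if "\<And>s. norm (g s) \<le> L" for g :: "real \<Rightarrow> 'k" and s L
    using that[of s] norm_Pair_le[of "1::complex" "g s"] by (simp add: hat_def)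
  have pos: "0 \<le> 1 + K'" "0 \<le> 1 + K" using order_trans[OF norm_ge_zero K'[of 0]] order_trans[OF norm_ge_zero K[of 0]] by auto
  have "cmod (gen f' f s x) \<le> (M * (1 + K') * (1 + K)) * norm x" if "x \<in> C" for s x
    using hat[of f' K' s, OF K'] hat[of f K s, OF K] M(1) pos
    by (intro order_trans[OF M(2)[OF that]] mult_right_mono mult_mono) auto
  then show ?thesis using M(1) pos by (intro that[of "M * (1 + K') * (1 + K)"]) auto
qed

context
  fixes f' f :: "real \<Rightarrow> 'k"
  assumes f': "f' \<in> step_functions" and f: "f \<in> step_functions"
begin

lemma mat_el_bounded: "0 \<le> t \<Longrightarrow> mat_el l f' f t \<in> bounded_functionals C"
  using weak_solution f' f by (simp add: weak_solution_def weakly_bounded_process_def)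

lemma mat_el_adapted:
  "0 \<le> t \<Longrightarrow> x \<in> C \<Longrightarrow> mat_el l f' f t x =
    cinner (expv (restr {t..} f')) (expv (restr {t..} f)) * mat_el l (restr {0..<t} f') (restr {0..<t} f) t x"
  using weak_solution f' f by (simp add: weak_solution_def weakly_bounded_process_def process_on_def)

lemma mat_el_eq:
  "0 \<le> t \<Longrightarrow> x \<in> C \<Longrightarrow> mat_el l f' f t x =
    cinner (expv f') (expv f) * \<epsilon> x + integral {0..t} (\<lambda>s. (mat_el l f' f s \<star> gen f' f s) x)"
  using weak_solution f' f by (simp add: weak_solution_def)

lemma mat_el_integrable:
  assumes "x \<in> C"
  shows "(\<lambda>s. (mat_el l f' f s \<star> gen f' f s) x) integrable_on {0..t}"
proof -
  have "simple_function borel (\<lambda>s. (f' s, f s))"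
    by (rule simple_function_compose2[OF simple_function_step[OF f'] simple_function_step[OF f]])
  moreover have "continuous_on {0..} (\<lambda>s. (mat_el l f' f s \<star> op_mat_el \<phi> (hat (fst a)) (hat (snd a))) x)" for a
    using weak_solution f' f assms unfolding weak_solution_def by blast
  ultimately show ?thesis
    using integrable_on_simple_continuous[of "\<lambda>s. (f' s, f s)"
        "\<lambda>a s. (mat_el l f' f s \<star> op_mat_el \<phi> (hat (fst a)) (hat (snd a))) x" t] by simp
qed

lemma mat_el_uniform_bound:
  obtains K where "0 \<le> K" "\<And>t x. 0 \<le> t \<Longrightarrow> t \<le> T \<Longrightarrow> x \<in> C \<Longrightarrow> cmod (mat_el l f' f t x) \<le> K * norm x"
proof -
  have "\<exists>K. \<forall>t\<in>{0..T}. cmod (mat_el l f' f t x) \<le> K" if x: "x \<in> C" for x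
  proof -
    \<comment> \<open>For fixed x the equation exhibits the matrix element as a constant plus an
      indefinite integral, hence continuous and bounded on the compact interval. This is the
      pointwise bound that uniform boundedness requires.\<close>
    have "continuous_on {0..T} (\<lambda>t. cinner (expv f') (expv f) * \<epsilon> x + integral {0..t} (\<lambda>s. (mat_el l f' f s \<star> gen f' f s) x))"
      by (intro continuous_intros indefinite_integral_continuous_1 mat_el_integrable x)
    then have "compact ((\<lambda>t. cinner (expv f') (expv f) * \<epsilon> x + integral {0..t} (\<lambda>s. (mat_el l f' f s \<star> gen f' f s) x)) ` {0..T})"
      by (rule compact_continuous_image) simp
    then have "bounded ((\<lambda>t. mat_el l f' f t x) ` {0..T})"
      using mat_el_eq[OF _ x] by (auto dest!: compact_imp_bounded)
    then show ?thesis unfolding bounded_iff by auto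
  qed
  moreover have "clinear_on C (mat_el l f' f t)" "\<exists>M. \<forall>x\<in>C. cmod (mat_el l f' f t x) \<le> M * norm x"
    if "t \<in> {0..T}" for t
    using that mat_el_bounded[of t] by (auto simp: bounded_functionals_def)
  ultimately show ?thesis
    by - (rule uniform_boundedness[OF csubspace closed, of "{0..T}" "mat_el l f' f"]; simp add: that)
qed

lemma mat_el_lipschitz:
  obtains K where "0 \<le> K" "\<And>s t x. 0 \<le> s \<Longrightarrow> s \<le> t \<Longrightarrow> t \<le> T \<Longrightarrow> x \<in> C \<Longrightarrow>
    cmod (mat_el l f' f t x - mat_el l f' f s x) \<le> K * (t - s) * norm x"
proof -
  obtain N where N: "0 \<le> N" "\<And>s x. x \<in> C \<Longrightarrow> cmod (gen f' f s x) \<le> N * norm x"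
    using gen_bound[OF f' f] by metis
  obtain K where K: "0 \<le> K" "\<And>t x. 0 \<le> t \<Longrightarrow> t \<le> T \<Longrightarrow> x \<in> C \<Longrightarrow> cmod (mat_el l f' f t x) \<le> K * norm x"
    using mat_el_uniform_bound by metis
  have "cmod (mat_el l f' f t x - mat_el l f' f s x) \<le> (K * N) * (t - s) * norm x"
    if st: "0 \<le> s" "s \<le> t" "t \<le> T" and x: "x \<in> C" for s t x
  proof -
    let ?A = "\<lambda>s. (mat_el l f' f s \<star> gen f' f s) x"
    have "integral {0..s} ?A + integral {s..t} ?A = integral {0..t} ?A"
      by (rule Henstock_Kurzweil_Integration.integral_combine[OF st(1,2) mat_el_integrable[OF x]])
    then have "mat_el l f' f t x - mat_el l f' f s x = integral {s..t} ?A"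
      using st x by (simp add: mat_el_eq) (simp add: algebra_simps)
    moreover have "norm (integral {s..t} ?A) \<le> (K * N * norm x) * (t - s)"
    proof -
      have "norm (integral {s..t} ?A) \<le> integral {s..t} (\<lambda>_. K * N * norm x)"
      proof (rule integral_norm_bound_integral)
        show "?A integrable_on {s..t}"
          using integrable_on_subinterval[OF mat_el_integrable[OF x, of t], of s t] st by auto
        show "\<And>q. q \<in> {s..t} \<Longrightarrow> norm (?A q) \<le> K * N * norm x"
          using st x by (intro convolution_bound mat_el_bounded op_mat_el_bounded K N) auto
      qed (rule integrable_const_ivl)
      then show ?thesis using st by (simp add: mult_ac)
    qed
    ultimately show ?thesis by (simp add: algebra_simps)
  qed
  then show ?thesis using K(1) N(1) by (intro that[of "K * N"]) auto
qed

end

end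

context weak_qsde begin

section \<open>The cocycle identity\<close>

text \<open>Here f' and f are not cut off at s + t. The shifted functions on the right then do not
  depend on t, so both sides are solutions of a single equation in t.\<close>

lemma mat_el_cocycle_restricted:
  fixes f' f :: "real \<Rightarrow> 'k"
  assumes f': "f' \<in> step_functions" and f: "f \<in> step_functions" and s: "0 \<le> s" and t: "0 \<le> t" and x: "x \<in> C"
  shows "mat_el l f' f (s + t) x =
    (mat_el l (restr {0..<s} f') (restr {0..<s} f) s \<star> mat_el l (left_shift s f') (left_shift s f) t) x"
proof -
  define \<omega> where "\<omega> = mat_el l (restr {0..<s} f') (restr {0..<s} f) s"
  define h' h where "h' = left_shift s f'" and "h = left_shift s f"
  \<comment> \<open>\<open>e * \<omega>\<close> is the common initial value: adaptedness at s gives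
    it for G, the initial condition of the shifted equation for H.\<close>
  define e where "e = cinner (expv h') (expv h)"
  define G where "G q = mat_el l f' f (s + q)" for q
  define H where "H q = \<omega> \<star> mat_el l h' h q" for q
  define D where "D q y = G q y - H q y" for q y
  have h: "h' \<in> step_functions" "h \<in> step_functions"
    unfolding h'_def h_def by (intro step_functions_left_shift f' f s)+
  have \<omega>: "\<omega> \<in> bounded_functionals C"
    unfolding \<omega>_def by (intro mat_el_bounded step_functions_restr_lessThan f' f s)
  have G_in: "G q \<in> bounded_functionals C" if "0 \<le> q" for q
    unfolding G_def using s that by (intro mat_el_bounded f' f) simp
  have H_in: "H q \<in> bounded_functionals C" if "0 \<le> q" for q
    unfolding H_def by (intro convolution_bounded \<omega> mat_el_bounded h that)
  have D_in: "D q \<in> bounded_functionals C" if "0 \<le> q" for q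
    using bounded_functionals_diff[OF G_in[OF that] H_in[OF that]] by (simp add: D_def[abs_def])
  have gen_shift: "gen f' f (s + q) = gen h' h q" if "0 \<le> q" for q
    using that by (simp add: h'_def h_def left_shift_def add.commute)
  \<comment> \<open>Subtracting the equation at time s from that at s + r leaves the integral over
    the later interval, which is then translated to start at 0.\<close>
  have G_eq: "((\<lambda>q. (G q \<star> gen h' h q) y) has_integral G r y - e * \<omega> y) {0..r}" if r: "0 \<le> r" and y: "y \<in> C" for r y
  proof -
    let ?A = "\<lambda>q. (mat_el l f' f q \<star> gen f' f q) y"
    have A: "?A integrable_on {0..s + r}" by (rule mat_el_integrable[OF f' f y])
    have split: "integral {0..s} ?A + integral {s..s + r} ?A = integral {0..s + r} ?A"
      using s r by (intro Henstock_Kurzweil_Integration.integral_combine A) auto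
    have "?A integrable_on {s..s + r}"
      using integrable_on_subinterval[OF A, of s "s + r"] s r by auto
    then have "(?A has_integral integral {s..s + r} ?A) {0 + s..r + s}"
      by (simp add: has_integral_integral add.commute)
    then have "((\<lambda>q. ?A (s + q)) has_integral integral {s..s + r} ?A) {0..r}"
      unfolding has_integral_shift_Icc_real[symmetric] by (simp add: o_def)
    then have "((\<lambda>q. (G q \<star> gen h' h q) y) has_integral integral {s..s + r} ?A) {0..r}"
      by (rule has_integral_cong[THEN iffD1, rotated]) (simp add: G_def flip: gen_shift)
    moreover have "integral {s..s + r} ?A = G r y - G 0 y"
      using split s r unfolding G_def
      by (simp add: mat_el_eq[OF f' f _ y]) (simp add: algebra_simps)
    moreover have "G 0 y = e * \<omega> y"
      using mat_el_adapted[OF f' f s y] cinner_expv_left_shift[OF f' f s]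
      by (simp add: G_def \<omega>_def e_def h'_def h_def)
    ultimately show ?thesis by simp
  qed
  have H_eq: "((\<lambda>q. (H q \<star> gen h' h q) y) has_integral H r y - e * \<omega> y) {0..r}" if r: "0 \<le> r" and y: "y \<in> C" for r y
  proof -
    \<comment> \<open>Left convolution by \<omega> means evaluation at \<open>?y\<close>, so this is
      the equation for the shifted functions at a different element of C.\<close>
    let ?y = "slice_left C C \<omega> (\<Delta> y)"
    let ?B = "\<lambda>q. (mat_el l h' h q \<star> gen h' h q) ?y"
    have y': "?y \<in> C" by (rule slice_coproduct_in(1)[OF \<omega> \<omega> y])
    have "(?B has_integral integral {0..r} ?B) {0..r}"
      by (rule integrable_integral[OF mat_el_integrable[OF h y']])
    moreover have "?B q = (H q \<star> gen h' h q) y" if "q \<in> {0..r}" for q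
    proof -
      have q: "mat_el l h' h q \<in> bounded_functionals C" using that by (intro mat_el_bounded h) simp
      have "?B q = (\<omega> \<star> (mat_el l h' h q \<star> gen h' h q)) y"
        by (rule convolution_left[OF \<omega> convolution_bounded[OF q op_mat_el_bounded] y, symmetric])
      then show ?thesis unfolding H_def by (simp only: convolution_assoc[OF \<omega> q op_mat_el_bounded y])
    qed
    ultimately have "((\<lambda>q. (H q \<star> gen h' h q) y) has_integral integral {0..r} ?B) {0..r}"
      by (rule has_integral_cong[THEN iffD1, rotated])
    moreover have "H r y = e * \<omega> y + integral {0..r} ?B"
    proof -
      have "H r y = mat_el l h' h r ?y"
        unfolding H_def by (rule convolution_left[OF \<omega> mat_el_bounded[OF h r] y])
      moreover have "\<epsilon> ?y = \<omega> y"
        using convolution_left[OF \<omega> counit_bounded y] convolution_counit[OF \<omega> y] by simp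
      ultimately show ?thesis using mat_el_eq[OF h r y'] by (simp add: e_def)
    qed
    ultimately show ?thesis by simp
  qed
  obtain N where N: "0 \<le> N" "\<And>q x. x \<in> C \<Longrightarrow> cmod (gen h' h q x) \<le> N * norm x"
    using gen_bound[OF h] by metis
  obtain K1 where K1: "0 \<le> K1" "\<And>q x. 0 \<le> q \<Longrightarrow> q \<le> s + t \<Longrightarrow> x \<in> C \<Longrightarrow> cmod (mat_el l f' f q x) \<le> K1 * norm x"
    using mat_el_uniform_bound[OF f' f] by metis
  obtain K2 where K2: "0 \<le> K2" "\<And>q x. 0 \<le> q \<Longrightarrow> q \<le> t \<Longrightarrow> x \<in> C \<Longrightarrow> cmod (mat_el l h' h q x) \<le> K2 * norm x"
    using mat_el_uniform_bound[OF h] by metis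
  obtain K3 where K3: "0 \<le> K3" "\<And>x. x \<in> C \<Longrightarrow> cmod (\<omega> x) \<le> K3 * norm x"
    using bounded_functionals_bound[OF \<omega>] by metis
  \<comment> \<open>The inhomogeneous terms cancel in D. Its bound adds K1 from G and, by
    submultiplicativity, K3 * K2 from H.\<close>
  have "D t x = 0"
  proof (rule convolution_integral_equation_unique[where T = t and \<psi> = "gen h' h" and N = N and K = "K1 + K3 * K2"])
    show "cmod (D q y) \<le> (K1 + K3 * K2) * norm y" if q: "0 \<le> q" "q \<le> t" and y: "y \<in> C" for q y
    proof -
      have "cmod (G q y) \<le> K1 * norm y" unfolding G_def using s q y by (intro K1) auto
      moreover have "cmod (H q y) \<le> K3 * K2 * norm y"
        unfolding H_def using q y by (intro convolution_bound \<omega> mat_el_bounded h K2 K3) auto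
      ultimately show ?thesis
        using norm_triangle_ineq4[of "G q y" "H q y"] by (simp add: D_def algebra_simps)
    qed
    show "((\<lambda>q. (D q \<star> gen h' h q) y) has_integral D r y) {0..r}" if r: "0 \<le> r" and y: "y \<in> C" for r y
    proof -
      have "((\<lambda>q. (G q \<star> gen h' h q) y - (H q \<star> gen h' h q) y) has_integral D r y) {0..r}"
        using has_integral_diff[OF G_eq[OF r y] H_eq[OF r y]] by (simp add: D_def)
      then show ?thesis
        by (rule has_integral_cong[THEN iffD1, rotated])
          (simp add: D_def[abs_def] convolution_diff_left[OF G_in H_in op_mat_el_bounded y])
    qed
  qed (use N K1(1) K2(1) K3(1) t x in \<open>auto intro: D_in op_mat_el_bounded\<close>)
  then show ?thesis by (simp add: D_def G_def H_def \<omega>_def h'_def h_def)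
qed

text \<open>Adaptedness at s + t splits off the scalar and cuts the functions there; before s and
  between s and s + t the cut has no effect.\<close>

lemma mat_el_cocycle:
  fixes f' f :: "real \<Rightarrow> 'k"
  assumes f': "f' \<in> step_functions" and f: "f \<in> step_functions" and s: "0 \<le> s" and t: "0 \<le> t" and x: "x \<in> C"
  shows "mat_el l f' f (s + t) x =
    cinner (expv (restr {s + t..} f')) (expv (restr {s + t..} f)) *
    (mat_el l (restr {0..<s} f') (restr {0..<s} f) s \<star>
      mat_el l (left_shift s (restr {s..<s + t} f')) (left_shift s (restr {s..<s + t} f)) t) x"
proof -
  have st: "0 \<le> s + t" using s t by simp
  have eq: "restr {0..<s} (restr {0..<s + t} g) = restr {0..<s} g"
    "left_shift s (restr {0..<s + t} g) = left_shift s (restr {s..<s + t} g)" for g :: "real \<Rightarrow> 'k"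
    using s t by (auto simp: restr_def left_shift_def fun_eq_iff)
  show ?thesis
    unfolding mat_el_adapted[OF f' f st x]
      mat_el_cocycle_restricted[OF step_functions_restr_lessThan[OF f' st] step_functions_restr_lessThan[OF f st] s t x] eq ..
qed

lemma weak_cocycle: "weak_cocycle C \<Delta> l"
  using weak_solution mat_el_cocycle unfolding weak_cocycle_def weak_solution_def by simp

section \<open>The associated convolution semigroups\<close>

abbreviation const_on :: "'k \<Rightarrow> real \<Rightarrow> real \<Rightarrow> 'k" where "const_on c t \<equiv> restr {0..<t} (\<lambda>_. c)"

lemma convolution_semigroup: "convolution_semigroup C \<epsilon> \<Delta> (associated_semigroup l c' c)"
  unfolding convolution_semigroup_def
proof (intro conjI allI impI ballI)
  have bounded: "mat_el l (const_on c' t) (const_on c t) t \<in> bounded_functionals C" if "0 \<le> t" for t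
    using that by (intro mat_el_bounded restr_in_step_functions)
  show "associated_semigroup l c' c t \<in> bounded_functionals C" if "0 \<le> t" for t
    using bounded_functionals_scale[OF bounded[OF that]] by (simp add: associated_semigroup_def[abs_def])
  have zero: "restr {} (\<lambda>_. d) = (\<lambda>_. 0)" for d :: 'k by (auto simp: restr_def)
  show "associated_semigroup l c' c 0 x = \<epsilon> x" if "x \<in> C" for x
    using mat_el_eq[OF step_functions_zero step_functions_zero order_refl that]
    by (simp add: associated_semigroup_def zero cinner_expv square_integrable_zero)
  show "associated_semigroup l c' c (s + t) x = (associated_semigroup l c' c s \<star> associated_semigroup l c' c t) x"
    if s: "0 \<le> s" and t: "0 \<le> t" and x: "x \<in> C" for s t x
  proof -
    \<comment> \<open>Constants are shift invariant: both pieces of a constant on an interval of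
      length s + t are again constants on initial intervals, which turns the cocycle identity into a
      semigroup law.\<close>
    have eq: "restr {0..<s} (const_on d (s + t)) = const_on d s" "left_shift s (const_on d (s + t)) = const_on d t" for d
      using s t by (auto simp: restr_def left_shift_def fun_eq_iff)
    let ?a = "\<lambda>t. exp (- complex_of_real t * cinner c' c)" and ?F = "\<lambda>t. mat_el l (const_on c' t) (const_on c t) t"
    have "?F (s + t) x = (?F s \<star> ?F t) x"
      using mat_el_cocycle_restricted[OF restr_in_step_functions restr_in_step_functions s t x, of "s + t" "s + t" c' c] s t
      by (simp add: eq)
    moreover have "((\<lambda>x. ?a s * ?F s x) \<star> (\<lambda>x. ?a t * ?F t x)) x = ?a s * ?a t * (?F s \<star> ?F t) x"
    proof -
      \<comment> \<open>The right slice leaves the first functional outermost, so its scalar comes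
        out pointwise; the left slice then does the same for the second.\<close>
      have "((\<lambda>x. ?a s * ?F s x) \<star> (\<lambda>x. ?a t * ?F t x)) x = ?a s * (?F s \<star> (\<lambda>x. ?a t * ?F t x)) x"
        by (simp add: convolution_right[OF _ _ x] bounded bounded_functionals_scale s t)
      also have "\<dots> = ?a s * (?a t * (?F s \<star> ?F t) x)"
        by (simp add: convolution_left[OF _ _ x] bounded bounded_functionals_scale s t)
      finally show ?thesis by (simp add: mult.assoc)
    qed
    moreover have "?a (s + t) = ?a s * ?a t" by (simp add: algebra_simps flip: exp_add)
    ultimately show ?thesis unfolding associated_semigroup_def[abs_def] by (simp only:)
  qed
qed

text \<open>On \<open>[0, T]\<close> the semigroup is a multiple of the solution along the constant functions cut
  off at the fixed time \<open>T\<close>, which is Lipschitz in norm.\<close>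

lemma norm_continuous: "norm_continuous C (associated_semigroup l c' c)"
  unfolding norm_continuous_def
proof (intro allI impI)
  fix t :: real assume t: "0 \<le> t"
  \<comment> \<open>Any T beyond t would do: the interval from 0 to T has to contain all nonnegative
    times near t, on both sides.\<close>
  define T where "T = t + 1"
  let ?F = "mat_el l (const_on c' T) (const_on c T)"
  let ?S = "associated_semigroup l c' c"
  have step: "const_on d T \<in> step_functions" for d using t by (intro restr_in_step_functions) (simp add: T_def)
  have eq: "?S s x = exp (- complex_of_real T * cinner c' c) * ?F s x" if s: "0 \<le> s" "s \<le> T" and x: "x \<in> C" for s x
  proof -
    have "restr {0..<s} (const_on d T) = const_on d s" for d using s by (auto simp: restr_def)
    then have "?F s x = exp (complex_of_real (T - s) * cinner c' c) * mat_el l (const_on c' s) (const_on c s) s x"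
      using mat_el_adapted[OF step step s(1) x] cinner_expv_interval[OF s, of c' c] by simp
    then have "exp (- complex_of_real T * cinner c' c) * ?F s x =
        exp (- complex_of_real T * cinner c' c + complex_of_real (T - s) * cinner c' c) * mat_el l (const_on c' s) (const_on c s) s x"
      by (simp only: exp_add mult.assoc)
    also have "- complex_of_real T * cinner c' c + complex_of_real (T - s) * cinner c' c = - complex_of_real s * cinner c' c"
      by (simp add: algebra_simps)
    finally show ?thesis by (simp add: associated_semigroup_def)
  qed
  obtain K where K: "0 \<le> K" "\<And>s t x. 0 \<le> s \<Longrightarrow> s \<le> t \<Longrightarrow> t \<le> T \<Longrightarrow> x \<in> C \<Longrightarrow>
      cmod (?F t x - ?F s x) \<le> K * (t - s) * norm x"
    using mat_el_lipschitz[OF step step] by metis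
  define L where "L = cmod (exp (- complex_of_real T * cinner c' c)) * K"
  have lip: "cmod (?S s x - ?S t x) \<le> L * \<bar>s - t\<bar>" if s: "0 \<le> s" "s \<le> T" and x: "x \<in> C" "norm x \<le> 1" for s x
  proof -
    have "cmod (?F s x - ?F t x) \<le> K * \<bar>s - t\<bar> * norm x"
      using K(2)[of s t x] K(2)[of t s x] s t x by (cases "s \<le> t") (auto simp: T_def norm_minus_commute)
    also have "\<dots> \<le> K * \<bar>s - t\<bar> * 1" using K(1) x(2) by (intro mult_left_mono) auto
    finally have "cmod (exp (- complex_of_real T * cinner c' c) * (?F s x - ?F t x)) \<le> L * \<bar>s - t\<bar>"
      unfolding norm_mult L_def by (simp add: mult_left_mono mult.assoc)
    moreover have "?S s x - ?S t x = exp (- complex_of_real T * cinner c' c) * (?F s x - ?F t x)"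
      using eq[OF s x(1)] eq[OF t _ x(1)] by (simp add: T_def right_diff_distrib)
    ultimately show ?thesis by simp
  qed
  have norm: "\<bar>functional_norm C (\<lambda>x. ?S s x - ?S t x)\<bar> \<le> L * \<bar>s - t\<bar>" if s: "0 \<le> s" "s \<le> T" for s
  proof -
    let ?B = "{x \<in> C. norm x \<le> 1}" and ?g = "\<lambda>x. cmod (?S s x - ?S t x)"
    \<comment> \<open>The element 0 makes the index set nonempty and the supremum nonnegative, as
      the bound on its absolute value requires.\<close>
    have zero: "0 \<in> ?B" using complex_module.subspace_0[OF csubspace] by simp
    have le: "?g x \<le> L * \<bar>s - t\<bar>" if "x \<in> ?B" for x using lip[OF s] that by simp
    have "bdd_above (?g ` ?B)" using le by (rule bdd_aboveI2)
    then have "?g 0 \<le> (SUP x\<in>?B. ?g x)" using zero by (rule cSUP_upper[rotated])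
    then have "0 \<le> (SUP x\<in>?B. ?g x)" using norm_ge_zero order_trans by blast
    moreover have "(SUP x\<in>?B. ?g x) \<le> L * \<bar>s - t\<bar>" using zero le by (intro cSUP_least) auto
    ultimately show ?thesis unfolding functional_norm_def by simp
  qed
  show "((\<lambda>s. functional_norm C (\<lambda>x. ?S s x - ?S t x)) \<longlongrightarrow> 0) (at t within {0..})"
  proof (rule Lim_null_comparison)
    have "\<forall>\<^sub>F s in at t within {0..}. s \<in> {..<T}"
      by (rule topological_tendstoD[OF tendsto_ident_at]) (auto simp: T_def)
    moreover have "\<forall>\<^sub>F s in at t within {0..}. s \<in> {0..}" by (simp add: eventually_at_filter)
    ultimately show "\<forall>\<^sub>F s in at t within {0..}. norm (functional_norm C (\<lambda>x. ?S s x - ?S t x)) \<le> L * \<bar>s - t\<bar>"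
      by eventually_elim (use norm in auto)
    have "((\<lambda>s. L * \<bar>s - t\<bar>) \<longlongrightarrow> L * \<bar>t - t\<bar>) (at t within {0..})" by (intro tendsto_intros)
    then show "((\<lambda>s. L * \<bar>s - t\<bar>) \<longlongrightarrow> 0) (at t within {0..})" by simp
  qed
qed

end

theorem proposition4p2:
  fixes C :: "('h::complex_hilbert \<Rightarrow>\<^sub>L 'h) set"
    and \<epsilon> :: "('h \<Rightarrow>\<^sub>L 'h) \<Rightarrow> complex"
    and \<Delta> :: "('h \<Rightarrow>\<^sub>L 'h) \<Rightarrow> ('h, 'h) htens \<Rightarrow>\<^sub>L ('h, 'h) htens"
    and \<phi> :: "('h \<Rightarrow>\<^sub>L 'h) \<Rightarrow> (complex \<times> 'k::complex_hilbert) \<Rightarrow>\<^sub>L (complex \<times> 'k)"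
    and l :: "real \<Rightarrow> ('h \<Rightarrow>\<^sub>L 'h) \<Rightarrow> 'k fock \<Rightarrow> 'k fock"
  assumes "operator_space_coalgebra C \<epsilon> \<Delta>"
    and "\<phi> \<in> CB C bounded_ops"
    and "weak_solution C \<epsilon> \<Delta> \<phi> l"
  shows "weak_cocycle C \<Delta> l \<and> markov_regular C l \<and>
    (\<forall>c' c. convolution_semigroup C \<epsilon> \<Delta> (associated_semigroup l c' c) \<and>
            norm_continuous C (associated_semigroup l c' c))"
proof -
  interpret weak_qsde C \<epsilon> \<Delta> \<phi> l using assms by unfold_locales
  show ?thesis
    using weak_cocycle convolution_semigroup norm_continuous by (simp add: markov_regular_def)
qed

end
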